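(* There is a dense $G_{\delta}$ subset $\mathcal{G}$ of $C_{\lambda}(\mathbb{S}^1)$ such that: (1) each $g \in \mathcal{G}$ is weakly mixing with respect to $\lambda$; (2) for each pair $\alpha,\beta\in [0,1)$ and each $f\in \mathcal{G}$ the map $T_{\alpha,\beta}(f)$ belongs to $\mathcal{G}$.
   Context: The circle $\mathbb{S}^1$ is identified with $[0,1)$ (i.e. $\mathbb{R}/\mathbb{Z}$) and $\lambda$ denotes normalized Lebesgue measure on $\mathbb{S}^1$; $\mathcal{B}$ denotes the Borel sets of $\mathbb{S}^1$. $C_{\lambda}(\mathbb{S}^1)$ is the set of all continuous maps $f:\mathbb{S}^1\to\mathbb{S}^1$ that preserve $\lambda$, equipped with the uniform metric $\rho(f,g)=\sup_{x\in\mathbb{S}^1}|f(x)-g(x)|$, where $|\cdot|$ is distance on the circle. A map $f\in C_\lambda(\mathbb{S}^1)$ is weakly mixing with respect to $\lambda$ if for every $A,B\in\mathcal{B}$, $\lim_{n\to\infty}\frac1n\sum_{j=0}^{n-1}|\lambda(f^{-j}(A)\cap B)-\lambda(A)\lambda(B)|=0$. For $\alpha\in[0,1)$, $r_\alpha:\mathbb{S}^1\to\mathbb{S}^1$ is the rotation $r_\alpha(x)=x+\alpha \pmod 1$. For $(\alpha,\beta)\in[0,1)^2$, $T_{\alpha,\beta}:C_\lambda(\mathbb{S}^1)\to C_\lambda(\mathbb{S}^1)$ is defined by $T_{\alpha,\beta}(f)=r_\alpha\circ f\circ r_\beta$. *)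

theory Defs
  imports "HOL-Analysis.Analysis" "HOL-Probability.Probability_Measure"
begin

section \<open>The circle as the half-open unit interval with the quotient metric\<close>

typedef circle = "{0..<1::real}"
  morphisms coord Abs_circle
  by (rule exI[of _ 0]) simp

setup_lifting type_definition_circle

lift_definition circle_of :: "real \<Rightarrow> circle" is frac
  by (simp add: frac_lt_1)

lemma coord_ge_0 [simp]: "0 \<le> coord x"
  and coord_less_1 [simp]: "coord x < 1"
  using coord[of x] by auto

lemma coord_circle_of [simp]: "coord (circle_of t) = frac t"
  by (rule circle_of.rep_eq)

lemma circle_of_coord [simp]: "circle_of (coord x) = x"
  by (simp add: coord_inject[symmetric] frac_eq)

text \<open>The distance is the length of the shorter of the two arcs between the points.\<close>

instantiation circle :: metric_space
begin

definition dist_circle :: "circle \<Rightarrow> circle \<Rightarrow> real" where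
  "dist_circle x y = min \<bar>coord x - coord y\<bar> (1 - \<bar>coord x - coord y\<bar>)"

definition uniformity_circle :: "(circle \<times> circle) filter" where
  "uniformity_circle = (INF e\<in>{0<..}. principal {(x, y). dist x y < e})"

definition open_circle :: "circle set \<Rightarrow> bool" where
  "open_circle U = (\<forall>x\<in>U. \<forall>\<^sub>F (x', y) in uniformity. x' = x \<longrightarrow> y \<in> U)"

instance
proof
  fix x y z :: circle
  have bounds: "0 \<le> coord x" "coord x < 1" "0 \<le> coord y" "coord y < 1"
    "0 \<le> coord z" "coord z < 1"
    by simp_all
  show "dist x y = 0 \<longleftrightarrow> x = y"
    using bounds unfolding dist_circle_def coord_inject[symmetric] by linarith
  show "dist x y \<le> dist x z + dist y z"
    using bounds unfolding dist_circle_def by linarith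
qed (simp_all add: uniformity_circle_def open_circle_def)

end

lemma dist_circle_le_half: "dist x y \<le> 1 / 2" for x y :: circle
  by (simp add: dist_circle_def min_def)

lemma dist_circle_of_le: "dist (circle_of s) (circle_of t) \<le> \<bar>s - t\<bar>"
proof -
  define m :: int where "m = \<lfloor>s\<rfloor> - \<lfloor>t\<rfloor>"
  have st: "s - t = frac s - frac t + of_int m"
    by (simp add: m_def frac_def)
  have b: "0 \<le> frac s" "frac s < 1" "0 \<le> frac t" "frac t < 1"
    by (simp_all add: frac_lt_1)
  consider "m = 0" | "1 \<le> m" | "m \<le> -1" by linarith
  then show ?thesis
  proof cases
    case 1
    then show ?thesis using st by (simp add: dist_circle_def)
  next
    case 2
    then have "(1::real) \<le> of_int m" by simp
    then show ?thesis
      using st b unfolding dist_circle_def min_def abs_if by simp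
  next
    case 3
    then have "of_int m \<le> (-1::real)" by linarith
    then show ?thesis
      using st b unfolding dist_circle_def min_def abs_if by simp
  qed
qed

lemma continuous_on_circle_of: "continuous_on A circle_of"
proof (rule continuous_onI)
  fix x e :: real
  assume "0 < e"
  then show "\<exists>d>0. \<forall>x'\<in>A. dist x' x < d \<longrightarrow> dist (circle_of x') (circle_of x) \<le> e"
    by (metis dist_circle_of_le dist_real_def order.trans less_imp_le)
qed

definition circle_measure :: "circle measure" where
  "circle_measure = distr (restrict_space lborel {0..<1}) borel circle_of"

lemma sets_circle_measure [simp, measurable_cong]: "sets circle_measure = sets borel"
  and space_circle_measure [simp]: "space circle_measure = UNIV"
  by (simp_all add: circle_measure_def)

lemma prob_space_circle_measure: "prob_space circle_measure"
  unfolding circle_measure_def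
proof (rule prob_space.prob_space_distr)
  show "prob_space (restrict_space lborel {0..<1::real})"
    by (rule prob_spaceI) (simp add: emeasure_restrict_space)
  have "circle_of \<in> borel_measurable lborel"
    using borel_measurable_continuous_onI[OF continuous_on_circle_of[of UNIV]] by simp
  then show "circle_of \<in> borel_measurable (restrict_space lborel {0..<1})"
    by (rule measurable_restrict_space1)
qed


section \<open>Continuous maps preserving Lebesgue measure\<close>

definition C_leb :: "(circle \<Rightarrow> circle) set" where
  "C_leb = {f. continuous_on UNIV f \<and>
     (\<forall>A\<in>sets borel. emeasure circle_measure (f -` A) = emeasure circle_measure A)}"

definition unif_dist :: "(circle \<Rightarrow> circle) \<Rightarrow> (circle \<Rightarrow> circle) \<Rightarrow> real" where
  "unif_dist f g = (SUP x. dist (f x) (g x))"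

lemma Metric_space_C_leb: "Metric_space C_leb unif_dist"
proof
  have upper: "dist (f x) (g x) \<le> unif_dist f g" for f g :: "circle \<Rightarrow> circle" and x
    unfolding unif_dist_def
    by (rule cSUP_upper) (auto intro!: bdd_aboveI2[of _ _ "1/2"] dist_circle_le_half)
  have least: "unif_dist f g \<le> c" if "\<And>x. dist (f x) (g x) \<le> c"
    for f g :: "circle \<Rightarrow> circle" and c
    unfolding unif_dist_def by (rule cSUP_least) (use that in auto)
  fix f g h :: "circle \<Rightarrow> circle"
  show nonneg: "0 \<le> unif_dist f g"
    using upper[of f undefined g] zero_le_dist order.trans by blast
  show "unif_dist f g = unif_dist g f"
    by (simp add: unif_dist_def dist_commute)
  show "unif_dist f g = 0 \<longleftrightarrow> f = g"
  proof
    assume "unif_dist f g = 0"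
    then show "f = g" using upper[of f _ g] by (auto simp: fun_eq_iff)
  next
    assume "f = g"
    then show "unif_dist f g = 0" by (simp add: unif_dist_def)
  qed
  show "unif_dist f h \<le> unif_dist f g + unif_dist g h"
  proof (rule least)
    fix x
    have "dist (f x) (h x) \<le> dist (f x) (g x) + dist (g x) (h x)"
      by (rule dist_triangle)
    also have "\<dots> \<le> unif_dist f g + unif_dist g h"
      by (intro add_mono upper)
    finally show "dist (f x) (h x) \<le> unif_dist f g + unif_dist g h" .
  qed
qed

definition C_leb_topology :: "(circle \<Rightarrow> circle) topology" where
  "C_leb_topology = Metric_space.mtopology C_leb unif_dist"

definition weakly_mixing :: "(circle \<Rightarrow> circle) \<Rightarrow> bool" where
  "weakly_mixing f \<longleftrightarrow>
     (\<forall>A\<in>sets borel. \<forall>B\<in>sets borel.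
        (\<lambda>n. (\<Sum>j<n. \<bar>measure circle_measure ((f ^^ j) -` A \<inter> B)
                   - measure circle_measure A * measure circle_measure B\<bar>) / real n)
        \<longlonglongrightarrow> 0)"

definition rotation :: "real \<Rightarrow> circle \<Rightarrow> circle" where
  "rotation \<alpha> x = circle_of (coord x + \<alpha>)"

definition two_sided_rotation :: "real \<Rightarrow> real \<Rightarrow> (circle \<Rightarrow> circle) \<Rightarrow> circle \<Rightarrow> circle" where
  "two_sided_rotation \<alpha> \<beta> f = rotation \<alpha> \<circ> f \<circ> rotation \<beta>"

end

theory Submission
  imports Defs
begin

text \<open>
Weak mixing of all the maps $r_\alpha \circ f \circ r_\beta$ simultaneously is expressed by
  conditions that are open in \<open>f\<close>, and each condition is shown to be dense; completeness of the
  space of maps and Baire's theorem then give the set. Invariance under two-sided rotations costs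
  nothing, because the conditions quantify over all pairs of angles and rotations compose.

  \<^emph>\<open>The open condition.\<close> Let $\phi$ be the indicator of an arc minus its mean, and
  $c_{ij} = \int (\phi \circ T^i)(\phi \circ T^j)$. If $\sum_{i,j<m} |c_{ij}| \le \epsilon m^2$ for a
  single \<open>m\<close>, then for every Borel set \<open>B\<close> the sum of $|\int (\phi \circ T^j) 1_B|$ over any block
  of \<open>m\<close> consecutive times is at most $\sqrt{\epsilon}\, m$, by Cauchy-Schwarz and
  stationarity (\<open>correlation_block_bound\<close>). Cutting the time axis into blocks bounds the limit superior
  of the Cesaro means, so that one good \<open>m\<close> for each $\epsilon$ and each rational arc already gives
  weak mixing. The condition involves finitely many iterates only, and the pair of angles ranges
  over a compact set; hence it is open in \<open>f\<close> (\<open>openin_nearly_mixing\<close>).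

  \<^emph>\<open>Density.\<close> Given $g$, fold each of \<open>N\<close> equal cells of the circle \<open>m\<close> times over itself, fold the
  cells of a partition shifted by a third of a cell three times, and then apply \<open>g\<close>. Each folding preserves the
  measure and moves points by at most $1/N$, so for large \<open>N\<close> the composite is close to \<open>g\<close> whatever \<open>m\<close> is.
  On the other hand, as \<open>m\<close> grows, the fold of the cells acts on densities like the conditional
  expectation on the cells (\<open>fold_defect_tendsto\<close>). In the limit the dynamics, seen through cell
  averages, is a product of two steps: a doubly stochastic matrix, which depends on \<open>g\<close> and on the
  rotation and of which nothing is known except that it does not increase the Euclidean norm, and a weighted average
  of neighbouring cells, which comes from the shifted folds and contracts vectors of mean zero by a factor
  that depends on \<open>N\<close> alone (\<open>cyclic_averaging_contracts\<close>). Thus all correlations at a large time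
  distance are small, uniformly in the angles (\<open>cell_energy_step\<close>,
  \<open>folded_decorrelates\<close>), which is what the open condition asks for.

  The uniformity in the angles of the convergence for $m \to \infty$ is the point that needs care,
  since \<open>m\<close> has to be chosen before the angles. It holds because the densities to which the fold is applied are
  rotations of finitely many fixed integrable functions, and an integrable function is close to
  a continuous one, whose rotations are equicontinuous.
\<close>

section \<open>Rotations and topology of the circle\<close>

lemma circle_of_add_int [simp]: "circle_of (t + of_int k) = circle_of t"
  by (simp add: coord_inject[symmetric] frac_def)

lemma rotation_circle_of [simp]: "rotation a (circle_of t) = circle_of (t + a)"
proof -
  have "t + a = (frac t + a) + of_int \<lfloor>t\<rfloor>" by (simp add: frac_def)
  then show ?thesis unfolding rotation_def coord_circle_of by (metis circle_of_add_int)
qed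

lemma rotation_rotation [simp]: "rotation a (rotation b x) = rotation (b + a) x"
  unfolding rotation_def[of b x] by (simp add: rotation_def[of "b + a"] add.assoc)

lemma rotation_0 [simp]: "rotation 0 x = x"
  by (simp add: rotation_def)

lemma rotation_add_int [simp]: "rotation (a + of_int k) x = rotation a x"
  unfolding rotation_def using circle_of_add_int[of "coord x + a" k] by (simp add: add.assoc)

text \<open>The circle distance is attained by suitable real representatives. This turns Lipschitz bounds for
lifts into Lipschitz bounds on the circle.\<close>

lemma circle_lift:
  obtains t where "circle_of t = y" "\<bar>coord x - t\<bar> = dist x y"
proof (cases "\<bar>coord x - coord y\<bar> \<le> 1 - \<bar>coord x - coord y\<bar>")
  case True
  then have "\<bar>coord x - coord y\<bar> = dist x y" by (simp add: dist_circle_def min_def)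
  then show ?thesis by (intro that[of "coord y"]) simp_all
next
  case False
  have b: "coord x < 1" "coord y < 1" "0 \<le> coord x" "0 \<le> coord y" by simp_all
  have d: "dist x y = 1 - \<bar>coord x - coord y\<bar>" using False by (simp add: dist_circle_def min_def)
  show ?thesis
  proof (cases "coord x < coord y")
    case True
    have "circle_of (coord y + of_int (- 1)) = y" by (simp only: circle_of_add_int circle_of_coord)
    moreover have "\<bar>coord x - (coord y - 1)\<bar> = dist x y" using True d b by linarith
    ultimately show ?thesis by (intro that[of "coord y - 1"]) simp_all
  next
    case False
    have "circle_of (coord y + of_int 1) = y" by (simp only: circle_of_add_int circle_of_coord)
    moreover have "\<bar>coord x - (coord y + 1)\<bar> = dist x y" using False d b by linarith
    ultimately show ?thesis by (intro that[of "coord y + 1"]) simp_all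
  qed
qed

text \<open>Continuity at the point where the coordinate jumps from 1 to 0 needs no separate argument when the map has a Lipschitz
lift to the line.\<close>

lemma lipschitz_degree_one_continuous:
  assumes "\<And>s t. \<bar>Z s - Z t\<bar> \<le> L * \<bar>s - t\<bar>" "\<And>t. F (circle_of t) = circle_of (Z t)"
  shows "continuous_on UNIV F"
proof (rule continuous_onI)
  fix x e :: real and x' :: circle
  assume e: "0 < e"
  have "0 \<le> L" using assms(1)[of 1 0] by simp
  have *: "dist (F y) (F x') \<le> L * dist y x'" for y
  proof -
    obtain t where t: "circle_of t = x'" "\<bar>coord y - t\<bar> = dist y x'" by (rule circle_lift)
    have "dist (F y) (F x') = dist (circle_of (Z (coord y))) (circle_of (Z t))"
      by (metis assms(2) circle_of_coord t(1))
    also have "\<dots> \<le> \<bar>Z (coord y) - Z t\<bar>" by (rule dist_circle_of_le)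
    also have "\<dots> \<le> L * dist y x'" using assms(1) t(2) by metis
    finally show ?thesis .
  qed
  show "\<exists>d>0. \<forall>y\<in>UNIV. dist y x' < d \<longrightarrow> dist (F y) (F x') \<le> e"
  proof (intro exI conjI ballI impI)
    show "0 < e / (L + 1)" using e \<open>0 \<le> L\<close> by simp
    fix y assume "dist y x' < e / (L + 1)"
    then have "(L + 1) * dist y x' \<le> e" using \<open>0 \<le> L\<close> by (simp add: field_simps)
    then show "dist (F y) (F x') \<le> e" using *[of y] zero_le_dist[of y x'] 
      by (smt (verit) distrib_right mult_cancel_right1)
  qed
qed

lemma continuous_rotation: "continuous_on UNIV (rotation a)"
  by (rule lipschitz_degree_one_continuous[of "\<lambda>t. t + a" 1]) auto

lemma compact_UNIV_circle: "compact (UNIV :: circle set)"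
proof -
  have "compact (circle_of ` {0..1})"
    by (intro compact_continuous_image continuous_on_circle_of) simp
  moreover have "circle_of ` {0..1} = UNIV"
  proof -
    have "x \<in> circle_of ` {0..1}" for x
      by (intro image_eqI[of _ _ "coord x"]) (simp_all add: less_imp_le)
    then show ?thesis by blast
  qed
  ultimately show ?thesis by simp
qed

lemma dist_rotation_angle: "dist (rotation a x) (rotation b x) \<le> \<bar>a - b\<bar>"
  using dist_circle_of_le[of "coord x + a" "coord x + b"] by (simp add: rotation_def)

lemma dist_rotation [simp]: "dist (rotation a x) (rotation a y) = dist x y"
proof -
  have le: "dist (rotation a x) (rotation a y) \<le> dist x y" for a x y
  proof -
    obtain t where t: "circle_of t = y" "\<bar>coord x - t\<bar> = dist x y" by (rule circle_lift)
    have "rotation a y = circle_of (t + a)" using t(1) by auto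
    then show ?thesis using dist_circle_of_le[of "coord x + a" "t + a"] t(2)
      by (simp add: rotation_def[of a x])
  qed
  from le[of a x y] le[of "-a" "rotation a x" "rotation a y"] show ?thesis by simp
qed

section \<open>Integration over arcs\<close>

lemma circle_of_measurable [measurable]: "circle_of \<in> borel_measurable borel"
  by (rule borel_measurable_continuous_onI[OF continuous_on_circle_of])

interpretation circle: prob_space circle_measure
  by (rule prob_space_circle_measure)

text \<open>On this class of functions no integrability question arises, neither on the circle nor on arcs, and the class is closed
under composition with measurable maps.\<close>

definition bounded_borel :: "(circle \<Rightarrow> real) \<Rightarrow> bool" where
  "bounded_borel F \<longleftrightarrow> F \<in> borel_measurable borel \<and> bounded (range F)"

text \<open>The endpoints are real numbers and the interval may wrap around the circle, so that rotations act by
translating the endpoints. The gauge integral makes affine substitutions, including reflections,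
and the concatenation of adjacent closed intervals immediate.\<close>

definition arc_integral :: "(circle \<Rightarrow> real) \<Rightarrow> real \<Rightarrow> real \<Rightarrow> real" where
  "arc_integral F a b = integral {a..b} (\<lambda>t. F (circle_of t))"

lemma integral_circle_measure:
  assumes [measurable]: "F \<in> borel_measurable borel"
  shows "(\<integral>x. F x \<partial>circle_measure) = (LINT t:{0..<1}|lborel. F (circle_of t) :: real)"
proof -
  have "circle_of \<in> borel_measurable (restrict_space lborel {0..<1})"
    by (intro measurable_restrict_space1) simp
  then show ?thesis unfolding circle_measure_def set_lebesgue_integral_def
    by (subst integral_distr) (auto simp: integral_restrict_space)
qed

lemma bounded_borelD: "bounded_borel F \<Longrightarrow> F \<in> borel_measurable borel"
  by (simp add: bounded_borel_def)

lemma bounded_borelI: 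
  assumes "F \<in> borel_measurable borel" "\<And>x. \<bar>F x\<bar> \<le> B" shows "bounded_borel F"
  using assms unfolding bounded_borel_def bounded_iff by auto

lemma bounded_borel_bound:
  assumes "bounded_borel F" obtains B where "0 \<le> B" "\<And>x. \<bar>F x\<bar> \<le> B"
proof -
  obtain B where B: "\<And>x. \<bar>F x\<bar> \<le> B"
    using assms unfolding bounded_borel_def bounded_iff by auto
  then have "0 \<le> B" by (meson abs_ge_zero order_trans)
  then show ?thesis using B by (rule that)
qed

lemma integrable_bounded_borel:
  assumes "bounded_borel F" shows "integrable circle_measure F"
proof -
  obtain B where "0 \<le> B" and "\<And>x. \<bar>F x\<bar> \<le> B" using bounded_borel_bound[OF assms] by blast
  moreover have [measurable]: "F \<in> borel_measurable borel" using assms by (rule bounded_borelD)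
  ultimately show ?thesis by (intro circle.integrable_const_bound[where B=B]) auto
qed

lemma arc_set_integrable:
  assumes "bounded_borel F"
  shows "set_integrable lborel {a..b} (\<lambda>t. F (circle_of t))" 
    "set_integrable lborel {a..<b} (\<lambda>t. F (circle_of t))"
proof -
  have [measurable]: "F \<in> borel_measurable borel" using assms by (rule bounded_borelD)
  obtain B where "0 \<le> B" and B: "\<And>x. \<bar>F x\<bar> \<le> B" using bounded_borel_bound[OF assms] by blast
  have "set_integrable lborel A (\<lambda>t. F (circle_of t))" if "A \<in> sets borel" "emeasure lborel A < \<infinity>" for A
    unfolding set_integrable_def using that B
    by (intro integrableI_bounded_set_indicator[where B=B]) auto
  then show "set_integrable lborel {a..b} (\<lambda>t. F (circle_of t))" 
    "set_integrable lborel {a..<b} (\<lambda>t. F (circle_of t))"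
    by (cases "a \<le> b"; simp)+
qed

lemma arc_integrable:
  "bounded_borel F \<Longrightarrow> (\<lambda>t. F (circle_of t)) integrable_on {a..b}"
  by (intro set_borel_integral_eq_integral(1) arc_set_integrable)

lemma arc_integral_combine:
  assumes "bounded_borel F" "a \<le> c" "c \<le> b"
  shows "arc_integral F a c + arc_integral F c b = arc_integral F a b"
  unfolding arc_integral_def by (rule Henstock_Kurzweil_Integration.integral_combine[OF assms(2,3) arc_integrable[OF assms(1)]])

lemma arc_integral_Ico:
  assumes "bounded_borel F"
  shows "(LINT t:{a..<b}|lborel. F (circle_of t)) = arc_integral F a b"
proof -
  have "(LINT t:{a..<b}|lborel. F (circle_of t)) = integral {a..<b} (\<lambda>t. F (circle_of t))"
    by (intro set_borel_integral_eq_integral(2) arc_set_integrable assms)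
  also have "\<dots> = arc_integral F a b"
    unfolding arc_integral_def
    by (rule integral_subset_negligible) (auto intro: negligible_subset[OF negligible_sing[of b]])
  finally show ?thesis .
qed

lemma integral_circle_arc:
  "bounded_borel F \<Longrightarrow> (\<integral>x. F x \<partial>circle_measure) = arc_integral F 0 1"
  by (simp add: integral_circle_measure[OF bounded_borelD] arc_integral_Ico)

lemma arc_integral_rotation:
  "arc_integral (\<lambda>x. F (rotation s x)) a b = arc_integral F (a + s) (b + s)"
  unfolding arc_integral_def
  using integral_shift_Icc_real[of a b "\<lambda>t. F (circle_of t)" s] by (simp add: o_def add.commute)

lemma arc_integral_add_int:
  "arc_integral F (a + of_int k) (b + of_int k) = arc_integral F a b"
  using arc_integral_rotation[of F "of_int k" a b] rotation_add_int[of 0 k] by simp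

lemma arc_integral_period:
  assumes F: "bounded_borel F"
  shows "arc_integral F a (a + 1) = (\<integral>x. F x \<partial>circle_measure)"
proof -
  define r where "r = frac a"
  have r: "0 \<le> r" "r \<le> 1" "a = r + of_int \<lfloor>a\<rfloor>"
    using frac_lt_1[of a] by (auto simp: r_def frac_def)
  have "arc_integral F a (a + 1) = arc_integral F r (r + 1)"
    by (metis r(3) arc_integral_add_int add.assoc add.commute)
  also have "\<dots> = arc_integral F r 1 + arc_integral F 1 (r + 1)"
    using r F by (intro arc_integral_combine[symmetric]) auto
  also have "arc_integral F 1 (r + 1) = arc_integral F 0 r"
    using arc_integral_add_int[of F 0 1 r] by simp
  also have "arc_integral F r 1 + arc_integral F 0 r = arc_integral F 0 1"
    using arc_integral_combine[OF F r(1,2)] by simp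
  finally show ?thesis using F by (simp add: integral_circle_arc)
qed

lemma bounded_borel_comp:
  "bounded_borel F \<Longrightarrow> f \<in> borel_measurable borel \<Longrightarrow> bounded_borel (\<lambda>x. F (f x))"
  unfolding bounded_borel_def by (auto intro: bounded_subset measurable_compose[of f borel borel F])

lemma bounded_borel_indicator: "A \<in> sets borel \<Longrightarrow> bounded_borel (indicator A)"
  by (rule bounded_borelI[where B=1]) (auto simp: indicator_def)

lemma bounded_borel_mult:
  assumes "bounded_borel F" "bounded_borel G" shows "bounded_borel (\<lambda>x. F x * G x)"
proof -
  obtain A B where "0 \<le> A" "0 \<le> B" "\<And>x. \<bar>F x\<bar> \<le> A" "\<And>x. \<bar>G x\<bar> \<le> B"
    using assms by (metis bounded_borel_bound)
  with assms show ?thesis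
    by (intro bounded_borelI[where B="A * B"])
      (auto dest!: bounded_borelD simp: abs_mult intro!: mult_mono)
qed

lemma bounded_borel_const: "bounded_borel (\<lambda>x. c)"
  by (rule bounded_borelI[where B="\<bar>c\<bar>"]) auto

section \<open>Maps that preserve the measure\<close>

lemma C_leb_measurable: "f \<in> C_leb \<Longrightarrow> f \<in> borel_measurable borel"
  unfolding C_leb_def by (auto intro: borel_measurable_continuous_onI)

lemma C_leb_continuous: "f \<in> C_leb \<Longrightarrow> continuous_on UNIV f"
  unfolding C_leb_def by auto

lemma C_leb_iff_distr:
  "f \<in> C_leb \<longleftrightarrow> continuous_on UNIV f \<and> distr circle_measure borel f = circle_measure"
proof (cases "continuous_on UNIV f")
  case True
  then have [measurable]: "f \<in> borel_measurable borel" by (rule borel_measurable_continuous_onI)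
  have "distr circle_measure borel f = circle_measure \<longleftrightarrow>
    (\<forall>A\<in>sets borel. emeasure circle_measure (f -` A) = emeasure circle_measure A)"
  proof
    assume eq: "distr circle_measure borel f = circle_measure"
    have "emeasure circle_measure (f -` A) = emeasure (distr circle_measure borel f) A" if "A \<in> sets borel" for A
      using that by (subst emeasure_distr) auto
    then show "\<forall>A\<in>sets borel. emeasure circle_measure (f -` A) = emeasure circle_measure A"
      unfolding eq by blast
  next
    assume "\<forall>A\<in>sets borel. emeasure circle_measure (f -` A) = emeasure circle_measure A"
    then show "distr circle_measure borel f = circle_measure"
      by (intro measure_eqI) (auto simp: emeasure_distr)
  qed
  with True show ?thesis by (simp add: C_leb_def)
qed (simp add: C_leb_def)

lemma C_leb_integral:
  fixes F :: "circle \<Rightarrow> real"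
  assumes "f \<in> C_leb" "F \<in> borel_measurable borel"
  shows "(\<integral>x. F (f x) \<partial>circle_measure) = (\<integral>x. F x \<partial>circle_measure)"
proof -
  have [measurable]: "f \<in> borel_measurable borel" using assms(1) by (rule C_leb_measurable)
  have "(\<integral>x. F (f x) \<partial>circle_measure) = (\<integral>x. F x \<partial>distr circle_measure borel f)"
    using assms(2) by (subst integral_distr) auto
  then show ?thesis using assms(1) by (simp add: C_leb_iff_distr)
qed

lemma C_leb_integrable:
  fixes F :: "circle \<Rightarrow> real"
  assumes "f \<in> C_leb" "integrable circle_measure F"
  shows "integrable circle_measure (\<lambda>x. F (f x))"
proof -
  have [measurable]: "f \<in> borel_measurable borel" using assms(1) by (rule C_leb_measurable)
  have "integrable (distr circle_measure borel f) F" using assms by (simp add: C_leb_iff_distr)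
  then show ?thesis by (rule integrable_distr[rotated]) auto
qed

lemma C_lebI:
  assumes "continuous_on UNIV f"
    "\<And>F. bounded_borel F \<Longrightarrow> (\<integral>x. F (f x) \<partial>circle_measure) = (\<integral>x. F x \<partial>circle_measure)"
  shows "f \<in> C_leb"
proof -
  have m[measurable]: "f \<in> borel_measurable borel" using assms(1) by (rule borel_measurable_continuous_onI)
  have "emeasure circle_measure (f -` A) = emeasure circle_measure A" if A: "A \<in> sets borel" for A
  proof -
    have "f -` A \<in> sets circle_measure" using measurable_sets[OF m A] by simp
    moreover have "(\<lambda>x. indicator A (f x)) = (indicator (f -` A) :: circle \<Rightarrow> real)"
      by (auto simp: indicator_def)
    ultimately show ?thesis
      using assms(2)[OF bounded_borel_indicator[OF A]] A by (simp add: circle.emeasure_eq_measure)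
  qed
  with assms(1) show ?thesis by (simp add: C_leb_def)
qed

lemma C_leb_comp:
  assumes f: "f \<in> C_leb" and g: "g \<in> C_leb"
  shows "(\<lambda>x. f (g x)) \<in> C_leb"
proof (rule C_lebI)
  show "continuous_on UNIV (\<lambda>x. f (g x))"
    by (rule continuous_on_compose2[OF C_leb_continuous[OF f] C_leb_continuous[OF g]]) simp
  fix F assume F: "bounded_borel F"
  have "bounded_borel (\<lambda>x. F (f x))" by (rule bounded_borel_comp[OF F C_leb_measurable[OF f]])
  from C_leb_integral[OF g bounded_borelD[OF this]] C_leb_integral[OF f bounded_borelD[OF F]]
  show "(\<integral>x. F (f (g x)) \<partial>circle_measure) = (\<integral>x. F x \<partial>circle_measure)" by simp
qed

lemma C_leb_funpow: "f \<in> C_leb \<Longrightarrow> f ^^ n \<in> C_leb"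
proof (induction n)
  case 0
  show ?case by (rule C_lebI) (auto intro: continuous_on_id)
next
  case (Suc n)
  then show ?case using C_leb_comp[of f "f ^^ n"] by (simp add: o_def)
qed

lemma rotation_in_C_leb: "rotation s \<in> C_leb"
proof (rule C_lebI[OF continuous_rotation])
  fix F assume F: "bounded_borel F"
  have "bounded_borel (\<lambda>x. F (rotation s x))"
    by (rule bounded_borel_comp[OF F borel_measurable_continuous_onI[OF continuous_rotation]])
  then show "(\<integral>x. F (rotation s x) \<partial>circle_measure) = (\<integral>x. F x \<partial>circle_measure)"
    using arc_integral_period[OF F, of s]
    by (simp add: integral_circle_arc[of "\<lambda>x. F (rotation s x)"] arc_integral_rotation add.commute)
qed

lemma two_sided_rotation_in_C_leb: "f \<in> C_leb \<Longrightarrow> two_sided_rotation a b f \<in> C_leb"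
  unfolding two_sided_rotation_def o_def
  by (rule C_leb_comp[OF rotation_in_C_leb C_leb_comp[OF _ rotation_in_C_leb]])

section \<open>Folding the cells of a partition\<close>

text \<open>The distance to the nearest even integer, that is, the infinite zigzag of slope $\pm 1$ between 0 and 1.\<close>

definition tent :: "real \<Rightarrow> real" where
  "tent x = \<bar>x - 2 * of_int (round (x / 2))\<bar>"

lemma tent_le: "tent x \<le> \<bar>x - 2 * of_int k\<bar>"
  using round_diff_minimal[of "x / 2" k] unfolding tent_def by (simp add: field_simps abs_if split: if_splits)

lemma tent_lipschitz: "\<bar>tent x - tent y\<bar> \<le> \<bar>x - y\<bar>"
  using tent_le[of x "round (y / 2)"] tent_le[of y "round (x / 2)"] unfolding tent_def by linarith

lemma tent_bounds: "0 \<le> tent x" "tent x \<le> 1"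
  using of_int_round_abs_le[of "x / 2"] unfolding tent_def by (auto simp: abs_if split: if_splits)

lemma abs_even_int_diff:
  fixes s :: real assumes "0 \<le> s" "s \<le> 1" shows "s \<le> \<bar>s + 2 * of_int k\<bar>"
proof (cases "k \<ge> 0")
  case True
  then have "0 \<le> real_of_int k" by simp
  with assms show ?thesis by linarith
next
  case False
  then have "real_of_int k \<le> - 1" by linarith
  with assms show ?thesis by linarith
qed

lemma tent_even:
  assumes "0 \<le> s" "s \<le> 1" shows "tent (2 * of_int a + s) = s"
proof (rule antisym)
  show "tent (2 * of_int a + s) \<le> s" using tent_le[of "2 * of_int a + s" a] assms by simp
  show "s \<le> tent (2 * of_int a + s)"
    using abs_even_int_diff[OF assms, of "a - round ((2 * of_int a + s) / 2)"]
    unfolding tent_def by (simp add: algebra_simps)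
qed

lemma tent_odd:
  assumes "0 \<le> s" "s \<le> 1" shows "tent (2 * of_int a + 1 + s) = 1 - s"
proof (rule antisym)
  show "tent (2 * of_int a + 1 + s) \<le> 1 - s" using tent_le[of "2 * of_int a + 1 + s" "a + 1"] assms by simp
  show "1 - s \<le> tent (2 * of_int a + 1 + s)"
    using abs_even_int_diff[of "1 - s" "round ((2 * of_int a + 1 + s) / 2) - a - 1"] assms
    unfolding tent_def by (simp add: algebra_simps)
qed

text \<open>On each interval between consecutive integers the graph runs \<open>m\<close> times through the full height of that
interval. For odd \<open>m\<close> the integers are fixed, so that the pieces fit together continuously.\<close>

definition zigzag :: "nat \<Rightarrow> real \<Rightarrow> real" where
  "zigzag m s = of_int \<lfloor>s\<rfloor> + tent (real m * frac s)"

lemma zigzag_add_int: "zigzag m (s + of_int k) = zigzag m s + of_int k"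
  by (simp add: zigzag_def frac_def)

lemma tent_of_odd: "odd m \<Longrightarrow> tent (real m) = 1"
proof -
  assume "odd m"
  then obtain b where "m = 2 * b + 1" by (elim oddE)
  then show ?thesis using tent_odd[of 0 "int b"] by (simp add: algebra_simps)
qed

lemma zigzag_on_cell:
  assumes "odd m" "of_int i \<le> s" "s \<le> of_int i + 1"
  shows "zigzag m s = of_int i + tent (real m * (s - of_int i))"
proof (cases "s = of_int i + 1")
  case True
  then have "\<lfloor>s\<rfloor> = i + 1" by simp
  then show ?thesis using True tent_of_odd[OF \<open>odd m\<close>] tent_even[of 0 0]
    by (simp add: zigzag_def frac_def)
next
  case False
  then have "\<lfloor>s\<rfloor> = i" using assms by (intro floor_unique) auto
  then show ?thesis by (simp add: zigzag_def frac_def)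
qed

lemma zigzag_close: "\<bar>zigzag m s - s\<bar> \<le> 1"
  using tent_bounds[of "real m * frac s"] frac_ge_0[of s] frac_lt_1[of s]
  unfolding zigzag_def frac_def by linarith

text \<open>Within one unit interval this is the Lipschitz bound of the tent function; two points in different
unit intervals are compared through the integers that separate them, which are fixed points.\<close>

lemma zigzag_lipschitz:
  assumes m: "odd m" shows "\<bar>zigzag m s - zigzag m t\<bar> \<le> real m * \<bar>s - t\<bar>"
proof -
  have m1: "1 \<le> real m" using m by (cases m) auto
  have *: "\<bar>zigzag m s - zigzag m t\<bar> \<le> real m * (t - s)" if "s \<le> t" for s t
  proof -
    have cell: "\<bar>zigzag m s - zigzag m t\<bar> \<le> real m * (t - s)"
      if "of_int i \<le> s" "s \<le> t" "t \<le> of_int i + 1" for i s t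
    proof -
      have "\<bar>zigzag m s - zigzag m t\<bar> \<le> \<bar>real m * (s - of_int i) - real m * (t - of_int i)\<bar>"
        using that m tent_lipschitz by (simp add: zigzag_on_cell[of m i])
      also have "\<dots> = real m * (t - s)"
        using that m1 by (simp add: abs_mult flip: right_diff_distrib)
      finally show ?thesis .
    qed
    show ?thesis
    proof (cases "\<lfloor>s\<rfloor> = \<lfloor>t\<rfloor>")
      case True
      then show ?thesis using that by (intro cell[of "\<lfloor>s\<rfloor>"]) linarith+
    next
      case False
      define i j where "i = \<lfloor>s\<rfloor> + 1" and "j = \<lfloor>t\<rfloor>"
      have ij: "i \<le> j" using False floor_mono[OF that] unfolding i_def j_def by linarith
      have s: "of_int (i - 1) \<le> s" "s \<le> of_int i" and t: "of_int j \<le> t" "t \<le> of_int j + 1"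
        unfolding i_def j_def by linarith+
      have int: "zigzag m (of_int k) = of_int k" for k
        using zigzag_add_int[of m 0 k] tent_even[of 0 0] by (simp add: zigzag_def)
      have "\<bar>zigzag m s - of_int i\<bar> \<le> real m * (of_int i - s)"
        using cell[of "i - 1" s "of_int i"] s int[of i] by simp
      moreover have "\<bar>of_int j - zigzag m t\<bar> \<le> real m * (t - of_int j)"
        using cell[of j "of_int j" t] t int[of j] by simp
      moreover have "\<bar>of_int i - of_int j\<bar> \<le> real m * (of_int j - of_int i)"
        using ij m1 mult_right_mono[OF m1, of "of_int j - of_int i"] by simp
      ultimately show ?thesis by (simp add: algebra_simps) 
    qed
  qed
  show ?thesis using *[of s t] *[of t s] abs_minus_commute[of "zigzag m s" "zigzag m t"]
    by (cases "s \<le> t") (simp_all add: abs_if[of "s - t"])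
qed

definition fold_map :: "nat \<Rightarrow> nat \<Rightarrow> circle \<Rightarrow> circle" where
  "fold_map N m x = circle_of (zigzag m (real N * coord x) / real N)"

lemma fold_map_circle_of:
  assumes "N > 0"
  shows "fold_map N m (circle_of t) = circle_of (zigzag m (real N * t) / real N)"
proof -
  have "real N * t = real N * frac t + of_int (int N * \<lfloor>t\<rfloor>)" by (simp add: frac_def algebra_simps)
  then have "zigzag m (real N * t) / real N = zigzag m (real N * frac t) / real N + of_int \<lfloor>t\<rfloor>"
    using assms by (simp only: zigzag_add_int) (simp add: field_simps)
  then show ?thesis by (simp add: fold_map_def)
qed

lemma continuous_fold_map:
  assumes "N > 0" "odd m" shows "continuous_on UNIV (fold_map N m)"
proof (rule lipschitz_degree_one_continuous)
  show "fold_map N m (circle_of t) = circle_of (zigzag m (real N * t) / real N)" for t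
    using assms(1) by (rule fold_map_circle_of)
  show "\<bar>zigzag m (real N * s) / real N - zigzag m (real N * t) / real N\<bar> \<le> real m * \<bar>s - t\<bar>" for s t
  proof -
    have "\<bar>zigzag m (real N * s) - zigzag m (real N * t)\<bar> \<le> real m * (real N * \<bar>s - t\<bar>)"
      using zigzag_lipschitz[OF assms(2), of "real N * s" "real N * t"]
      by (simp add: abs_mult flip: right_diff_distrib)
    then show ?thesis using assms(1) by (simp add: field_simps flip: diff_divide_distrib)
  qed
qed

lemma dist_fold_map: "N > 0 \<Longrightarrow> dist (fold_map N m x) x \<le> 1 / real N"
proof -
  assume N: "N > 0"
  have "dist (fold_map N m x) (circle_of (coord x)) \<le> \<bar>zigzag m (real N * coord x) / real N - coord x\<bar>"
    unfolding fold_map_def by (rule dist_circle_of_le)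
  also have "\<dots> = \<bar>zigzag m (real N * coord x) - real N * coord x\<bar> / real N"
    using N by (simp add: field_simps)
  also have "\<dots> \<le> 1 / real N" using zigzag_close N by (intro divide_right_mono) auto
  finally show ?thesis by simp
qed

text \<open>If \<open>f\<close> is not integrable on the image interval, then the composite is not integrable either, and both
integrals take the default value 0.\<close>

lemma integral_affine_increasing:
  fixes f :: "real \<Rightarrow> real" assumes "m > 0" 
  shows "integral {a..b} (\<lambda>t. f (m * t + c)) = integral {m * a + c..m * b + c} f / m"
proof -
  have iff: "((\<lambda>t. f (m * t + c)) has_integral (I / m)) {a..b} \<longleftrightarrow> (f has_integral I) {m * a + c..m * b + c}" for I
    using has_integral_affinity_iff[OF assms, of f c I "m * a + c" "m * b + c"] assms
    by (simp add: field_simps)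
  show ?thesis
  proof (cases "f integrable_on {m * a + c..m * b + c}")
    case True
    then show ?thesis using iff integrable_integral by (intro integral_unique) blast
  next
    case False
    moreover have "\<not> (\<lambda>t. f (m * t + c)) integrable_on {a..b}"
    proof
      assume "(\<lambda>t. f (m * t + c)) integrable_on {a..b}"
      then obtain I where "((\<lambda>t. f (m * t + c)) has_integral I) {a..b}" by blast
      then have "(f has_integral I * m) {m * a + c..m * b + c}" using iff[of "I * m"] assms by simp
      with False show False by blast
    qed
    ultimately show ?thesis by (simp add: not_integrable_integral)
  qed
qed

lemma integral_affine_decreasing:
  fixes f :: "real \<Rightarrow> real" assumes "m > 0" 
  shows "integral {a..b} (\<lambda>t. f (c - m * t)) = integral {c - m * b..c - m * a} f / m"
  using integral_affine_increasing[OF assms, of "- b" "- a" f c]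
    Henstock_Kurzweil_Integration.integral_reflect_real[of "-a" "-b" "\<lambda>t. f (m * t + c)"] by (simp add: algebra_simps)

text \<open>The integral over the cell number \<open>i\<close> of the partition into \<open>n\<close> cells; the index is an integer, so that
neighbours can be addressed cyclically.\<close>

definition cell_integral :: "nat \<Rightarrow> (circle \<Rightarrow> real) \<Rightarrow> int \<Rightarrow> real" where
  "cell_integral n F i = arc_integral F (of_int i / real n) ((of_int i + 1) / real n)"

lemma arc_integral_sum:
  assumes "bounded_borel F" "0 \<le> d"
  shows "(\<Sum>l<k. arc_integral F (a + real l * d) (a + (real l + 1) * d)) = arc_integral F a (a + real k * d)"
proof (induction k)
  case 0
  then show ?case by (simp add: arc_integral_def)
next
  case (Suc k)
  have "arc_integral F a (a + real k * d) + arc_integral F (a + real k * d) (a + (real k + 1) * d)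
    = arc_integral F a (a + (real k + 1) * d)"
    using assms by (intro arc_integral_combine) (auto simp: algebra_simps)
  with Suc show ?case by (simp add: add.commute)
qed

lemma cell_integral_refine:
  assumes "bounded_borel F" "N > 0" "m > 0"
  shows "cell_integral N F i = (\<Sum>l<m. cell_integral (N * m) F (i * int m + int l))"
proof -
  have "(\<Sum>l<m. cell_integral (N * m) F (i * int m + int l)) =
    (\<Sum>l<m. arc_integral F (of_int i / real N + real l * (1 / (real N * real m))) 
        (of_int i / real N + (real l + 1) * (1 / (real N * real m))))"
    unfolding cell_integral_def using assms by (intro sum.cong refl) (simp add: field_simps)
  also have "\<dots> = arc_integral F (of_int i / real N) (of_int i / real N + real m * (1 / (real N * real m)))"
    using assms by (intro arc_integral_sum) auto
  also have "\<dots> = cell_integral N F i"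
    unfolding cell_integral_def using assms by (simp add: field_simps)
  finally show ?thesis ..
qed

lemma integral_circle_cells:
  assumes "bounded_borel F" "N > 0"
  shows "(\<integral>x. F x \<partial>circle_measure) = (\<Sum>i<N. cell_integral N F (int i))"
  using cell_integral_refine[OF assms(1) _ assms(2), of 1 0] integral_circle_arc[OF assms(1)]
  by (simp add: cell_integral_def)

text \<open>Each of the \<open>m\<close> branches maps a cell of the refined partition affinely onto a whole cell of the
original one, upwards for even \<open>l\<close> and downwards for odd \<open>l\<close>. Invariance of the measure
and the averaging effect of the fold both rest on this.\<close>

lemma fold_map_branch:
  assumes N: "N > 0" and m: "odd m" and l: "l < m"
  shows "cell_integral (N * m) (\<lambda>x. H (fold_map N m x)) (i * int m + int l) = cell_integral N H i / real m"
proof -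
  define a b where "a = (of_int i * real m + real l) / (real N * real m)" 
    and "b = (of_int i * real m + real l + 1) / (real N * real m)"
  have m0: "real m > 0" using l by simp
  have range: "real l \<le> real m * (real N * t - of_int i) \<and> real m * (real N * t - of_int i) \<le> real l + 1"
    if "t \<in> {a..b}" for t
    using that m0 N unfolding a_def b_def by (simp add: field_simps)
  have cell: "of_int i \<le> real N * t \<and> real N * t \<le> of_int i + 1" if t: "t \<in> {a..b}" for t
  proof -
    have "0 \<le> real m * (real N * t - of_int i)" using range[OF t] by linarith
    moreover have "real m * (real N * t - of_int i) \<le> real m * 1" using range[OF t] l by linarith
    ultimately show ?thesis using m0 by (simp add: zero_le_mult_iff)
  qed
  \<comment> \<open>The whole refined cell lies in the closed cell \<open>i\<close>, including the endpoint at which the floor jumps.\<close>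
  have fm: "fold_map N m (circle_of t) = circle_of ((of_int i + tent (real m * (real N * t - of_int i))) / real N)"
    if t: "t \<in> {a..b}" for t
    using cell[OF t] by (simp add: fold_map_circle_of[OF N] zigzag_on_cell[OF m, of i])
  have "integral {a..b} (\<lambda>t. H (fold_map N m (circle_of t))) = arc_integral H (of_int i / real N) ((of_int i + 1) / real N) / real m"
  proof (cases "even l")
    case True
    then obtain k where k: "l = 2 * k" by (elim evenE)
    define c where "c = (of_int i - real m * of_int i - real l) / real N"
    have "fold_map N m (circle_of t) = circle_of (real m * t + c)" if t: "t \<in> {a..b}" for t
    proof -
      have "tent (real m * (real N * t - of_int i)) = real m * (real N * t - of_int i) - real l"
        using tent_even[of "real m * (real N * t - of_int i) - real l" "int k"] range[OF t] k by simp
      then have "(of_int i + tent (real m * (real N * t - of_int i))) / real N = real m * t + c"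
        using N by (simp add: c_def field_simps)
      then show ?thesis using fm[OF t] by simp
    qed
    then have "integral {a..b} (\<lambda>t. H (fold_map N m (circle_of t))) = integral {a..b} (\<lambda>t. H (circle_of (real m * t + c)))"
      by (intro integral_cong) simp
    also have "\<dots> = integral {real m * a + c..real m * b + c} (\<lambda>t. H (circle_of t)) / real m"
      using integral_affine_increasing[OF m0, of a b "\<lambda>t. H (circle_of t)" c] .
    also have "real m * a + c = of_int i / real N"
      using N m0 by (simp add: a_def c_def field_simps)
    also have "real m * b + c = (of_int i + 1) / real N"
      using N m0 by (simp add: b_def c_def field_simps)
    finally show ?thesis by (simp add: arc_integral_def)
  next
    case False
    then obtain k where k: "l = 2 * k + 1" by (elim oddE)
    define c where "c = (of_int i + 1 + real m * of_int i + real l) / real N"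
    have "fold_map N m (circle_of t) = circle_of (c - real m * t)" if t: "t \<in> {a..b}" for t
    proof -
      have "tent (real m * (real N * t - of_int i)) = 1 - (real m * (real N * t - of_int i) - real l)"
        using tent_odd[of "real m * (real N * t - of_int i) - real l" "int k"] range[OF t] k 
        by (simp add: algebra_simps)
      then have "(of_int i + tent (real m * (real N * t - of_int i))) / real N = c - real m * t"
        using N by (simp add: c_def field_simps)
      then show ?thesis using fm[OF t] by simp
    qed
    then have "integral {a..b} (\<lambda>t. H (fold_map N m (circle_of t))) = integral {a..b} (\<lambda>t. H (circle_of (c - real m * t)))"
      by (intro integral_cong) simp
    also have "\<dots> = integral {c - real m * b..c - real m * a} (\<lambda>t. H (circle_of t)) / real m"
      using integral_affine_decreasing[OF m0, of a b "\<lambda>t. H (circle_of t)" c] .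
    also have "c - real m * b = of_int i / real N"
      using N m0 by (simp add: b_def c_def field_simps)
    also have "c - real m * a = (of_int i + 1) / real N"
      using N m0 by (simp add: a_def c_def field_simps)
    finally show ?thesis by (simp add: arc_integral_def)
  qed
  then show ?thesis unfolding cell_integral_def arc_integral_def a_def b_def by simp
qed

lemma fold_map_measurable: "N > 0 \<Longrightarrow> odd m \<Longrightarrow> fold_map N m \<in> borel_measurable borel"
  by (rule borel_measurable_continuous_onI[OF continuous_fold_map])

lemma cell_integral_fold_map:
  assumes N: "N > 0" and m: "odd m" and H: "bounded_borel H"
  shows "cell_integral N (\<lambda>x. H (fold_map N m x)) i = cell_integral N H i"
proof -
  have m0: "m > 0" using m by (cases m) auto
  show ?thesis
    using cell_integral_refine[OF bounded_borel_comp[OF H fold_map_measurable[OF N m]] N m0, of i]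
    m0 by (simp add: fold_map_branch[OF N m])
qed

lemma fold_map_in_C_leb:
  assumes N: "N > 0" and m: "odd m"
  shows "fold_map N m \<in> C_leb"
proof (rule C_lebI[OF continuous_fold_map[OF N m]])
  fix F assume F: "bounded_borel F"
  show "(\<integral>x. F (fold_map N m x) \<partial>circle_measure) = (\<integral>x. F x \<partial>circle_measure)"
    using integral_circle_cells[OF bounded_borel_comp[OF F fold_map_measurable[OF N m]] N]
    by (simp add: cell_integral_fold_map[OF N m F] integral_circle_cells[OF F N])
qed

text \<open>The shift is a third of a cell, so that the boundaries of the original cells fall on boundaries between
the three branches of the shifted folds.\<close>

definition shifted_fold_map :: "nat \<Rightarrow> circle \<Rightarrow> circle" where
  "shifted_fold_map N x = rotation (- (1 / (3 * real N))) (fold_map N 3 (rotation (1 / (3 * real N)) x))"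

lemma shifted_fold_map_in_C_leb: "N > 0 \<Longrightarrow> shifted_fold_map N \<in> C_leb"
  unfolding shifted_fold_map_def[abs_def]
  by (rule C_leb_comp[OF rotation_in_C_leb C_leb_comp[OF fold_map_in_C_leb rotation_in_C_leb]]) simp_all

lemma dist_shifted_fold_map: "N > 0 \<Longrightarrow> dist (shifted_fold_map N x) x \<le> 1 / real N"
proof -
  assume N: "N > 0"
  define s where "s = 1 / (3 * real N)"
  have "dist (shifted_fold_map N x) (rotation (- s) (rotation s x)) = dist (fold_map N 3 (rotation s x)) (rotation s x)"
    unfolding shifted_fold_map_def s_def by (simp only: dist_rotation)
  also have "\<dots> \<le> 1 / real N" by (rule dist_fold_map[OF N])
  finally show ?thesis by simp
qed

text \<open>A cell consists of two branches of one shifted fold and one branch of the next, and every branch carries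
a third of the integral over its shifted cell. This mixing of neighbouring cells is
what contracts the cell averages.\<close>

lemma cell_integral_shifted_fold_map:
  assumes N: "N > 0" and H: "bounded_borel H"
  defines "H' \<equiv> \<lambda>x. H (rotation (- (1 / (3 * real N))) x)"
  shows "cell_integral N (\<lambda>x. H (shifted_fold_map N x)) i =
    2 / 3 * cell_integral N H' i + 1 / 3 * cell_integral N H' (i + 1)"
proof -
  define s where "s = 1 / (3 * real N)"
  define G where "G = (\<lambda>x. H' (fold_map N 3 x))"
  have H': "bounded_borel H'" unfolding H'_def
    by (rule bounded_borel_comp[OF H C_leb_measurable[OF rotation_in_C_leb]])
  have G: "bounded_borel G" unfolding G_def
    by (rule bounded_borel_comp[OF H' fold_map_measurable]) (use N in auto)
  have c: "cell_integral (N * 3) G (i * 3 + int l) = cell_integral N H' i / 3" if "l < 3" for l i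
    using fold_map_branch[OF N _ that, of H' i] by (simp add: G_def)
  have e: "cell_integral N (\<lambda>x. H (shifted_fold_map N x)) i = cell_integral N (\<lambda>x. G (rotation s x)) i"
    by (simp add: G_def H'_def shifted_fold_map_def s_def)
  also have "\<dots> = arc_integral G (of_int i / real N + s) ((of_int i + 1) / real N + s)"
    unfolding cell_integral_def by (rule arc_integral_rotation)
  also have "\<dots> = (\<Sum>l<3. arc_integral G (of_int i / real N + s + real l * s) (of_int i / real N + s + (real l + 1) * s))"
  proof -
    have "of_int i / real N + s + real 3 * s = (of_int i + 1) / real N + s"
      using N by (simp add: s_def add_divide_distrib)
    moreover have "0 \<le> s" by (simp add: s_def)
    ultimately show ?thesis
      using arc_integral_sum[OF G, where d=s and k=3 and a="of_int i / real N + s"] by metis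
  qed
  also have "\<dots> = cell_integral (N * 3) G (i * 3 + int 1) + cell_integral (N * 3) G (i * 3 + int 2) 
      + cell_integral (N * 3) G ((i + 1) * 3 + int 0)"
  proof -
    have 3: "{..<3} = {0, 1, 2::nat}" by auto
    have e: "of_int i / real N + s + x * s = (of_int i * 3 + 1 + x) / real (N * 3)" for x
      using N by (simp add: s_def add_divide_distrib)
    show ?thesis unfolding 3 cell_integral_def e by (simp add: algebra_simps)
  qed
  finally show ?thesis using c[of 1 i] c[of 2 i] c[of 0 "i + 1"] by simp
qed

section \<open>Induction principles for integrable functions\<close>

lemma coord_measurable [measurable]: "coord \<in> borel_measurable borel"
proof -
  have "{x. coord x \<le> a} \<in> sets borel" for a
  proof -
    consider "a < 0" | "0 \<le> a" "a < 1" | "1 \<le> a" by linarith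
    then show ?thesis
    proof cases
      case 1
      then have "{x. coord x \<le> a} = {}" using coord_ge_0 order_trans not_le by blast
      then show ?thesis by simp
    next
      case 2
      have "{x. coord x \<le> a} = circle_of ` {0..a}"
      proof (intro set_eqI iffI)
        fix x assume "x \<in> {x. coord x \<le> a}"
        then show "x \<in> circle_of ` {0..a}" by (intro image_eqI[of _ _ "coord x"]) auto
      next
        fix x assume "x \<in> circle_of ` {0..a}"
        then obtain t where "x = circle_of t" "0 \<le> t" "t \<le> a" by auto
        with 2 show "x \<in> {x. coord x \<le> a}" by (simp add: frac_eq[THEN iffD2])
      qed
      moreover have "compact (circle_of ` {0..a})"
        by (intro compact_continuous_image continuous_on_circle_of) simp
      ultimately show ?thesis by (metis borel_compact)
    next
      case 3
      then have "{x. coord x \<le> a} = UNIV" using coord_less_1 less_imp_le order_trans by blast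
      then show ?thesis by simp
    qed
  qed
  then show ?thesis by (simp add: borel_measurable_iff_le)
qed

definition arc :: "real \<Rightarrow> circle set" where
  "arc q = {x. coord x < q}"

lemma arc_measurable [measurable]: "arc q \<in> sets borel"
  unfolding arc_def by measurable

text \<open>The coordinate is measurable for the sigma-algebra generated by the arcs, and a Borel set of the
circle is the preimage under the coordinate of its preimage in the line.\<close>

lemma arcs_generate:
  "sets (borel :: circle measure) = sigma_sets UNIV (arc ` \<rat>)"
proof
  show "sigma_sets UNIV (arc ` \<rat>) \<subseteq> sets borel"
    by (intro sets.sigma_sets_subset[of _ "borel :: circle measure", simplified]) auto
  define S where "S = sigma (UNIV :: circle set) (arc ` \<rat>)"
  have S: "sets S = sigma_sets UNIV (arc ` \<rat>)" "space S = UNIV" by (simp_all add: S_def)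
  have "coord \<in> borel_measurable S"
  proof (rule borel_measurableI_less)
    fix a :: real
    have "{x \<in> space S. coord x < a} = (\<Union>q\<in>{q\<in>\<rat>. q < a}. arc q)"
      using Rats_dense_in_real by (fastforce simp: S arc_def)
    also have "\<dots> \<in> sets S"
      by (intro sets.countable_UN'' countable_subset[OF _ countable_rat]) (auto simp: S)
    finally show "{x \<in> space S. coord x < a} \<in> sets S" .
  qed
  show "sets borel \<subseteq> sigma_sets UNIV (arc ` \<rat>)"
  proof
    fix A :: "circle set" assume A: "A \<in> sets borel"
    have "circle_of -` A \<in> sets borel" using measurable_sets[OF circle_of_measurable A] by simp
    from measurable_sets[OF \<open>coord \<in> borel_measurable S\<close> this]
    show "A \<in> sigma_sets UNIV (arc ` \<rat>)" by (simp add: S vimage_def)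
  qed
qed

lemma Int_stable_arcs: "Int_stable (arc ` \<rat>)"
proof (rule Int_stableI)
  fix a b assume "a \<in> arc ` \<rat>" "b \<in> arc ` \<rat>"
  then obtain p q where "p \<in> \<rat>" "q \<in> \<rat>" "a = arc p" "b = arc q" by auto
  then show "a \<inter> b \<in> arc ` \<rat>" by (intro image_eqI[of _ _ "min p q"]) (auto simp: arc_def min_def)
qed

text \<open>Dominated convergence in the form that suits an arbitrary property closed under approximation in mean.\<close>

lemma L1_class_dominated:
  fixes f w :: "circle \<Rightarrow> real"
  assumes lim: "\<And>f. integrable circle_measure f \<Longrightarrow>
      (\<And>e. 0 < e \<Longrightarrow> \<exists>g. integrable circle_measure g \<and> P g \<and> (\<integral>x. \<bar>f x - g x\<bar> \<partial>circle_measure) < e) \<Longrightarrow> P f"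
    and s: "\<And>i::nat. integrable circle_measure (s i)" "\<And>i. P (s i)"
    and w: "integrable circle_measure w" "\<And>i x. \<bar>s i x\<bar> \<le> w x"
    and ptw: "\<And>x. (\<lambda>i. s i x) \<longlonglongrightarrow> f x" and f: "integrable circle_measure f"
  shows "P f"
proof (rule lim[OF f])
  fix e :: real assume e: "0 < e"
  have "(\<lambda>i. \<integral>x. \<bar>f x - s i x\<bar> \<partial>circle_measure) \<longlonglongrightarrow> (\<integral>x. 0 \<partial>circle_measure)"
  proof (rule integral_dominated_convergence)
    show "(\<lambda>x. 0::real) \<in> borel_measurable circle_measure" by simp
    show "(\<lambda>x. \<bar>f x - s i x\<bar>) \<in> borel_measurable circle_measure" for i
      using f s(1)[of i] by measurable
    show "integrable circle_measure (\<lambda>x. \<bar>f x\<bar> + w x)" using f w(1) by simp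
    show "AE x in circle_measure. (\<lambda>i. \<bar>f x - s i x\<bar>) \<longlonglongrightarrow> 0"
      using ptw by (intro AE_I2 tendsto_eq_intros) auto
    show "AE x in circle_measure. norm \<bar>f x - s i x\<bar> \<le> \<bar>f x\<bar> + w x" for i
    proof (rule AE_I2)
      fix x show "norm \<bar>f x - s i x\<bar> \<le> \<bar>f x\<bar> + w x" using w(2)[of i x] by simp
    qed
  qed
  then have "\<forall>\<^sub>F i in sequentially. (\<integral>x. \<bar>f x - s i x\<bar> \<partial>circle_measure) < e"
    using e by (intro order_tendstoD) auto
  then obtain i where "(\<integral>x. \<bar>f x - s i x\<bar> \<partial>circle_measure) < e"
    by (auto simp: eventually_sequentially)
  then show "\<exists>g. integrable circle_measure g \<and> P g \<and> (\<integral>x. \<bar>f x - g x\<bar> \<partial>circle_measure) < e"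
    using s by blast
qed

lemma integrable_indicator_circle: "A \<in> sets borel \<Longrightarrow> integrable circle_measure (indicator A :: circle \<Rightarrow> real)"
  by (rule integrable_bounded_borel[OF bounded_borel_indicator])

text \<open>A linear property that survives approximation in mean needs to be checked on a generating
\<open>\<pi>\<close>-system only: the sets whose indicators have the property form a Dynkin system.\<close>

lemma integrable_circle_induct:
  fixes h :: "circle \<Rightarrow> real"
  assumes h: "integrable circle_measure h"
    and G: "Int_stable G" "sets borel = sigma_sets UNIV G"
    and basic: "\<And>A. A \<in> G \<Longrightarrow> P (indicator A)"
    and one: "P (\<lambda>_. 1)"
    and add: "\<And>f g. integrable circle_measure f \<Longrightarrow> P f \<Longrightarrow> integrable circle_measure g \<Longrightarrow> P g \<Longrightarrow> P (\<lambda>x. f x + g x)"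
    and scale: "\<And>f c. integrable circle_measure f \<Longrightarrow> P f \<Longrightarrow> P (\<lambda>x. c * f x)"
    and lim: "\<And>f. integrable circle_measure f \<Longrightarrow>
      (\<And>e. 0 < e \<Longrightarrow> \<exists>g. integrable circle_measure g \<and> P g \<and> (\<integral>x. \<bar>f x - g x\<bar> \<partial>circle_measure) < e) \<Longrightarrow> P f"
  shows "P h"
proof -
  note dom = L1_class_dominated[of P, OF lim]
  have zero: "P (\<lambda>_. 0)" using scale[of "\<lambda>_. 1" 0] one by simp
  have ind: "P (indicator A)" if A: "A \<in> sets borel" for A
  proof -
    have "G \<subseteq> Pow UNIV" "A \<in> sigma_sets UNIV G" using A G(2) by simp_all
    with G(1) show ?thesis
    proof (induction rule: sigma_sets_induct_disjoint)
      case (basic A) then show ?case by (rule assms(4))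
    next
      case empty then show ?case using zero by (simp add: indicator_def[abs_def])
    next
      case (compl A)
      have i: "integrable circle_measure (indicator A :: circle \<Rightarrow> real)"
        by (rule integrable_indicator_circle) (simp add: G(2) compl(1))
      have "integrable circle_measure (\<lambda>x. (- 1) * indicator A x :: real)"
        by (rule integrable_mult_right[OF i])
      from add[OF _ one this scale[OF i compl(2)]]
      have "P (\<lambda>x. 1 + (- 1) * indicator A x)" by simp
      moreover have "(\<lambda>x. 1 + (- 1) * indicator A x) = (indicator (UNIV - A) :: circle \<Rightarrow> real)"
        by (auto simp: indicator_def)
      ultimately show ?case by simp
    next
      case (union A)
      have A: "A i \<in> sets borel" for i using union(2) G(2) by auto
      have "P (indicator (\<Union>i<n. A i))" for n
      proof (induction n)
        case 0 then show ?case using zero by (simp add: indicator_def[abs_def])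
      next
        case (Suc n)
        have "(indicator (\<Union>i<Suc n. A i) :: circle \<Rightarrow> real) = (\<lambda>x. indicator (\<Union>i<n. A i) x + indicator (A n) x)"
        proof
          fix x
          have "A n \<inter> A j = {}" if "j < n" for j
            using disjoint_family_onD[OF union(1), of n j] that by simp
          then have "x \<notin> A n \<or> x \<notin> (\<Union>i<n. A i)" by auto
          then show "(indicator (\<Union>i<Suc n. A i) x :: real) = indicator (\<Union>i<n. A i) x + indicator (A n) x"
            by (auto simp: indicator_def lessThan_Suc)
        qed
        moreover have "integrable circle_measure (indicator (\<Union>i<n. A i) :: circle \<Rightarrow> real)"
          "integrable circle_measure (indicator (A n) :: circle \<Rightarrow> real)"
          using A by (auto intro!: integrable_indicator_circle)
        ultimately show ?case using add[OF _ Suc _ union(3)] by simp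
      qed
      note part = this
      show ?case
      proof (rule dom[where s="\<lambda>n. indicator (\<Union>i<n. A i)" and w="\<lambda>_. 1"])
        show "integrable circle_measure (indicator (\<Union>i<n. A i) :: circle \<Rightarrow> real)" for n
          using A by (intro integrable_indicator_circle) auto
        show "integrable circle_measure (indicator (\<Union>i. A i) :: circle \<Rightarrow> real)"
          using A by (intro integrable_indicator_circle) auto
        show "(\<lambda>n. indicator (\<Union>i<n. A i) x :: real) \<longlonglongrightarrow> indicator (\<Union>i. A i) x" for x
          by (rule LIMSEQ_indicator_UN)
      qed (auto simp: indicator_def intro: part)
    qed
  qed
  show ?thesis using h
  proof (induction rule: integrable_induct)
    case (base A c)
    then show ?case using scale[OF _ ind, of A c] by (simp add: mult.commute integrable_indicator_circle)
  next
    case (add f g) show ?case by (rule assms(6)[OF add(1,3,2,4)])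
  next
    case (lim f s)
    show ?case by (rule dom[where s=s and f=f and w="\<lambda>x. 2 * \<bar>f x\<bar>"]) (use lim in auto)
  qed
qed

lemma closed_sets_generate: "sets (borel :: circle measure) = sigma_sets UNIV (Collect closed)"
  by (simp add: borel_eq_closed)

text \<open>The approximants are the positive parts of \<open>1 - n * infdist x C\<close>.\<close>

lemma indicator_closed_limit:
  fixes C :: "'a::metric_space set"
  assumes "closed C"
  obtains k :: "nat \<Rightarrow> 'a \<Rightarrow> real" where "\<And>n. continuous_on UNIV (k n)" "\<And>n x. \<bar>k n x\<bar> \<le> 1"
    "\<And>x. (\<lambda>n. k n x) \<longlonglongrightarrow> indicator C x"
proof (cases "C = {}")
  case True
  show ?thesis by (rule that[of "\<lambda>_ _. 0"]) (auto simp: True)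
next
  case False
  define k where "k n x = max 0 (1 - real n * infdist x C)" for n x
  show ?thesis
  proof (rule that[of k])
    show "continuous_on UNIV (k n)" for n unfolding k_def by (intro continuous_intros)
    show "\<bar>k n x\<bar> \<le> 1" for n x using infdist_nonneg[of x C] by (simp add: k_def)
    fix x
    show "(\<lambda>n. k n x) \<longlonglongrightarrow> indicator C x"
    proof (cases "x \<in> C")
      case True then show ?thesis by (simp add: k_def)
    next
      case False
      then have d: "infdist x C > 0"
        using assms \<open>C \<noteq> {}\<close> in_closed_iff_infdist_zero infdist_nonneg[of x C] by (metis order_le_less)
      obtain n0 where n0: "1 / infdist x C \<le> real n0" using real_arch_simple by blast
      have "k n x = 0" if "n \<ge> n0" for n
      proof -
        have "1 / infdist x C \<le> real n" using n0 that by linarith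
        then show ?thesis using d by (simp add: k_def field_simps)
      qed
      then have "\<forall>\<^sub>F n in sequentially. k n x = 0" by (auto simp: eventually_sequentially)
      then show ?thesis using False by (simp add: tendsto_eventually)
    qed
  qed
qed

lemma bounded_borel_continuous:
  fixes k :: "circle \<Rightarrow> real"
  assumes "continuous_on UNIV k" shows "bounded_borel k"
  unfolding bounded_borel_def using assms compact_UNIV_circle
  by (auto intro: borel_measurable_continuous_onI compact_imp_bounded compact_continuous_image)

text \<open>Closed sets form a \<open>\<pi>\<close>-system that generates the Borel sets, and their indicators are bounded limits of
continuous functions.\<close>

lemma integrable_circle_induct_continuous:
  fixes h :: "circle \<Rightarrow> real"
  assumes h: "integrable circle_measure h"
    and cont: "\<And>k. continuous_on UNIV k \<Longrightarrow> P k"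
    and add: "\<And>f g. integrable circle_measure f \<Longrightarrow> P f \<Longrightarrow> integrable circle_measure g \<Longrightarrow> P g \<Longrightarrow> P (\<lambda>x. f x + g x)"
    and scale: "\<And>f c. integrable circle_measure f \<Longrightarrow> P f \<Longrightarrow> P (\<lambda>x. c * f x)"
    and lim: "\<And>f. integrable circle_measure f \<Longrightarrow>
      (\<And>e. 0 < e \<Longrightarrow> \<exists>g. integrable circle_measure g \<and> P g \<and> (\<integral>x. \<bar>f x - g x\<bar> \<partial>circle_measure) < e) \<Longrightarrow> P f"
  shows "P h"
proof (rule integrable_circle_induct[OF h _ closed_sets_generate _ _ add scale lim])
  show "Int_stable (Collect (closed :: circle set \<Rightarrow> bool))" by (auto simp: Int_stable_def)
  show "P (indicator C)" if "C \<in> Collect closed" for C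
  proof -
    have C: "closed C" using that by simp
    obtain k :: "nat \<Rightarrow> circle \<Rightarrow> real" where k: "\<And>n. continuous_on UNIV (k n)" "\<And>n x. \<bar>k n x\<bar> \<le> 1"
      "\<And>x. (\<lambda>n. k n x) \<longlonglongrightarrow> indicator C x" using indicator_closed_limit[OF C] by blast
    show ?thesis
    proof (rule L1_class_dominated[where P=P and s=k and w="\<lambda>_. 1", OF lim])
      show "integrable circle_measure (k i)" for i
        by (rule integrable_bounded_borel[OF bounded_borel_continuous[OF k(1)]])
      show "integrable circle_measure (indicator C :: circle \<Rightarrow> real)"
        using C by (intro integrable_indicator_circle borel_closed)
      show "integrable circle_measure (\<lambda>_. 1::real)" by simp
    qed (use k cont in auto)
  qed
  show "P (\<lambda>_. 1)" by (rule cont) simp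
qed

section \<open>A multiple fold acts like averaging over cells\<close>

definition cell :: "nat \<Rightarrow> nat \<Rightarrow> circle set" where
  "cell n i = {x. real i / real n \<le> coord x \<and> coord x < (real i + 1) / real n}"

lemma cell_measurable [measurable]: "cell n i \<in> sets borel"
  unfolding cell_def by measurable

lemma bounded_borel_cell: "bounded_borel (indicator (cell n i))"
  by (rule bounded_borel_indicator) simp

lemma sum_indicator_cells:
  assumes "n > 0" shows "(\<Sum>i<n. indicator (cell n i) x) = (1::real)"
proof -
  define k where "k = nat \<lfloor>real n * coord x\<rfloor>"
  have k: "int k = \<lfloor>real n * coord x\<rfloor>" by (simp add: k_def)
  have mem: "x \<in> cell n i \<longleftrightarrow> i = k" for i
  proof -
    have "x \<in> cell n i \<longleftrightarrow> real i \<le> real n * coord x \<and> real n * coord x < real i + 1"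
      using assms by (simp add: cell_def field_simps)
    also have "\<dots> \<longleftrightarrow> \<lfloor>real n * coord x\<rfloor> = int i" by (auto simp: floor_eq_iff)
    also have "\<dots> \<longleftrightarrow> i = k" using k by auto
    finally show ?thesis .
  qed
  have "real n * coord x < real n" using assms by simp
  then have "k < n" using k by linarith
  have "(\<Sum>i<n. indicator (cell n i) x) = (\<Sum>i<n. if i = k then 1 else (0::real))"
    by (intro sum.cong refl) (simp add: indicator_def mem)
  also have "\<dots> = 1" using \<open>k < n\<close> by simp
  finally show ?thesis .
qed

lemma integral_over_cell:
  assumes F: "bounded_borel F" and i: "i < n"
  shows "(\<integral>x. indicator (cell n i) x * F x \<partial>circle_measure) = cell_integral n F (int i)"
proof -
  have n: "n > 0" using i by simp
  have [measurable]: "F \<in> borel_measurable borel" using F by (rule bounded_borelD)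
  have "(real i + 1) / real n \<le> 1" using i by (simp add: field_simps)
  then have range: "0 \<le> t \<and> t < 1" if "real i / real n \<le> t" "t < (real i + 1) / real n" for t
    using that order_trans[of 0 "real i / real n" t] by auto
  have "circle_of t \<in> cell n i \<and> t \<in> {0..<1} \<longleftrightarrow> t \<in> {real i / real n..<(real i + 1) / real n}" for t
    using range[of t] by (auto simp: cell_def frac_eq[THEN iffD2])
  then have eq: "indicator {0..<1} t * (indicator (cell n i) (circle_of t) * F (circle_of t)) =
      indicator {real i / real n..<(real i + 1) / real n} t * F (circle_of t)" for t
    by (auto simp: indicator_def)
  have "(\<integral>x. indicator (cell n i) x * F x \<partial>circle_measure) =
    (LINT t:{real i / real n..<(real i + 1) / real n}|lborel. F (circle_of t))"
    unfolding set_lebesgue_integral_def by (subst integral_circle_measure) 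
      (simp_all add: set_lebesgue_integral_def eq)
  also have "\<dots> = cell_integral n F (int i)"
    by (simp add: arc_integral_Ico[OF F] cell_integral_def)
  finally show ?thesis .
qed

lemma cell_integral_add:
  "bounded_borel F \<Longrightarrow> bounded_borel G \<Longrightarrow> 
    cell_integral n (\<lambda>x. F x + G x) i = cell_integral n F i + cell_integral n G i"
  unfolding cell_integral_def arc_integral_def by (intro integral_add arc_integrable)

lemma cell_integral_scale: "cell_integral n (\<lambda>x. c * F x) i = c * cell_integral n F i"
  unfolding cell_integral_def arc_integral_def by simp

lemma cell_integral_bound:
  assumes F: "bounded_borel F" and n: "n > 0"
    and B: "\<And>t. of_int i / real n \<le> t \<Longrightarrow> t \<le> (of_int i + 1) / real n \<Longrightarrow> \<bar>F (circle_of t)\<bar> \<le> B"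
  shows "\<bar>cell_integral n F i\<bar> \<le> B / real n"
proof -
  have "norm (integral {of_int i / real n..(of_int i + 1) / real n} (\<lambda>t. F (circle_of t)))
      \<le> integral {of_int i / real n..(of_int i + 1) / real n} (\<lambda>t. B)"
    by (rule integral_norm_bound_integral[OF arc_integrable[OF F]]) (use B in auto)
  also have "\<dots> = B / real n" using n by (simp add: field_simps)
  finally show ?thesis by (simp add: cell_integral_def arc_integral_def)
qed

lemma cell_integral_period: "n > 0 \<Longrightarrow> cell_integral n F (i + int n) = cell_integral n F i"
  using arc_integral_add_int[of F "of_int i / real n" 1 "(of_int i + 1) / real n"]
  by (simp add: cell_integral_def field_simps)

text \<open>The error made when the composite of \<open>H\<close> with the fold is treated as independent of \<open>h\<close> on each
cell; equivalently, when the transfer operator of the fold is replaced by the conditional expectation on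
the cells. The rotation of \<open>h\<close> is kept as a parameter because all estimates have to be uniform in it.\<close>

definition fold_defect :: "nat \<Rightarrow> nat \<Rightarrow> real \<Rightarrow> (circle \<Rightarrow> real) \<Rightarrow> (circle \<Rightarrow> real) \<Rightarrow> real" where
  "fold_defect N m b H h = (\<integral>x. h (rotation b x) * H (fold_map N m x) \<partial>circle_measure)
    - (\<Sum>i<N. real N * (\<integral>x. indicator (cell N i) x * h (rotation b x) \<partial>circle_measure) * cell_integral N H (int i))"

text \<open>The bound 1 makes the estimates uniform over the whole class.\<close>

definition test_function :: "(circle \<Rightarrow> real) \<Rightarrow> bool" where
  "test_function H \<longleftrightarrow> H \<in> borel_measurable borel \<and> (\<forall>x. \<bar>H x\<bar> \<le> 1)"

lemma test_function_bounded_borel: "test_function H \<Longrightarrow> bounded_borel H"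
  unfolding test_function_def by (auto intro: bounded_borelI)

lemma integrable_mult_bounded:
  fixes h :: "circle \<Rightarrow> real"
  assumes h: "integrable circle_measure h" and G: "bounded_borel G"
  shows "integrable circle_measure (\<lambda>x. h x * G x)" "integrable circle_measure (\<lambda>x. G x * h x)"
proof -
  have [measurable]: "G \<in> borel_measurable borel" using G by (rule bounded_borelD)
  have [measurable]: "h \<in> borel_measurable borel" using borel_measurable_integrable[OF h] by simp
  obtain B where B: "0 \<le> B" "\<And>x. \<bar>G x\<bar> \<le> B" using bounded_borel_bound[OF G] by blast
  show "integrable circle_measure (\<lambda>x. h x * G x)"
    by (rule Bochner_Integration.integrable_bound[of _ "\<lambda>x. B * h x"])
      (use B h in \<open>auto simp: abs_mult mult.commute[of "\<bar>h _\<bar>"] intro!: mult_right_mono\<close>)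
  then show "integrable circle_measure (\<lambda>x. G x * h x)" by (simp add: mult.commute)
qed

lemma fold_defect_add:
  assumes "integrable circle_measure f" "integrable circle_measure g" "N > 0" "odd m" "test_function H"
  shows "fold_defect N m b H (\<lambda>x. f x + g x) = fold_defect N m b H f + fold_defect N m b H g"
proof -
  note r = C_leb_integrable[OF rotation_in_C_leb[of b]]
  have b: "bounded_borel (\<lambda>x. H (fold_map N m x))"
    by (rule bounded_borel_comp[OF test_function_bounded_borel fold_map_measurable]) (use assms in auto)
  have "(\<integral>x. (f (rotation b x) + g (rotation b x)) * H (fold_map N m x) \<partial>circle_measure) =
    (\<integral>x. f (rotation b x) * H (fold_map N m x) \<partial>circle_measure) + (\<integral>x. g (rotation b x) * H (fold_map N m x) \<partial>circle_measure)"
    unfolding distrib_right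
    by (rule Bochner_Integration.integral_add[OF integrable_mult_bounded(1)[OF r b] integrable_mult_bounded(1)[OF r b]])
      (use assms in auto)
  moreover have "(\<integral>x. indicator (cell N i) x * (f (rotation b x) + g (rotation b x)) \<partial>circle_measure) =
    (\<integral>x. indicator (cell N i) x * f (rotation b x) \<partial>circle_measure) + (\<integral>x. indicator (cell N i) x * g (rotation b x) \<partial>circle_measure)" for i
    unfolding distrib_left
    by (rule Bochner_Integration.integral_add[OF integrable_mult_bounded(2)[OF r bounded_borel_cell] integrable_mult_bounded(2)[OF r bounded_borel_cell]])
      (use assms in auto)
  ultimately show ?thesis unfolding fold_defect_def by (simp add: algebra_simps sum.distrib)
qed

lemma fold_defect_scale: "fold_defect N m b H (\<lambda>x. c * f x) = c * fold_defect N m b H f"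
proof -
  have "(\<integral>x. indicator (cell N i) x * (c * f (rotation b x)) \<partial>circle_measure) =
    c * (\<integral>x. indicator (cell N i) x * f (rotation b x) \<partial>circle_measure)" for i
    by (simp add: mult.left_commute[of _ c])
  then show ?thesis
    unfolding fold_defect_def by (simp add: right_diff_distrib sum_distrib_left mult.assoc mult.left_commute[of _ c])
qed

text \<open>Both terms of the defect are contractions from the mean norm, as \<open>H\<close> and its cell averages are bounded by 1.\<close>

lemma fold_defect_bound:
  assumes f: "integrable circle_measure f" and N: "N > 0" and m: "odd m" and H: "test_function H"
  shows "\<bar>fold_defect N m b H f\<bar> \<le> 2 * (\<integral>x. \<bar>f x\<bar> \<partial>circle_measure)"
proof -
  define I where "I = (\<integral>x. \<bar>f x\<bar> \<partial>circle_measure)"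
  have [measurable]: "f \<in> borel_measurable borel" using borel_measurable_integrable[OF f] by simp
  have fb: "integrable circle_measure (\<lambda>x. f (rotation b x))" by (rule C_leb_integrable[OF rotation_in_C_leb f])
  then have afb: "integrable circle_measure (\<lambda>x. \<bar>f (rotation b x)\<bar>)" by simp
  have I: "(\<integral>x. \<bar>f (rotation b x)\<bar> \<partial>circle_measure) = I"
    unfolding I_def by (rule C_leb_integral[OF rotation_in_C_leb]) simp
  have Hb: "\<bar>H x\<bar> \<le> 1" for x using H by (simp add: test_function_def)
  have b: "bounded_borel (\<lambda>x. H (fold_map N m x))"
    by (rule bounded_borel_comp[OF test_function_bounded_borel[OF H] fold_map_measurable[OF N m]])
  have "\<bar>\<integral>x. f (rotation b x) * H (fold_map N m x) \<partial>circle_measure\<bar> \<le> (\<integral>x. \<bar>f (rotation b x) * H (fold_map N m x)\<bar> \<partial>circle_measure)"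
    by (rule integral_abs_bound)
  also have "\<dots> \<le> (\<integral>x. \<bar>f (rotation b x)\<bar> \<partial>circle_measure)"
    by (rule integral_mono[OF integrable_abs[OF integrable_mult_bounded(1)[OF fb b]] afb])
      (use Hb in \<open>simp add: abs_mult mult_left_le\<close>)
  finally have 1: "\<bar>\<integral>x. f (rotation b x) * H (fold_map N m x) \<partial>circle_measure\<bar> \<le> I" using I by simp
  have c: "\<bar>cell_integral N H i\<bar> \<le> 1 / real N" for i
    by (rule cell_integral_bound[OF test_function_bounded_borel[OF H] N Hb])
  have "\<bar>\<Sum>i<N. real N * (\<integral>x. indicator (cell N i) x * f (rotation b x) \<partial>circle_measure) * cell_integral N H (int i)\<bar>
    \<le> (\<Sum>i<N. \<integral>x. indicator (cell N i) x * \<bar>f (rotation b x)\<bar> \<partial>circle_measure)"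
  proof (rule order_trans[OF sum_abs], rule sum_mono)
    fix i
    have le: "\<bar>\<integral>x. indicator (cell N i) x * f (rotation b x) \<partial>circle_measure\<bar> \<le> (\<integral>x. indicator (cell N i) x * \<bar>f (rotation b x)\<bar> \<partial>circle_measure)"
      using integral_abs_bound[of circle_measure "\<lambda>x. indicator (cell N i) x * f (rotation b x)"]
      by (simp add: abs_mult)
    have "\<bar>real N * (\<integral>x. indicator (cell N i) x * f (rotation b x) \<partial>circle_measure) * cell_integral N H (int i)\<bar>
      = \<bar>\<integral>x. indicator (cell N i) x * f (rotation b x) \<partial>circle_measure\<bar> * (real N * \<bar>cell_integral N H (int i)\<bar>)"
      by (simp add: abs_mult)
    also have "\<dots> \<le> \<bar>\<integral>x. indicator (cell N i) x * f (rotation b x) \<partial>circle_measure\<bar> * 1"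
      using c[of "int i"] N by (intro mult_left_mono) (auto simp: field_simps)
    finally show "\<bar>real N * (\<integral>x. indicator (cell N i) x * f (rotation b x) \<partial>circle_measure) * cell_integral N H (int i)\<bar>
      \<le> (\<integral>x. indicator (cell N i) x * \<bar>f (rotation b x)\<bar> \<partial>circle_measure)" using le by simp
  qed
  also have "\<dots> = (\<integral>x. (\<Sum>i<N. indicator (cell N i) x * \<bar>f (rotation b x)\<bar>) \<partial>circle_measure)"
    by (rule Bochner_Integration.integral_sum[symmetric]) (rule integrable_mult_bounded(2)[OF afb bounded_borel_cell])
  also have "\<dots> = I" by (simp add: sum_indicator_cells[OF N] I flip: sum_distrib_right)
  finally show ?thesis using 1 unfolding fold_defect_def I_def by linarith
qed

text \<open>On a branch \<open>h\<close> is constant up to \<open>e\<close>, and against a constant the branch property gives exact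
independence. Each of the two terms of the defect contributes at most \<open>e\<close>.\<close>

lemma fold_defect_continuous_bound:
  assumes h: "continuous_on UNIV h" and N: "N > 0" and m: "odd m" and H: "test_function H"
    and close: "\<And>x y. dist x y \<le> 1 / real (N * m) \<Longrightarrow> \<bar>h x - h y\<bar> \<le> e"
  shows "\<bar>fold_defect N m b H h\<bar> \<le> 2 * e"
proof -
  have m0: "m > 0" using m by (cases m) auto
  then have Nm: "N * m > 0" using N by simp
  define k where "k x = h (rotation b x)" for x
  define K where "K x = H (fold_map N m x)" for x
  have Hb: "bounded_borel H" by (rule test_function_bounded_borel[OF H])
  have H1: "\<bar>H x\<bar> \<le> 1" for x using H by (simp add: test_function_def)
  have kb: "bounded_borel k" unfolding k_def[abs_def]
    by (rule bounded_borel_comp[OF bounded_borel_continuous[OF h] C_leb_measurable[OF rotation_in_C_leb]])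
  have Kb: "bounded_borel K" unfolding K_def[abs_def]
    by (rule bounded_borel_comp[OF Hb fold_map_measurable[OF N m]])
  have kKb: "bounded_borel (\<lambda>x. k x * K x)" by (rule bounded_borel_mult[OF kb Kb])
  have cH: "\<bar>real N * cell_integral N H i\<bar> \<le> 1" for i
    using cell_integral_bound[OF Hb N H1, of i] N by (simp add: abs_mult field_simps)
  let ?J = "\<lambda>i l. int i * int m + int l"
  have piece: "\<bar>cell_integral (N * m) (\<lambda>x. k x * K x) (?J i l) - real N * cell_integral N H (int i) * cell_integral (N * m) k (?J i l)\<bar>
      \<le> 2 * e / real (N * m)" if l: "l < m" for i l
  proof -
    define c where "c = k (circle_of (of_int (?J i l) / real (N * m)))"
    \<comment> \<open>The value of \<open>h\<close> at the left end of the branch serves as the constant.\<close>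
    define k' where "k' x = k x + - c" for x
    have k'b: "bounded_borel k'"
    proof -
      obtain B where B: "\<And>x. \<bar>k x\<bar> \<le> B" using bounded_borel_bound[OF kb] by blast
      have "\<bar>k' x\<bar> \<le> B + \<bar>c\<bar>" for x unfolding k'_def using B[of x] by linarith
      then show ?thesis unfolding k'_def[abs_def] using bounded_borelD[OF kb]
        by (intro bounded_borelI[of _ "B + \<bar>c\<bar>"]) auto
    qed
    have k'K: "bounded_borel (\<lambda>x. k' x * K x)" by (rule bounded_borel_mult[OF k'b Kb])
    have k': "\<bar>k' (circle_of t)\<bar> \<le> e"
      if t: "of_int (?J i l) / real (N * m) \<le> t" "t \<le> (of_int (?J i l) + 1) / real (N * m)" for t
    proof -
      have "dist (rotation b (circle_of t)) (rotation b (circle_of (of_int (?J i l) / real (N * m))))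
        \<le> \<bar>t - of_int (?J i l) / real (N * m)\<bar>"
        unfolding dist_rotation by (rule dist_circle_of_le)
      also have "\<dots> \<le> 1 / real (N * m)" using t by (simp add: add_divide_distrib)
      finally show ?thesis using close unfolding k'_def c_def k_def by simp
    qed
    have "cell_integral (N * m) (\<lambda>x. k x * K x) (?J i l) =
        cell_integral (N * m) (\<lambda>x. k' x * K x + c * K x) (?J i l)"
      by (simp add: k'_def algebra_simps)
    also have "\<dots> = cell_integral (N * m) (\<lambda>x. k' x * K x) (?J i l) + c * (cell_integral N H (int i) / real m)"
      using fold_map_branch[OF N m l, of H "int i"] 
      by (simp add: cell_integral_add[OF k'K bounded_borel_mult[OF bounded_borel_const Kb]]
        cell_integral_scale) (simp add: K_def[abs_def])
    finally have 1: "cell_integral (N * m) (\<lambda>x. k x * K x) (?J i l) =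
       cell_integral (N * m) (\<lambda>x. k' x * K x) (?J i l) + c * (cell_integral N H (int i) / real m)" .
    have "cell_integral (N * m) (\<lambda>x. c) (?J i l) = c / real (N * m)"
      unfolding cell_integral_def arc_integral_def using Nm by (simp add: add_divide_distrib)
    then have 2: "cell_integral (N * m) k (?J i l) = cell_integral (N * m) k' (?J i l) + c / real (N * m)"
      using cell_integral_add[OF k'b bounded_borel_const, of "N * m" c "?J i l"] by (simp add: k'_def)
    have 3: "\<bar>cell_integral (N * m) (\<lambda>x. k' x * K x) (?J i l)\<bar> \<le> e / real (N * m)"
    proof (rule cell_integral_bound[OF k'K Nm])
      fix t assume t: "of_int (?J i l) / real (N * m) \<le> t" "t \<le> (of_int (?J i l) + 1) / real (N * m)"
      have "\<bar>k' (circle_of t)\<bar> * \<bar>K (circle_of t)\<bar> \<le> e * 1"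
        using k'[OF t] H1 by (intro mult_mono) (auto simp: K_def)
      then show "\<bar>k' (circle_of t) * K (circle_of t)\<bar> \<le> e" by (simp add: abs_mult)
    qed
    have 4: "\<bar>cell_integral (N * m) k' (?J i l)\<bar> \<le> e / real (N * m)"
      by (rule cell_integral_bound[OF k'b Nm k'])
    have "\<bar>real N * cell_integral N H (int i)\<bar> * \<bar>cell_integral (N * m) k' (?J i l)\<bar> \<le> 1 * (e / real (N * m))"
      using cH[of "int i"] 4 by (intro mult_mono) auto
    then have 5: "\<bar>real N * cell_integral N H (int i) * cell_integral (N * m) k' (?J i l)\<bar> \<le> e / real (N * m)"
      by (simp add: abs_mult)
    have "cell_integral (N * m) (\<lambda>x. k x * K x) (?J i l) - real N * cell_integral N H (int i) * cell_integral (N * m) k (?J i l)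
      = cell_integral (N * m) (\<lambda>x. k' x * K x) (?J i l) - real N * cell_integral N H (int i) * cell_integral (N * m) k' (?J i l)"
      unfolding 1 2 using N by (simp add: field_simps)
    then show ?thesis using 3 5 by (simp add: abs_le_iff)
  qed
  have "fold_defect N m b H h = (\<Sum>i<N. \<Sum>l<m. cell_integral (N * m) (\<lambda>x. k x * K x) (?J i l) 
      - real N * cell_integral N H (int i) * cell_integral (N * m) k (?J i l))"
  proof -
    have "(\<integral>x. h (rotation b x) * H (fold_map N m x) \<partial>circle_measure) = (\<Sum>i<N. cell_integral N (\<lambda>x. k x * K x) (int i))"
      using integral_circle_cells[OF kKb N] by (simp add: k_def K_def)
    moreover have "(\<integral>x. indicator (cell N i) x * h (rotation b x) \<partial>circle_measure) = cell_integral N k (int i)" if "i < N" for i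
      using integral_over_cell[OF kb that] by (simp add: k_def)
    ultimately have "fold_defect N m b H h = (\<Sum>i<N. cell_integral N (\<lambda>x. k x * K x) (int i)
        - real N * cell_integral N H (int i) * cell_integral N k (int i))"
      unfolding fold_defect_def by (simp add: sum_subtractf mult.assoc mult.commute[of "cell_integral N H _"])
    then show ?thesis
      by (simp add: cell_integral_refine[OF kKb N m0] cell_integral_refine[OF kb N m0] sum_subtractf sum_distrib_left)
  qed
  also have "\<bar>\<dots>\<bar> \<le> (\<Sum>i<N. \<Sum>l<m. 2 * e / real (N * m))"
    by (intro order_trans[OF sum_abs] sum_mono piece) auto
  also have "\<dots> = 2 * e" using N m0 by simp
  finally show ?thesis .
qed

text \<open>The threshold \<open>M\<close> depends neither on the angle nor on the test function. For continuous \<open>h\<close> this is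
uniform continuity, which rotations respect; the general case follows by approximation in mean.\<close>

lemma fold_defect_tendsto:
  assumes h: "integrable circle_measure h" and N: "N > 0"
  shows "\<forall>e>0. \<exists>M. \<forall>m\<ge>M. odd m \<longrightarrow> (\<forall>b H. test_function H \<longrightarrow> \<bar>fold_defect N m b H h\<bar> \<le> e)"
  using h
proof (rule integrable_circle_induct_continuous[where P = "\<lambda>h. \<forall>e>0. \<exists>M. \<forall>m\<ge>M. odd m \<longrightarrow> (\<forall>b H. test_function H \<longrightarrow> \<bar>fold_defect N m b H h\<bar> \<le> e)"])
  fix k :: "circle \<Rightarrow> real" assume k: "continuous_on UNIV k"
  show "\<forall>e>0. \<exists>M. \<forall>m\<ge>M. odd m \<longrightarrow> (\<forall>b H. test_function H \<longrightarrow> \<bar>fold_defect N m b H k\<bar> \<le> e)"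
  proof (intro allI impI)
    fix e :: real assume e: "0 < e"
    have "uniformly_continuous_on UNIV k" by (rule compact_uniformly_continuous[OF k compact_UNIV_circle])
    then obtain d where d: "d > 0" "\<And>x y. dist x y < d \<Longrightarrow> \<bar>k x - k y\<bar> < e / 2"
      unfolding uniformly_continuous_on_def dist_real_def using e by (metis UNIV_I half_gt_zero)
    obtain M :: nat where M: "1 / d < real M" using reals_Archimedean2 by blast
    show "\<exists>M. \<forall>m\<ge>M. odd m \<longrightarrow> (\<forall>b H. test_function H \<longrightarrow> \<bar>fold_defect N m b H k\<bar> \<le> e)"
    proof (intro exI[of _ M] allI impI)
      fix m b H assume m: "M \<le> m" "odd m" and H: "test_function H"
      have "1 / d < real m" using M m(1) by linarith
      also have "\<dots> \<le> real (N * m)" using N by (cases N) auto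
      finally have "1 / real (N * m) < d" using d(1) \<open>1 / d < real m\<close>
        by (metis divide_less_eq mult.commute less_trans zero_less_divide_1_iff pos_divide_less_eq)
      then have "\<bar>fold_defect N m b H k\<bar> \<le> 2 * (e / 2)"
        by (intro fold_defect_continuous_bound[OF k N m(2) H] less_imp_le[OF d(2)]) simp
      then show "\<bar>fold_defect N m b H k\<bar> \<le> e" by simp
    qed
  qed
next
  fix f g :: "circle \<Rightarrow> real"
  assume f: "integrable circle_measure f" and Pf: "\<forall>e>0. \<exists>M. \<forall>m\<ge>M. odd m \<longrightarrow> (\<forall>b H. test_function H \<longrightarrow> \<bar>fold_defect N m b H f\<bar> \<le> e)"
    and g: "integrable circle_measure g" and Pg: "\<forall>e>0. \<exists>M. \<forall>m\<ge>M. odd m \<longrightarrow> (\<forall>b H. test_function H \<longrightarrow> \<bar>fold_defect N m b H g\<bar> \<le> e)"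
  show "\<forall>e>0. \<exists>M. \<forall>m\<ge>M. odd m \<longrightarrow> (\<forall>b H. test_function H \<longrightarrow> \<bar>fold_defect N m b H (\<lambda>x. f x + g x)\<bar> \<le> e)"
  proof (intro allI impI)
    fix e :: real assume "0 < e"
    then have "e / 2 > 0" by simp
    with Pf Pg obtain M M' where
      M: "\<And>m b H. m \<ge> M \<Longrightarrow> odd m \<Longrightarrow> test_function H \<Longrightarrow> \<bar>fold_defect N m b H f\<bar> \<le> e / 2" and
      M': "\<And>m b H. m \<ge> M' \<Longrightarrow> odd m \<Longrightarrow> test_function H \<Longrightarrow> \<bar>fold_defect N m b H g\<bar> \<le> e / 2" by meson
    show "\<exists>M. \<forall>m\<ge>M. odd m \<longrightarrow> (\<forall>b H. test_function H \<longrightarrow> \<bar>fold_defect N m b H (\<lambda>x. f x + g x)\<bar> \<le> e)"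
    proof (intro exI[of _ "max M M'"] allI impI)
      fix m b H assume m: "max M M' \<le> m" "odd m" and H: "test_function H"
      show "\<bar>fold_defect N m b H (\<lambda>x. f x + g x)\<bar> \<le> e"
        unfolding fold_defect_add[OF f g N m(2) H] using M[of m H b] M'[of m H b] m H by simp
    qed
  qed
next
  fix f :: "circle \<Rightarrow> real" and c :: real
  assume Pf: "\<forall>e>0. \<exists>M. \<forall>m\<ge>M. odd m \<longrightarrow> (\<forall>b H. test_function H \<longrightarrow> \<bar>fold_defect N m b H f\<bar> \<le> e)"
  show "\<forall>e>0. \<exists>M. \<forall>m\<ge>M. odd m \<longrightarrow> (\<forall>b H. test_function H \<longrightarrow> \<bar>fold_defect N m b H (\<lambda>x. c * f x)\<bar> \<le> e)"
  proof (intro allI impI)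
    fix e :: real assume e: "0 < e"
    then have "e / (\<bar>c\<bar> + 1) > 0" by simp
    with Pf obtain M where 
      M: "\<And>m b H. m \<ge> M \<Longrightarrow> odd m \<Longrightarrow> test_function H \<Longrightarrow> \<bar>fold_defect N m b H f\<bar> \<le> e / (\<bar>c\<bar> + 1)" by meson
    show "\<exists>M. \<forall>m\<ge>M. odd m \<longrightarrow> (\<forall>b H. test_function H \<longrightarrow> \<bar>fold_defect N m b H (\<lambda>x. c * f x)\<bar> \<le> e)"
    proof (intro exI[of _ M] allI impI)
      fix m b H assume m: "M \<le> m" "odd m" and H: "test_function H"
      have "\<bar>c\<bar> * \<bar>fold_defect N m b H f\<bar> \<le> (\<bar>c\<bar> + 1) * (e / (\<bar>c\<bar> + 1))"
        using M[OF m H] by (intro mult_mono) auto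
      then show "\<bar>fold_defect N m b H (\<lambda>x. c * f x)\<bar> \<le> e" by (simp add: fold_defect_scale abs_mult)
    qed
  qed
next
  fix f :: "circle \<Rightarrow> real"
  assume f: "integrable circle_measure f" 
    and approx: "\<And>e. 0 < e \<Longrightarrow> \<exists>g. integrable circle_measure g \<and> (\<forall>e>0. \<exists>M. \<forall>m\<ge>M. odd m \<longrightarrow> (\<forall>b H. test_function H \<longrightarrow> \<bar>fold_defect N m b H g\<bar> \<le> e)) \<and>
        (\<integral>x. \<bar>f x - g x\<bar> \<partial>circle_measure) < e"
  show "\<forall>e>0. \<exists>M. \<forall>m\<ge>M. odd m \<longrightarrow> (\<forall>b H. test_function H \<longrightarrow> \<bar>fold_defect N m b H f\<bar> \<le> e)"
  proof (intro allI impI)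
    fix e :: real assume e: "0 < e"
    then obtain g where g: "integrable circle_measure g" "(\<integral>x. \<bar>f x - g x\<bar> \<partial>circle_measure) < e / 4"
      and Pg: "\<forall>e>0. \<exists>M. \<forall>m\<ge>M. odd m \<longrightarrow> (\<forall>b H. test_function H \<longrightarrow> \<bar>fold_defect N m b H g\<bar> \<le> e)"
      using approx[of "e / 4"] by auto
    from Pg e obtain M where 
      M: "\<And>m b H. m \<ge> M \<Longrightarrow> odd m \<Longrightarrow> test_function H \<Longrightarrow> \<bar>fold_defect N m b H g\<bar> \<le> e / 2" by (meson half_gt_zero)
    show "\<exists>M. \<forall>m\<ge>M. odd m \<longrightarrow> (\<forall>b H. test_function H \<longrightarrow> \<bar>fold_defect N m b H f\<bar> \<le> e)"
    proof (intro exI[of _ M] allI impI)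
      fix m b H assume m: "M \<le> m" "odd m" and H: "test_function H"
      have fg: "integrable circle_measure (\<lambda>x. f x - g x)" using f g(1) by simp
      have "fold_defect N m b H f = fold_defect N m b H (\<lambda>x. g x + (f x - g x))" by simp
      also have "\<dots> = fold_defect N m b H g + fold_defect N m b H (\<lambda>x. f x - g x)"
        by (rule fold_defect_add[OF g(1) fg N m(2) H])
      finally show "\<bar>fold_defect N m b H f\<bar> \<le> e"
        using fold_defect_bound[OF fg N m(2) H, of b] M[OF m H, of b] g(2) by linarith
    qed
  qed
qed

section \<open>Contraction of cell averages\<close>

text \<open>The image under \<open>g\<close> of the restriction of the measure to \<open>K\<close> is dominated by the invariant measure, so
it has a Radon-Nikodym density. This density is the transfer operator of \<open>g\<close> applied to the indicator
of \<open>K\<close>; its integrability is all the regularity that a merely continuous \<open>g\<close> provides.\<close>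

lemma transfer_density:
  assumes g: "g \<in> C_leb" and K: "K \<in> sets borel"
  obtains h :: "circle \<Rightarrow> real" where "integrable circle_measure h"
    "\<And>F. bounded_borel F \<Longrightarrow> (\<integral>x. indicator K x * F (g x) \<partial>circle_measure) = (\<integral>x. h x * F x \<partial>circle_measure)"
proof -
  have [measurable]: "g \<in> borel_measurable borel" by (rule C_leb_measurable[OF g])
  define D where "D = density circle_measure (\<lambda>x. ennreal (indicator K x))"
  define \<nu> where "\<nu> = distr D borel g"
  have [measurable_cong]: "sets D = sets borel" by (simp add: D_def)
  have int: "integrable \<nu> F" "(\<integral>x. F x \<partial>\<nu>) = (\<integral>x. indicator K x * F (g x) \<partial>circle_measure)" if F: "bounded_borel F" for F
  proof -
    have [measurable]: "F \<in> borel_measurable borel" by (rule bounded_borelD[OF F])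
    have Fg: "bounded_borel (\<lambda>x. F (g x))" by (rule bounded_borel_comp[OF F C_leb_measurable[OF g]])
    have "integrable D (\<lambda>x. F (g x))"
      unfolding D_def using integrable_bounded_borel[OF bounded_borel_mult[OF bounded_borel_indicator[OF K] Fg]] K
      by (subst integrable_density) auto
    then show "integrable \<nu> F" unfolding \<nu>_def by (subst integrable_distr_eq) auto
    have "(\<integral>x. F x \<partial>\<nu>) = (\<integral>x. F (g x) \<partial>D)" unfolding \<nu>_def by (subst integral_distr) auto
    also have "\<dots> = (\<integral>x. indicator K x * F (g x) \<partial>circle_measure)"
      unfolding D_def using K by (subst integral_density) auto
    finally show "(\<integral>x. F x \<partial>\<nu>) = (\<integral>x. indicator K x * F (g x) \<partial>circle_measure)" .
  qed
  have one: "integrable \<nu> (\<lambda>_. 1::real)" by (rule int(1)[OF bounded_borel_const])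
  have D: "emeasure D B = emeasure circle_measure (K \<inter> B)" if [measurable]: "B \<in> sets borel" for B
  proof -
    have "emeasure D B = (\<integral>\<^sup>+x. ennreal (indicator K x) * indicator B x \<partial>circle_measure)"
      unfolding D_def using K by (subst emeasure_density) auto
    also have "\<dots> = (\<integral>\<^sup>+x. indicator (K \<inter> B) x \<partial>circle_measure)"
      by (intro nn_integral_cong) (simp add: indicator_def)
    also have "\<dots> = emeasure circle_measure (K \<inter> B)" using K by (subst nn_integral_indicator) auto
    finally show ?thesis .
  qed
  have nu: "emeasure \<nu> A = emeasure circle_measure (K \<inter> g -` A)" if A: "A \<in> sets borel" for A
  proof -
    have "emeasure \<nu> A = emeasure D (g -` A)" unfolding \<nu>_def using A by (subst emeasure_distr) (auto simp: D_def)
    also have "\<dots> = emeasure circle_measure (K \<inter> g -` A)"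
      using measurable_sets[OF C_leb_measurable[OF g] A] by (intro D) simp
    finally show ?thesis .
  qed
  have "space \<nu> = UNIV" by (simp add: \<nu>_def)
  then have "finite_measure \<nu>"
    by (intro finite_measureI) (simp add: nu)
  then interpret \<nu>: finite_measure \<nu> .
  have ac: "absolutely_continuous circle_measure \<nu>"
    unfolding absolutely_continuous_def
  proof
    fix A assume A: "A \<in> null_sets circle_measure"
    then have A': "A \<in> sets borel" by auto
    have "emeasure circle_measure (K \<inter> g -` A) \<le> emeasure circle_measure (g -` A)"
      using measurable_sets[OF C_leb_measurable[OF g] A'] by (intro emeasure_mono) auto
    also have "\<dots> = 0" using g A A' unfolding C_leb_def by auto
    finally have "emeasure \<nu> A = 0" using nu[OF A'] by simp
    then show "A \<in> null_sets \<nu>" using A' by (auto simp: \<nu>_def)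
  qed
  have s: "sets \<nu> = sets circle_measure" by (simp add: \<nu>_def)
  define h where "h x = enn2real (RN_deriv circle_measure \<nu> x)" for x
  note RN = circle.RN_deriv_integrable[OF \<nu>.sigma_finite_measure_axioms ac s]
    circle.RN_deriv_integral[OF \<nu>.sigma_finite_measure_axioms ac s]
  show ?thesis
  proof (rule that[of h])
    have "integrable circle_measure (\<lambda>x. h x * 1)"
      unfolding h_def by (rule iffD1[OF RN(1) one]) simp
    then show "integrable circle_measure h" by (simp only: mult_1_right)
    fix F :: "circle \<Rightarrow> real" assume F: "bounded_borel F"
    then have "F \<in> borel_measurable circle_measure"
      by (simp add: bounded_borel_def measurable_cong_sets[OF sets_circle_measure refl])
    from RN(2)[OF this] int(2)[OF F]
    show "(\<integral>x. indicator K x * F (g x) \<partial>circle_measure) = (\<integral>x. h x * F x \<partial>circle_measure)"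
      unfolding h_def by (simp only:)
  qed
qed

text \<open>A vector of mean zero is bounded by its largest difference of entries, this by the total variation, and
the total variation by the square root of \<open>N\<close> times the Euclidean norm of the increments.\<close>

lemma cyclic_poincare:
  fixes b :: "nat \<Rightarrow> real"
  assumes mean: "(\<Sum>i<N. b i) = 0"
  shows "(\<Sum>i<N. (b i)\<^sup>2) \<le> (real N)\<^sup>2 * (\<Sum>i<N. (b i - b (Suc i))\<^sup>2)"
proof -
  define V where "V = (\<Sum>i<N. \<bar>b i - b (Suc i)\<bar>)"
  define D where "D = (\<Sum>i<N. (b i - b (Suc i))\<^sup>2)"
  have V2: "V\<^sup>2 \<le> real N * D"
    using Cauchy_Schwarz_ineq_sum[of "\<lambda>_. 1" "\<lambda>i. \<bar>b i - b (Suc i)\<bar>" "{..<N}"] by (simp add: V_def D_def)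
  have tele: "\<bar>b j - b (j + d)\<bar> \<le> (\<Sum>i\<in>{j..<j + d}. \<bar>b i - b (Suc i)\<bar>)" for j d
    by (induction d) auto
  have diff: "\<bar>b j - b k\<bar> \<le> V" if "j < N" "k < N" for j k
  proof -
    have *: "\<bar>b j - b k\<bar> \<le> V" if "j \<le> k" "k < N" for j k
    proof -
      have "\<bar>b j - b k\<bar> \<le> (\<Sum>i\<in>{j..<k}. \<bar>b i - b (Suc i)\<bar>)" using tele[of j "k - j"] that by simp
      also have "\<dots> \<le> V" unfolding V_def using that by (intro sum_mono2) auto
      finally show ?thesis .
    qed
    show ?thesis using *[of j k] *[of k j] that by (cases "j \<le> k") (auto simp: abs_minus_commute)
  qed
  have b: "(b j)\<^sup>2 \<le> real N * D" if j: "j < N" for j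
  proof -
    have "real N * b j = (\<Sum>k<N. b j - b k)" using mean by (simp add: sum_subtractf)
    then have "real N * \<bar>b j\<bar> = \<bar>\<Sum>k<N. b j - b k\<bar>" by (metis abs_mult abs_of_nat)
    also have "\<dots> \<le> (\<Sum>k<N. \<bar>b j - b k\<bar>)" by (rule sum_abs)
    also have "\<dots> \<le> (\<Sum>k<N. V)" using diff j by (intro sum_mono) auto
    also have "\<dots> = real N * V" by simp
    finally have "\<bar>b j\<bar> \<le> V" using j by simp
    then have "(b j)\<^sup>2 \<le> V\<^sup>2" using power_mono[OF _ abs_ge_zero, of "b j" V 2] by simp
    with V2 show ?thesis by linarith
  qed
  have "(\<Sum>i<N. (b i)\<^sup>2) \<le> (\<Sum>i<N. real N * D)" by (intro sum_mono b) auto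
  also have "\<dots> = (real N)\<^sup>2 * D" by (simp add: power2_eq_square)
  finally show ?thesis by (simp add: D_def)
qed

text \<open>By convexity the weighted average loses exactly \<open>2/9\<close> of the squared difference of neighbours, and
the Poincare inequality bounds these differences from below.\<close>

lemma cyclic_averaging_contracts:
  fixes b :: "nat \<Rightarrow> real"
  assumes mean: "(\<Sum>i<N. b i) = 0" and per: "b N = b 0" and N: "N > 0"
  shows "(\<Sum>i<N. (2 / 3 * b i + 1 / 3 * b (Suc i))\<^sup>2) \<le> (1 - 2 / (9 * (real N)\<^sup>2)) * (\<Sum>i<N. (b i)\<^sup>2)"
proof -
  have shift: "(\<Sum>i<N. (b (Suc i))\<^sup>2) = (\<Sum>i<N. (b i)\<^sup>2)"
    using sum.lessThan_Suc_shift[of "\<lambda>i. (b i)\<^sup>2" N] per by simp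
  have "(2 / 3 * b i + 1 / 3 * b (Suc i))\<^sup>2 = 2 / 3 * (b i)\<^sup>2 + 1 / 3 * (b (Suc i))\<^sup>2 - 2 / 9 * (b i - b (Suc i))\<^sup>2" for i
    by (simp add: power2_eq_square field_simps)
  then have "(\<Sum>i<N. (2 / 3 * b i + 1 / 3 * b (Suc i))\<^sup>2) = 2 / 3 * (\<Sum>i<N. (b i)\<^sup>2)
     + 1 / 3 * (\<Sum>i<N. (b (Suc i))\<^sup>2) - 2 / 9 * (\<Sum>i<N. (b i - b (Suc i))\<^sup>2)"
    by (simp only: sum.distrib sum_subtractf sum_distrib_left)
  then have "(\<Sum>i<N. (2 / 3 * b i + 1 / 3 * b (Suc i))\<^sup>2) =
     (\<Sum>i<N. (b i)\<^sup>2) - 2 / 9 * (\<Sum>i<N. (b i - b (Suc i))\<^sup>2)"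
    unfolding shift by linarith
  moreover have "2 / (9 * (real N)\<^sup>2) * (\<Sum>i<N. (b i)\<^sup>2) \<le> 2 / 9 * (\<Sum>i<N. (b i - b (Suc i))\<^sup>2)"
    using cyclic_poincare[OF mean] N by (simp add: field_simps)
  ultimately show ?thesis by (simp add: algebra_simps)
qed

text \<open>Jensen's inequality in each row, followed by summation over the columns.\<close>

lemma doubly_stochastic_contracts:
  fixes p :: "nat \<Rightarrow> nat \<Rightarrow> real" and a :: "nat \<Rightarrow> real"
  assumes pos: "\<And>j i. 0 \<le> p j i" and row: "\<And>j. j < N \<Longrightarrow> (\<Sum>i<N. p j i) = 1"
    and col: "\<And>i. i < N \<Longrightarrow> (\<Sum>j<N. p j i) = 1"
  shows "(\<Sum>j<N. (\<Sum>i<N. p j i * a i)\<^sup>2) \<le> (\<Sum>i<N. (a i)\<^sup>2)"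
proof -
  have "(\<Sum>i<N. p j i * a i)\<^sup>2 \<le> (\<Sum>i<N. p j i * (a i)\<^sup>2)" if "j < N" for j
  proof -
    define w where "w = (\<Sum>i<N. p j i * a i)"
    have "0 \<le> (\<Sum>i<N. p j i * (a i - w)\<^sup>2)" using pos by (intro sum_nonneg) auto
    also have "\<dots> = (\<Sum>i<N. p j i * (a i)\<^sup>2 - 2 * w * (p j i * a i) + w\<^sup>2 * p j i)"
      by (intro sum.cong refl) (simp add: power2_eq_square algebra_simps)
    also have "\<dots> = (\<Sum>i<N. p j i * (a i)\<^sup>2) - 2 * w * w + w\<^sup>2 * 1"
      using row[OF that] by (simp add: sum.distrib sum_subtractf w_def flip: sum_distrib_left)
    finally show ?thesis by (simp add: w_def power2_eq_square)
  qed
  then have "(\<Sum>j<N. (\<Sum>i<N. p j i * a i)\<^sup>2) \<le> (\<Sum>j<N. \<Sum>i<N. p j i * (a i)\<^sup>2)"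
    by (intro sum_mono) auto
  also have "\<dots> = (\<Sum>i<N. \<Sum>j<N. p j i * (a i)\<^sup>2)" by (rule sum.swap)
  also have "\<dots> = (\<Sum>i<N. (a i)\<^sup>2)" using col by (simp flip: sum_distrib_right)
  finally show ?thesis .
qed

lemma power2_sum_le_weighted:
  fixes x y t :: real assumes "t > 0"
  shows "(x + y)\<^sup>2 \<le> (1 + t) * x\<^sup>2 + (1 + 1 / t) * y\<^sup>2"
proof -
  have "0 \<le> (t * x - y)\<^sup>2 / t" using assms by simp
  also have "\<dots> = t * x\<^sup>2 - 2 * x * y + y\<^sup>2 / t"
    using assms by (simp add: power2_eq_square field_simps)
  finally show ?thesis by (simp add: power2_eq_square algebra_simps)
qed

text \<open>The squared Euclidean norm of the vector of cell averages.\<close>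

definition cell_energy :: "nat \<Rightarrow> (circle \<Rightarrow> real) \<Rightarrow> real" where
  "cell_energy N F = (\<Sum>i<N. (real N * cell_integral N F (int i))\<^sup>2)"

text \<open>The fold with \<open>m\<close> branches comes first, so that it acts on whatever density the previous step left;
\<open>g\<close> comes last, so that rotations applied after it can be absorbed into the doubly stochastic
matrix.\<close>

definition folded :: "(circle \<Rightarrow> circle) \<Rightarrow> nat \<Rightarrow> nat \<Rightarrow> circle \<Rightarrow> circle" where
  "folded g N m x = g (shifted_fold_map N (fold_map N m x))"

lemma folded_in_C_leb: "g \<in> C_leb \<Longrightarrow> N > 0 \<Longrightarrow> odd m \<Longrightarrow> folded g N m \<in> C_leb"
  unfolding folded_def[abs_def]
  by (rule C_leb_comp[OF _ C_leb_comp[OF shifted_fold_map_in_C_leb fold_map_in_C_leb]])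

text \<open>One step of the dynamics. The cell averages \<open>b\<close> over the shifted cells arise from the old averages \<open>a\<close> by a
doubly stochastic matrix, up to the defect; \<open>p j i\<close> is the probability that a point of the shifted cell
\<open>j\<close> is sent to the cell \<open>i\<close>. The shifted folds then average neighbouring entries of \<open>b\<close>. Half of
the contraction factor absorbs the cross terms between the main part and the defect.\<close>

lemma cell_energy_step:
  assumes g: "g \<in> C_leb" and N: "N > 0" and m: "odd m"
    and H: "test_function H" and mean: "(\<integral>x. H x \<partial>circle_measure) = 0"
    and K: "\<And>x. K x = H (fold_map N m x)"
    and h: "\<And>j F. bounded_borel F \<Longrightarrow>
      (\<integral>x. indicator (cell N j) x * F (g (rotation (- (1 / (3 * real N))) x)) \<partial>circle_measure) = (\<integral>x. h j x * F x \<partial>circle_measure)"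
    and hint: "\<And>j. integrable circle_measure (h j)"
    and small: "\<And>j b. j < N \<Longrightarrow> \<bar>real N * fold_defect N m b H (h j)\<bar> \<le> d"
  defines "\<kappa> \<equiv> 2 / (9 * (real N)\<^sup>2)"
  shows "cell_energy N (\<lambda>x. K (rotation c (folded g N m x)))
    \<le> (1 - \<kappa> / 2) * cell_energy N K + (1 + 2 / \<kappa>) * (real N * d\<^sup>2)"
proof -
  define s where "s = 1 / (3 * real N)"
  have Hb: "bounded_borel H" by (rule test_function_bounded_borel[OF H])
  have Kb: "bounded_borel K"
    using bounded_borel_comp[OF Hb fold_map_measurable[OF N m]] by (simp add: K[abs_def])
  define F where "F x = K (rotation c (g x))" for x
  define F' where "F' x = F (rotation (- s) x)" for x
  have rK: "bounded_borel (\<lambda>x. K (rotation c x))"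
    by (rule bounded_borel_comp[OF Kb C_leb_measurable[OF rotation_in_C_leb]])
  have Fb: "bounded_borel F" unfolding F_def[abs_def] by (rule bounded_borel_comp[OF rK C_leb_measurable[OF g]])
  have F'b: "bounded_borel F'" unfolding F'_def[abs_def]
    by (rule bounded_borel_comp[OF Fb C_leb_measurable[OF rotation_in_C_leb]])
  define b where "b j = real N * cell_integral N F' (int j)" for j :: nat
  define a where "a i = real N * cell_integral N H (int i)" for i :: nat
  define p where "p j i = real N * (\<integral>x. indicator (cell N i) x * h j (rotation (- c) x) \<partial>circle_measure)" for j i
  define e where "e j = real N * fold_defect N m (- c) H (h j)" for j

  have energy_K: "cell_energy N K = (\<Sum>i<N. (a i)\<^sup>2)"
    unfolding cell_energy_def a_def K[abs_def] by (simp add: cell_integral_fold_map[OF N m Hb])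
  have out: "real N * cell_integral N (\<lambda>x. K (rotation c (folded g N m x))) (int i) = 2 / 3 * b i + 1 / 3 * b (Suc i)" for i
  proof -
    have "bounded_borel (\<lambda>x. F (shifted_fold_map N x))"
      by (rule bounded_borel_comp[OF Fb C_leb_measurable[OF shifted_fold_map_in_C_leb[OF N]]])
    from cell_integral_fold_map[OF N m this, of "int i"]
    have "cell_integral N (\<lambda>x. K (rotation c (folded g N m x))) (int i) = cell_integral N (\<lambda>x. F (shifted_fold_map N x)) (int i)"
      by (simp add: F_def folded_def)
    also have "\<dots> = 2 / 3 * cell_integral N F' (int i) + 1 / 3 * cell_integral N F' (int i + 1)"
      using cell_integral_shifted_fold_map[OF N Fb, of "int i"] by (simp add: F'_def[abs_def] s_def)
    finally show ?thesis by (simp add: b_def algebra_simps)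
  qed

  \<comment> \<open>In this form the entries are visibly nonnegative with row and column sums 1.\<close>
  have pF: "p j i = real N * (\<integral>x. indicator (cell N j) x * indicator (cell N i) (rotation c (g (rotation (- s) x))) \<partial>circle_measure)" for j i
  proof -
    have ib: "bounded_borel (\<lambda>x. indicator (cell N i) (rotation c x))"
      by (rule bounded_borel_comp[OF bounded_borel_cell C_leb_measurable[OF rotation_in_C_leb]])
    have [measurable]: "h j \<in> borel_measurable borel" using borel_measurable_integrable[OF hint[of j]] by simp
    have [measurable]: "rotation x \<in> borel_measurable borel" for x by (rule C_leb_measurable[OF rotation_in_C_leb])
    have "(\<integral>x. indicator (cell N i) x * h j (rotation (- c) x) \<partial>circle_measure) = 
      (\<integral>x. indicator (cell N i) (rotation c x) * h j (rotation (- c) (rotation c x)) \<partial>circle_measure)"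
      by (rule C_leb_integral[OF rotation_in_C_leb, symmetric]) measurable
    also have "\<dots> = (\<integral>x. h j x * indicator (cell N i) (rotation c x) \<partial>circle_measure)"
      by (simp add: mult.commute)
    also have "\<dots> = (\<integral>x. indicator (cell N j) x * indicator (cell N i) (rotation c (g (rotation (- s) x))) \<partial>circle_measure)"
      using h[OF ib, of j] by (simp add: s_def)
    finally show ?thesis by (simp add: p_def)
  qed
  define G where "G x = rotation c (g (rotation (- s) x))" for x
  have G: "G \<in> C_leb" unfolding G_def[abs_def]
    by (rule C_leb_comp[OF rotation_in_C_leb C_leb_comp[OF g rotation_in_C_leb]])
  have iG: "bounded_borel (\<lambda>x. indicator (cell N i) (G x))" for i
    by (rule bounded_borel_comp[OF bounded_borel_cell C_leb_measurable[OF G]])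
  have iiG: "integrable circle_measure (\<lambda>x. indicator (cell N j) x * indicator (cell N i) (G x) :: real)" for i j
    by (rule integrable_bounded_borel[OF bounded_borel_mult[OF bounded_borel_cell iG]])
  have pG: "p j i = real N * (\<integral>x. indicator (cell N j) x * indicator (cell N i) (G x) \<partial>circle_measure)" for j i
    unfolding pF G_def ..
  have mass: "(\<integral>x. indicator (cell N i) x \<partial>circle_measure) = 1 / real N" if "i < N" for i
    using integral_over_cell[OF bounded_borel_const that, of 1] N
    by (simp add: cell_integral_def arc_integral_def add_divide_distrib)
  have pos: "0 \<le> p j i" for j i unfolding pG by (intro mult_nonneg_nonneg integral_nonneg) auto
  have row: "(\<Sum>i<N. p j i) = 1" if "j < N" for j
  proof -
    have "(\<Sum>i<N. p j i) = real N * (\<integral>x. (\<Sum>i<N. indicator (cell N j) x * indicator (cell N i) (G x)) \<partial>circle_measure)"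
      unfolding pG by (subst Bochner_Integration.integral_sum[OF iiG]) (simp add: sum_distrib_left)
    also have "\<dots> = 1" using mass[OF that] N by (simp add: sum_indicator_cells[OF N] flip: sum_distrib_left)
    finally show ?thesis .
  qed
  have col: "(\<Sum>j<N. p j i) = 1" if "i < N" for i
  proof -
    have "(\<Sum>j<N. p j i) = real N * (\<integral>x. (\<Sum>j<N. indicator (cell N j) x * indicator (cell N i) (G x)) \<partial>circle_measure)"
      unfolding pG by (subst Bochner_Integration.integral_sum[OF iiG]) (simp add: sum_distrib_left)
    also have "\<dots> = real N * (\<integral>x. indicator (cell N i) (G x) \<partial>circle_measure)"
      by (simp add: sum_indicator_cells[OF N] flip: sum_distrib_right)
    also have "(\<integral>x. indicator (cell N i) (G x) \<partial>circle_measure) = (\<integral>x. indicator (cell N i) x \<partial>circle_measure :: real)"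
      by (rule C_leb_integral[OF G]) measurable
    finally show ?thesis using mass[OF that] N by simp
  qed

  have b: "b j = (\<Sum>i<N. p j i * a i) + e j" if j: "j < N" for j
  proof -
    have [measurable]: "h j \<in> borel_measurable borel" using borel_measurable_integrable[OF hint[of j]] by simp
    have [measurable]: "K \<in> borel_measurable borel" by (rule bounded_borelD[OF Kb])
    have [measurable]: "rotation x \<in> borel_measurable borel" for x by (rule C_leb_measurable[OF rotation_in_C_leb])
    have "cell_integral N F' (int j) = (\<integral>x. indicator (cell N j) x * F' x \<partial>circle_measure)"
      by (rule integral_over_cell[OF F'b j, symmetric])
    also have "\<dots> = (\<integral>x. h j x * K (rotation c x) \<partial>circle_measure)"
      using h[OF rK, of j] by (simp add: F'_def F_def s_def)
    also have "\<dots> = (\<integral>x. h j (rotation (- c) (rotation c x)) * K (rotation c x) \<partial>circle_measure)" by simp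
    also have "\<dots> = (\<integral>x. h j (rotation (- c) x) * K x \<partial>circle_measure)"
      by (rule C_leb_integral[OF rotation_in_C_leb]) measurable
    finally have "b j = real N * (\<integral>x. h j (rotation (- c) x) * H (fold_map N m x) \<partial>circle_measure)"
      by (simp add: b_def K)
    also have "\<dots> = (\<Sum>i<N. p j i * a i) + e j"
      unfolding e_def fold_defect_def p_def a_def by (simp add: algebra_simps sum_distrib_left)
    finally show ?thesis .
  qed
  have per: "b N = b 0" using cell_integral_period[OF N, of F' 0] by (simp add: b_def)
  have sum0: "(\<Sum>j<N. b j) = 0"
  proof -
    have "(\<Sum>j<N. b j) = real N * (\<integral>x. F' x \<partial>circle_measure)"
      unfolding b_def integral_circle_cells[OF F'b N] by (simp add: sum_distrib_left)
    also have "(\<integral>x. F' x \<partial>circle_measure) = (\<integral>x. K x \<partial>circle_measure)"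
      using C_leb_integral[OF G bounded_borelD[OF Kb]] by (simp add: F'_def F_def G_def)
    also have "\<dots> = 0"
      using C_leb_integral[OF fold_map_in_C_leb[OF N m] bounded_borelD[OF Hb]] mean by (simp add: K)
    finally show ?thesis by simp
  qed
  have \<kappa>: "0 < \<kappa>" "\<kappa> \<le> 1"
  proof -
    have "1 \<le> real N" using N by simp
    then have "1 \<le> (real N)\<^sup>2" by (rule one_le_power)
    then have "2 \<le> 9 * (real N)\<^sup>2" by linarith
    then show "0 < \<kappa>" "\<kappa> \<le> 1" unfolding \<kappa>_def using N by (auto simp: divide_le_eq)
  qed
  have "(\<Sum>j<N. (b j)\<^sup>2) \<le> (\<Sum>j<N. (1 + \<kappa> / 2) * (\<Sum>i<N. p j i * a i)\<^sup>2 + (1 + 2 / \<kappa>) * d\<^sup>2)"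
  proof (rule sum_mono)
    fix j assume "j \<in> {..<N}" then have j: "j < N" by simp
    have "\<bar>e j\<bar> \<le> d" unfolding e_def by (rule small[OF j])
    then have e: "(e j)\<^sup>2 \<le> d\<^sup>2" using power_mono[OF _ abs_ge_zero, of "e j" d 2] by simp
    have "(b j)\<^sup>2 \<le> (1 + \<kappa> / 2) * (\<Sum>i<N. p j i * a i)\<^sup>2 + (1 + 1 / (\<kappa> / 2)) * (e j)\<^sup>2"
      unfolding b[OF j] using \<kappa> by (intro power2_sum_le_weighted) simp
    also have "\<dots> \<le> (1 + \<kappa> / 2) * (\<Sum>i<N. p j i * a i)\<^sup>2 + (1 + 2 / \<kappa>) * d\<^sup>2"
      using e \<kappa> by (intro add_left_mono) (auto intro!: mult_left_mono)
    finally show "(b j)\<^sup>2 \<le> (1 + \<kappa> / 2) * (\<Sum>i<N. p j i * a i)\<^sup>2 + (1 + 2 / \<kappa>) * d\<^sup>2" .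
  qed
  also have "\<dots> = (1 + \<kappa> / 2) * (\<Sum>j<N. (\<Sum>i<N. p j i * a i)\<^sup>2) + (1 + 2 / \<kappa>) * (real N * d\<^sup>2)"
    by (simp add: sum.distrib flip: sum_distrib_left)
  also have "\<dots> \<le> (1 + \<kappa> / 2) * cell_energy N K + (1 + 2 / \<kappa>) * (real N * d\<^sup>2)"
    unfolding energy_K using doubly_stochastic_contracts[of p N a, OF pos row col] \<kappa>
    by (intro add_right_mono mult_left_mono) auto
  finally have B: "(\<Sum>j<N. (b j)\<^sup>2) \<le> (1 + \<kappa> / 2) * cell_energy N K + (1 + 2 / \<kappa>) * (real N * d\<^sup>2)" .
  have "cell_energy N (\<lambda>x. K (rotation c (folded g N m x))) = (\<Sum>i<N. (2 / 3 * b i + 1 / 3 * b (Suc i))\<^sup>2)"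
    unfolding cell_energy_def out ..
  also have "\<dots> \<le> (1 - \<kappa>) * (\<Sum>i<N. (b i)\<^sup>2)"
    unfolding \<kappa>_def by (rule cyclic_averaging_contracts[OF sum0 per N])
  also have "\<dots> \<le> (1 - \<kappa>) * ((1 + \<kappa> / 2) * cell_energy N K + (1 + 2 / \<kappa>) * (real N * d\<^sup>2))"
    using B \<kappa> by (intro mult_left_mono) auto
  also have "\<dots> = ((1 - \<kappa>) * (1 + \<kappa> / 2)) * cell_energy N K + (1 - \<kappa>) * ((1 + 2 / \<kappa>) * (real N * d\<^sup>2))"
    by (simp add: algebra_simps)
  also have "\<dots> \<le> (1 - \<kappa> / 2) * cell_energy N K + 1 * ((1 + 2 / \<kappa>) * (real N * d\<^sup>2))"
  proof (intro add_mono mult_right_mono)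
    show "(1 - \<kappa>) * (1 + \<kappa> / 2) \<le> 1 - \<kappa> / 2" by (simp add: algebra_simps)
    show "0 \<le> cell_energy N K" unfolding cell_energy_def by (intro sum_nonneg) auto
  qed (use \<kappa> in auto)
  finally show ?thesis by simp
qed

section \<open>Decay of correlations for folded maps\<close>

lemma test_function_comp:
  "test_function F \<Longrightarrow> f \<in> borel_measurable borel \<Longrightarrow> test_function (\<lambda>x. F (f x))"
  unfolding test_function_def by (auto intro: measurable_compose[of f borel borel F])

lemma uniform_threshold:
  fixes Q :: "nat \<Rightarrow> nat \<Rightarrow> bool"
  assumes "\<And>j. \<exists>M. \<forall>m\<ge>M. Q j m"
  shows "\<exists>M. \<forall>m\<ge>M. \<forall>j<N. Q j m"
proof -
  obtain M where M: "\<And>j m. m \<ge> M j \<Longrightarrow> Q j m" using assms by metis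
  have "Q j m" if "(\<Sum>j<N. M j) \<le> m" "j < N" for j m
    using that member_le_sum[of j "{..<N}" M] by (intro M) auto
  then show ?thesis by blast
qed

text \<open>The energy of the cell averages decays geometrically down to a level fixed by the defects, which is
made small by the choice of \<open>m\<close>. One further use of the fold replaces the integral against \<open>h0\<close> by a sum
over cell averages. Both thresholds are chosen before the angles \<open>b\<close> and \<open>c\<close>.\<close>

lemma folded_decorrelates:
  assumes g: "g \<in> C_leb" and N: "N > 0" and h0: "test_function h0" and e: "e > 0"
  shows "\<exists>M n0. \<forall>m\<ge>M. odd m \<longrightarrow> (\<forall>c b \<phi>. test_function \<phi> \<longrightarrow> (\<integral>x. \<phi> x \<partial>circle_measure) = 0 \<longrightarrow>
    (\<forall>n\<ge>n0. \<bar>\<integral>x. h0 (rotation b x) * \<phi> (((\<lambda>x. rotation c (folded g N m x)) ^^ n) x) \<partial>circle_measure\<bar> \<le> e))"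
proof -
  have gr: "(\<lambda>x. g (rotation (- (1 / (3 * real N))) x)) \<in> C_leb" by (rule C_leb_comp[OF g rotation_in_C_leb])
  have "\<exists>h. integrable circle_measure h \<and> (\<forall>F. bounded_borel F \<longrightarrow>
     (\<integral>x. indicator (cell N j) x * F (g (rotation (- (1 / (3 * real N))) x)) \<partial>circle_measure) = (\<integral>x. h x * F x \<partial>circle_measure))" for j
    by (rule transfer_density[OF gr cell_measurable[of N j]]) blast
  then obtain h where hint: "\<And>j. integrable circle_measure (h j)" and
    h: "\<And>j F. bounded_borel F \<Longrightarrow>
     (\<integral>x. indicator (cell N j) x * F (g (rotation (- (1 / (3 * real N))) x)) \<partial>circle_measure) = (\<integral>x. h j x * F x \<partial>circle_measure)"
    by metis
  define \<kappa> where "\<kappa> = 2 / (9 * (real N)\<^sup>2)"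
  define \<eta> where "\<eta> = e / 2"
  define C where "C = (1 + 2 / \<kappa>) * real N"
  have N1: "1 \<le> real N" using N by simp
  then have "1 \<le> (real N)\<^sup>2" by (rule one_le_power)
  then have "2 \<le> 9 * (real N)\<^sup>2" by linarith
  then have \<kappa>: "0 < \<kappa>" "\<kappa> \<le> 1" unfolding \<kappa>_def using N by (auto simp: divide_le_eq)
  have \<eta>: "\<eta> > 0" using e by (simp add: \<eta>_def)
  have C: "C > 0" unfolding C_def using \<kappa> N by (intro mult_pos_pos add_pos_pos) auto
  \<comment> \<open>With this size of the defects the energy settles below half of the target \<open>\<eta>\<^sup>2\<close>.\<close>
  define d where "d = sqrt (\<kappa> / 2 * (\<eta>\<^sup>2 / 2) / C)"
  have d: "d > 0" unfolding d_def using \<kappa> \<eta> C by simp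
  have Cd: "C * d\<^sup>2 = \<kappa> / 2 * (\<eta>\<^sup>2 / 2)" unfolding d_def using \<kappa> \<eta> C by simp
  have "\<forall>e>0. \<exists>M. \<forall>m\<ge>M. odd m \<longrightarrow> (\<forall>b H. test_function H \<longrightarrow> \<bar>fold_defect N m b H (h j)\<bar> \<le> e)" for j
    by (rule fold_defect_tendsto[OF hint N])
  then have "\<exists>M. \<forall>m\<ge>M. odd m \<longrightarrow> (\<forall>b H. test_function H \<longrightarrow> \<bar>fold_defect N m b H (h j)\<bar> \<le> d / real N)" for j
    using d N by simp
  from uniform_threshold[of "\<lambda>j m. odd m \<longrightarrow> (\<forall>b H. test_function H \<longrightarrow> \<bar>fold_defect N m b H (h j)\<bar> \<le> d / real N)" N, OF this]
  obtain M1 where M1: "\<And>m j b H. M1 \<le> m \<Longrightarrow> j < N \<Longrightarrow> odd m \<Longrightarrow> test_function H \<Longrightarrow> \<bar>fold_defect N m b H (h j)\<bar> \<le> d / real N"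
    by blast
  have h0int: "integrable circle_measure h0"
    by (rule integrable_bounded_borel[OF test_function_bounded_borel[OF h0]])
  obtain M2 where M2: "\<And>m b H. M2 \<le> m \<Longrightarrow> odd m \<Longrightarrow> test_function H \<Longrightarrow> \<bar>fold_defect N m b H h0\<bar> \<le> e / 2"
    using fold_defect_tendsto[OF h0int N] e half_gt_zero by metis
  have "\<eta>\<^sup>2 / 2 / real N > 0" using \<eta> N by simp
  then obtain n1 where n1: "(1 - \<kappa> / 2) ^ n1 < \<eta>\<^sup>2 / 2 / real N"
    using real_arch_pow_inv[of "\<eta>\<^sup>2 / 2 / real N" "1 - \<kappa> / 2"] \<kappa> by auto
  show ?thesis
  proof (rule exI[of _ "max M1 M2"], rule exI[of _ "Suc n1"], intro allI impI)
    fix m c b \<phi> n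
    assume "max M1 M2 \<le> m" and m: "odd m" and \<phi>: "test_function \<phi>" and mean: "(\<integral>x. \<phi> x \<partial>circle_measure) = 0"
      and n: "Suc n1 \<le> n"
    then have mM: "M1 \<le> m" "M2 \<le> m" by auto
    define S where "S x = rotation c (folded g N m x)" for x
    \<comment> \<open>\<open>K k\<close> is \<open>\<phi>\<close> after \<open>k + 1\<close> steps; splitting off the first fold leaves \<open>H k\<close>.\<close>
    define H where "H k x = \<phi> ((S ^^ k) (rotation c (g (shifted_fold_map N x))))" for k x
    define K where "K k x = \<phi> ((S ^^ Suc k) x)" for k x
    have S: "S \<in> C_leb" unfolding S_def[abs_def]
      by (rule C_leb_comp[OF rotation_in_C_leb folded_in_C_leb[OF g N m]])
    have R: "(\<lambda>x. (S ^^ k) (rotation c (g (shifted_fold_map N x)))) \<in> C_leb" for k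
      by (rule C_leb_comp[OF C_leb_funpow[OF S] C_leb_comp[OF rotation_in_C_leb C_leb_comp[OF g shifted_fold_map_in_C_leb[OF N]]]])
    have HK: "K k x = H k (fold_map N m x)" for k x
      unfolding K_def H_def funpow_Suc_right by (simp add: S_def folded_def)
    have Ht: "test_function (H k)" for k
      unfolding H_def[abs_def] by (rule test_function_comp[OF \<phi> C_leb_measurable[OF R]])
    have H0: "(\<integral>x. H k x \<partial>circle_measure) = 0" for k
      unfolding H_def using C_leb_integral[OF R bounded_borelD[OF test_function_bounded_borel[OF \<phi>]]] mean by simp
    have step: "cell_energy N (K (Suc k)) \<le> (1 - \<kappa> / 2) * cell_energy N (K k) + \<kappa> / 2 * (\<eta>\<^sup>2 / 2)" for k
    proof -
      have "\<bar>real N * fold_defect N m b H (h j)\<bar> \<le> d" if "j < N" "test_function H" for j b H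
        using M1[OF mM(1) that(1) m that(2), of b] N by (simp add: abs_mult field_simps)
      from cell_energy_step[OF g N m Ht[of k] H0[of k] HK[of k] h hint this[OF _ Ht[of k]], of c]
      have "cell_energy N (\<lambda>x. K k (S x)) \<le> (1 - \<kappa> / 2) * cell_energy N (K k) + (1 + 2 / \<kappa>) * (real N * d\<^sup>2)"
        by (simp add: S_def \<kappa>_def)
      moreover have "(\<lambda>x. K k (S x)) = K (Suc k)" by (rule ext) (simp add: K_def funpow_swap1)
      moreover have "(1 + 2 / \<kappa>) * (real N * d\<^sup>2) = \<kappa> / 2 * (\<eta>\<^sup>2 / 2)" using Cd by (simp add: C_def)
      ultimately show ?thesis by simp
    qed
    have Kt: "test_function (K k)" for k
      using test_function_comp[OF Ht fold_map_measurable[OF N m]] unfolding HK[abs_def] .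
    have K1: "\<bar>K k x\<bar> \<le> 1" for k x using Kt by (simp add: test_function_def)
    have energy: "cell_energy N (K k) \<le> (1 - \<kappa> / 2) ^ k * real N + \<eta>\<^sup>2 / 2" for k
    proof (induction k)
      case 0
      have "\<bar>real N * cell_integral N (K 0) i\<bar> \<le> 1" for i
        using cell_integral_bound[OF test_function_bounded_borel[OF Kt] N K1[of 0], of i] N
        by (simp add: abs_mult field_simps)
      then have "(real N * cell_integral N (K 0) i)\<^sup>2 \<le> 1" for i by (simp add: abs_square_le_1)
      then have "cell_energy N (K 0) \<le> (\<Sum>i<N. 1)" unfolding cell_energy_def by (intro sum_mono) simp
      also have "\<dots> \<le> (1 - \<kappa> / 2) ^ 0 * real N + \<eta>\<^sup>2 / 2" by simp
      finally show ?case .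
    next
      case (Suc k)
      have "cell_energy N (K (Suc k)) \<le> (1 - \<kappa> / 2) * ((1 - \<kappa> / 2) ^ k * real N + \<eta>\<^sup>2 / 2) + \<kappa> / 2 * (\<eta>\<^sup>2 / 2)"
        using Suc \<kappa> by (intro order_trans[OF step] add_right_mono mult_left_mono) auto
      also have "\<dots> = (1 - \<kappa> / 2) ^ Suc k * real N + \<eta>\<^sup>2 / 2"
      proof -
        have "(1 - a) * (x + y) + a * y = (1 - a) * x + y" for a x y :: real by (simp add: algebra_simps)
        then show ?thesis unfolding power_Suc mult.assoc .
      qed
      finally show ?case .
    qed
    obtain k where k: "n = Suc k" "n1 \<le> k" using n by (cases n) auto
    have "(1 - \<kappa> / 2) ^ k \<le> (1 - \<kappa> / 2) ^ n1" using k(2) \<kappa> by (intro power_decreasing) auto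
    then have "(1 - \<kappa> / 2) ^ k * real N \<le> (\<eta>\<^sup>2 / 2 / real N) * real N"
      using n1 by (intro mult_right_mono) auto
    with energy[of k] N have E: "cell_energy N (K k) \<le> \<eta>\<^sup>2" by simp
    have Hi: "\<bar>real N * cell_integral N (H k) (int i)\<bar> \<le> \<eta>" if "i < N" for i
    proof -
      have "cell_integral N (H k) (int i) = cell_integral N (K k) (int i)"
        unfolding HK[abs_def] by (rule cell_integral_fold_map[OF N m test_function_bounded_borel[OF Ht], symmetric])
      moreover have "(real N * cell_integral N (K k) (int i))\<^sup>2 \<le> cell_energy N (K k)"
        unfolding cell_energy_def using that member_le_sum[of i "{..<N}" "\<lambda>i. (real N * cell_integral N (K k) (int i))\<^sup>2"] by simp
      ultimately have "\<bar>real N * cell_integral N (H k) (int i)\<bar>\<^sup>2 \<le> \<eta>\<^sup>2" using E by simp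
      from power2_le_imp_le[OF this less_imp_le[OF \<eta>]] show ?thesis .
    qed
    have hb: "bounded_borel (\<lambda>x. h0 (rotation b x))"
      by (rule bounded_borel_comp[OF test_function_bounded_borel[OF h0] C_leb_measurable[OF rotation_in_C_leb]])
    have h1: "\<bar>h0 x\<bar> \<le> 1" for x using h0 by (simp add: test_function_def)
    have ci: "\<bar>\<integral>x. indicator (cell N i) x * h0 (rotation b x) \<partial>circle_measure\<bar> \<le> 1 / real N" if "i < N" for i
      unfolding integral_over_cell[OF hb that] by (rule cell_integral_bound[OF hb N h1])
    have "\<bar>\<Sum>i<N. real N * (\<integral>x. indicator (cell N i) x * h0 (rotation b x) \<partial>circle_measure) * cell_integral N (H k) (int i)\<bar>
      \<le> (\<Sum>i<N. 1 / real N * \<eta>)"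
    proof (rule order_trans[OF sum_abs], rule sum_mono)
      fix i assume "i \<in> {..<N}" then have i: "i < N" by simp
      have "\<bar>\<integral>x. indicator (cell N i) x * h0 (rotation b x) \<partial>circle_measure\<bar> * \<bar>real N * cell_integral N (H k) (int i)\<bar>
        \<le> 1 / real N * \<eta>" using ci[OF i] Hi[OF i] by (intro mult_mono) auto
      then show "\<bar>real N * (\<integral>x. indicator (cell N i) x * h0 (rotation b x) \<partial>circle_measure) * cell_integral N (H k) (int i)\<bar>
        \<le> 1 / real N * \<eta>" by (simp add: abs_mult mult.commute mult.left_commute)
    qed
    also have "\<dots> = \<eta>" using N by simp
    finally have "\<bar>\<Sum>i<N. real N * (\<integral>x. indicator (cell N i) x * h0 (rotation b x) \<partial>circle_measure) * cell_integral N (H k) (int i)\<bar> \<le> \<eta>" .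
    moreover have "\<bar>fold_defect N m b (H k) h0\<bar> \<le> e / 2" by (rule M2[OF mM(2) m Ht])
    moreover have "(\<integral>x. h0 (rotation b x) * \<phi> (((\<lambda>x. rotation c (folded g N m x)) ^^ n) x) \<partial>circle_measure)
      = (\<integral>x. h0 (rotation b x) * H k (fold_map N m x) \<partial>circle_measure)"
      unfolding HK[symmetric] K_def k(1) S_def ..
    ultimately show "\<bar>\<integral>x. h0 (rotation b x) * \<phi> (((\<lambda>x. rotation c (folded g N m x)) ^^ n) x) \<partial>circle_measure\<bar> \<le> e"
      unfolding fold_defect_def \<eta>_def by linarith
  qed
qed

section \<open>From small correlation sums to weak mixing\<close>

definition correlation :: "(circle \<Rightarrow> circle) \<Rightarrow> (circle \<Rightarrow> real) \<Rightarrow> nat \<Rightarrow> nat \<Rightarrow> real" where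
  "correlation T \<phi> i j = (\<integral>x. \<phi> ((T ^^ i) x) * \<phi> ((T ^^ j) x) \<partial>circle_measure)"

definition correlation_sum :: "(circle \<Rightarrow> circle) \<Rightarrow> (circle \<Rightarrow> real) \<Rightarrow> nat \<Rightarrow> real" where
  "correlation_sum T \<phi> m = (\<Sum>i<m. \<Sum>j<m. \<bar>correlation T \<phi> i j\<bar>)"

lemma correlation_shift:
  assumes T: "T \<in> C_leb" and \<phi>: "bounded_borel \<phi>"
  shows "correlation T \<phi> (i + p) (j + p) = correlation T \<phi> i j"
proof -
  have b: "bounded_borel (\<lambda>x. \<phi> ((T ^^ i) x) * \<phi> ((T ^^ j) x))"
    by (rule bounded_borel_mult[OF bounded_borel_comp[OF \<phi> C_leb_measurable[OF C_leb_funpow[OF T]]]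
        bounded_borel_comp[OF \<phi> C_leb_measurable[OF C_leb_funpow[OF T]]]])
  from C_leb_integral[OF C_leb_funpow[OF T] bounded_borelD[OF b], of p] show ?thesis
    unfolding correlation_def by (simp add: funpow_add)
qed

text \<open>With the signs \<open>s j\<close> chosen to remove the absolute values, the sum becomes a single integral
of \<open>W\<close> over \<open>B\<close>, bounded by the root of the integral of the square of \<open>W\<close>. Expanding the
square produces the correlations, and the offset \<open>p\<close> disappears by stationarity.\<close>

lemma correlation_block_bound:
  assumes T: "T \<in> C_leb" and \<phi>: "bounded_borel \<phi>" and B: "B \<in> sets borel"
  shows "(\<Sum>j<m. \<bar>\<integral>x. \<phi> ((T ^^ (j + p)) x) * indicator B x \<partial>circle_measure\<bar>) \<le> sqrt (correlation_sum T \<phi> m)"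
proof -
  define u where "u j x = \<phi> ((T ^^ (j + p)) x)" for j x
  define s where "s j = sgn (\<integral>x. u j x * indicator B x \<partial>circle_measure)" for j
  define W where "W x = (\<Sum>j<m. s j * u j x)" for x
  define c where "c = (\<integral>x. W x * indicator B x \<partial>circle_measure)"
  have ub: "bounded_borel (u j)" for j unfolding u_def[abs_def]
    by (rule bounded_borel_comp[OF \<phi> C_leb_measurable[OF C_leb_funpow[OF T]]])
  have Bb: "bounded_borel (indicator B)" by (rule bounded_borel_indicator[OF B])
  have uB: "integrable circle_measure (\<lambda>x. u j x * indicator B x)" for j
    by (rule integrable_bounded_borel[OF bounded_borel_mult[OF ub Bb]])
  have suB: "integrable circle_measure (\<lambda>x. s j * (u j x * indicator B x))" for j
    by (rule integrable_mult_right[OF uB])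
  have c: "(\<Sum>j<m. \<bar>\<integral>x. u j x * indicator B x \<partial>circle_measure\<bar>) = c"
  proof -
    have "(\<Sum>j<m. \<bar>\<integral>x. u j x * indicator B x \<partial>circle_measure\<bar>) = (\<Sum>j<m. s j * (\<integral>x. u j x * indicator B x \<partial>circle_measure))"
      unfolding s_def by (simp add: abs_sgn mult.commute)
    also have "\<dots> = (\<Sum>j<m. \<integral>x. s j * (u j x * indicator B x) \<partial>circle_measure)" by simp
    also have "\<dots> = (\<integral>x. (\<Sum>j<m. s j * (u j x * indicator B x)) \<partial>circle_measure)"
      by (rule Bochner_Integration.integral_sum[OF suB, symmetric])
    also have "\<dots> = c" unfolding c_def W_def by (simp add: sum_distrib_right mult.assoc)
    finally show ?thesis .
  qed
  have uu: "integrable circle_measure (\<lambda>x. (s i * s j) * (u i x * u j x))" for i j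
    by (rule integrable_mult_right[OF integrable_bounded_borel[OF bounded_borel_mult[OF ub ub]]])
  have WW: "W x * W x = (\<Sum>i<m. \<Sum>j<m. (s i * s j) * (u i x * u j x))" for x
    unfolding W_def sum_product by (intro sum.cong refl) (simp add: mult_ac)
  have WWi: "integrable circle_measure (\<lambda>x. W x * W x)"
    unfolding WW by (intro Bochner_Integration.integrable_sum uu)
  have "(\<integral>x. W x * W x \<partial>circle_measure) = (\<Sum>i<m. \<Sum>j<m. s i * s j * correlation T \<phi> (i + p) (j + p))"
  proof -
    have "(\<integral>x. W x * W x \<partial>circle_measure) = (\<Sum>i<m. \<Sum>j<m. \<integral>x. (s i * s j) * (u i x * u j x) \<partial>circle_measure)"
      unfolding WW by (subst Bochner_Integration.integral_sum, intro Bochner_Integration.integrable_sum uu)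
        (intro sum.cong refl Bochner_Integration.integral_sum uu)
    then show ?thesis by (simp add: correlation_def u_def)
  qed
  also have "\<dots> \<le> (\<Sum>i<m. \<Sum>j<m. \<bar>correlation T \<phi> i j\<bar>)"
  proof (intro sum_mono)
    fix i j
    have s1: "\<bar>s i\<bar> \<le> 1" for i unfolding s_def by (simp add: sgn_if)
    have "s i * s j * correlation T \<phi> (i + p) (j + p) \<le> \<bar>s i\<bar> * \<bar>s j\<bar> * \<bar>correlation T \<phi> i j\<bar>"
      unfolding correlation_shift[OF T \<phi>] abs_mult[symmetric] by (rule abs_ge_self)
    also have "\<dots> \<le> (1 * 1) * \<bar>correlation T \<phi> i j\<bar>" using s1 by (intro mult_right_mono mult_mono) auto
    finally show "s i * s j * correlation T \<phi> (i + p) (j + p) \<le> \<bar>correlation T \<phi> i j\<bar>" by simp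
  qed
  finally have W2: "(\<integral>x. W x * W x \<partial>circle_measure) \<le> correlation_sum T \<phi> m" by (simp add: correlation_sum_def)
  have WB: "integrable circle_measure (\<lambda>x. W x * indicator B x)"
    unfolding W_def sum_distrib_right using suB by (intro Bochner_Integration.integrable_sum) (simp add: mult.assoc)
  have WWB: "integrable circle_measure (\<lambda>x. W x * W x * indicator B x)" by (rule integrable_mult_bounded(1)[OF WWi Bb])
  \<comment> \<open>Cauchy-Schwarz on a probability space, in the form that a variance is nonnegative.\<close>
  have "0 \<le> (\<integral>x. (W x * indicator B x - c)\<^sup>2 \<partial>circle_measure)" by (intro Bochner_Integration.integral_nonneg) auto
  also have "\<dots> = (\<integral>x. W x * W x * indicator B x - 2 * c * (W x * indicator B x) + c\<^sup>2 \<partial>circle_measure)"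
    by (intro Bochner_Integration.integral_cong refl) (simp add: power2_eq_square algebra_simps indicator_def)
  also have "\<dots> = (\<integral>x. W x * W x * indicator B x \<partial>circle_measure) - 2 * c * c + c\<^sup>2"
    using WWB integrable_mult_right[OF WB, of "2 * c"] circle.prob_space
    by (simp add: c_def)
  finally have "c\<^sup>2 \<le> (\<integral>x. W x * W x * indicator B x \<partial>circle_measure)" by (simp add: power2_eq_square)
  also have "\<dots> \<le> (\<integral>x. W x * W x \<partial>circle_measure)"
    by (rule integral_mono[OF WWB WWi]) (simp add: indicator_def)
  finally have "c\<^sup>2 \<le> correlation_sum T \<phi> m" using W2 by linarith
  then have "c \<le> sqrt (correlation_sum T \<phi> m)" by (rule real_le_rsqrt)
  with c show ?thesis by (simp add: u_def)
qed

text \<open>Cover the first \<open>n\<close> terms by \<open>n div m + 1\<close> blocks of length \<open>m\<close>. The incomplete last block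
only matters while \<open>n\<close> is small compared with \<open>m\<close>.\<close>

lemma cesaro_from_blocks:
  fixes a :: "nat \<Rightarrow> real"
  assumes pos: "\<And>j. 0 \<le> a j"
    and blocks: "\<And>e. 0 < e \<Longrightarrow> \<exists>m>0. \<forall>p. (\<Sum>j<m. a (j + p)) \<le> e * real m"
  shows "(\<lambda>n. (\<Sum>j<n. a j) / real n) \<longlonglongrightarrow> 0"
proof (rule LIMSEQ_I)
  fix r :: real assume r: "0 < r"
  obtain m where m: "m > 0" "\<And>p. (\<Sum>j<m. a (j + p)) \<le> r / 3 * real m" using blocks[of "r / 3"] r by auto
  show "\<exists>n0. \<forall>n\<ge>n0. norm ((\<Sum>j<n. a j) / real n - 0) < r"
  proof (intro exI[of _ m] allI impI)
    fix n assume n: "m \<le> n"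
    define q where "q = Suc (n div m)"
    have nq: "n \<le> q * m" unfolding q_def using dividend_less_div_times[OF m(1), of n] by simp
    have "n div m * m \<le> n" by simp
    then have qm: "real q * real m \<le> real n + real m"
      unfolding q_def by (simp add: algebra_simps flip: of_nat_mult) 
    have "(\<Sum>j<n. a j) \<le> (\<Sum>j<q * m. a j)" using nq pos by (intro sum_mono2) auto
    also have "\<dots> = (\<Sum>k<q. \<Sum>j\<in>{k * m..<k * m + m}. a j)" by (rule sum.nat_group[symmetric])
    also have "\<dots> \<le> (\<Sum>k<q. r / 3 * real m)"
    proof (rule sum_mono)
      fix k
      have "(\<Sum>j\<in>{k * m..<k * m + m}. a j) = (\<Sum>j<m. a (j + k * m))"
        using sum.shift_bounds_nat_ivl[of a 0 "k * m" m] by (simp add: add.commute lessThan_atLeast0)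
      then show "(\<Sum>j\<in>{k * m..<k * m + m}. a j) \<le> r / 3 * real m" using m(2) by simp
    qed
    also have "\<dots> = r / 3 * (real q * real m)" by simp
    also have "\<dots> \<le> r / 3 * (2 * real n)" using qm n r by (intro mult_left_mono) auto
    also have "\<dots> < r * real n" using r n m(1) by simp
    finally have "(\<Sum>j<n. a j) / real n < r" using n m(1) by (simp add: divide_less_eq)
    moreover have "0 \<le> (\<Sum>j<n. a j) / real n" using pos by (intro divide_nonneg_nonneg sum_nonneg) auto
    ultimately show "norm ((\<Sum>j<n. a j) / real n - 0) < r" by simp
  qed
qed

text \<open>The defining property of weak mixing with an integrable function in place of the first set.\<close>

definition decorrelates :: "(circle \<Rightarrow> circle) \<Rightarrow> (circle \<Rightarrow> real) \<Rightarrow> bool" where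
  "decorrelates T h \<longleftrightarrow> (\<forall>B\<in>sets borel. (\<lambda>n. (\<Sum>j<n. \<bar>(\<integral>x. h ((T ^^ j) x) * indicator B x \<partial>circle_measure)
      - (\<integral>x. h x \<partial>circle_measure) * measure circle_measure B\<bar>) / real n) \<longlonglongrightarrow> 0)"

definition centred_arc :: "real \<Rightarrow> circle \<Rightarrow> real" where
  "centred_arc q x = indicator (arc q) x - measure circle_measure (arc q)"

lemma centred_arc_test_function: "test_function (centred_arc q)"
proof -
  have "\<bar>centred_arc q x\<bar> \<le> 1" for x
    using circle.prob_le_1[of "arc q"] measure_nonneg[of circle_measure "arc q"]
    by (auto simp: centred_arc_def indicator_def)
  then show ?thesis unfolding test_function_def centred_arc_def[abs_def] by auto
qed

lemma integral_centred_arc: "(\<integral>x. centred_arc q x \<partial>circle_measure) = 0"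
  unfolding centred_arc_def using circle.prob_space
  by (subst Bochner_Integration.integral_diff) (auto intro: integrable_indicator_circle)

lemma decorrelates_arc:
  assumes T: "T \<in> C_leb"
    and small: "\<And>e. 0 < e \<Longrightarrow> \<exists>m>0. correlation_sum T (centred_arc q) m \<le> e * (real m)\<^sup>2"
  shows "decorrelates T (indicator (arc q))"
  unfolding decorrelates_def
proof
  fix B :: "circle set" assume B: "B \<in> sets borel"
  define a where "a j = \<bar>\<integral>x. centred_arc q ((T ^^ j) x) * indicator B x \<partial>circle_measure\<bar>" for j
  have b: "bounded_borel (centred_arc q)" by (rule test_function_bounded_borel[OF centred_arc_test_function])
  have "(\<lambda>n. (\<Sum>j<n. a j) / real n) \<longlonglongrightarrow> 0"
  proof (rule cesaro_from_blocks)
    show "0 \<le> a j" for j by (simp add: a_def)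
    fix e :: real assume e: "0 < e"
    then obtain m where m: "m > 0" "correlation_sum T (centred_arc q) m \<le> e\<^sup>2 * (real m)\<^sup>2" using small[of "e\<^sup>2"] by auto
    have "(\<Sum>j<m. a (j + p)) \<le> e * real m" for p
    proof -
      have "(\<Sum>j<m. a (j + p)) \<le> sqrt (correlation_sum T (centred_arc q) m)"
        unfolding a_def by (rule correlation_block_bound[OF T b B])
      also have "\<dots> \<le> sqrt ((e * real m)\<^sup>2)" using m(2) by (simp add: power_mult_distrib)
      also have "\<dots> = e * real m" using e by simp
      finally show ?thesis .
    qed
    then show "\<exists>m>0. \<forall>p. (\<Sum>j<m. a (j + p)) \<le> e * real m" using m(1) by blast
  qed
  moreover have "a j = \<bar>(\<integral>x. indicator (arc q) ((T ^^ j) x) * indicator B x \<partial>circle_measure)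
      - (\<integral>x. indicator (arc q) x \<partial>circle_measure) * measure circle_measure B\<bar>" for j
  proof -
    have i: "integrable circle_measure (\<lambda>x. indicator (arc q) ((T ^^ j) x) * indicator B x :: real)"
      by (rule integrable_bounded_borel[OF bounded_borel_mult[OF
        bounded_borel_comp[OF bounded_borel_indicator[OF arc_measurable] C_leb_measurable[OF C_leb_funpow[OF T]]]
        bounded_borel_indicator[OF B]]])
    have "(\<integral>x. centred_arc q ((T ^^ j) x) * indicator B x \<partial>circle_measure) = 
      (\<integral>x. indicator (arc q) ((T ^^ j) x) * indicator B x - measure circle_measure (arc q) * indicator B x \<partial>circle_measure)"
      by (intro Bochner_Integration.integral_cong refl) (simp add: centred_arc_def left_diff_distrib)
    also have "\<dots> = (\<integral>x. indicator (arc q) ((T ^^ j) x) * indicator B x \<partial>circle_measure)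
      - measure circle_measure (arc q) * measure circle_measure B"
      using B by (subst Bochner_Integration.integral_diff[OF i]) (auto intro: integrable_indicator_circle)
    finally show ?thesis by (simp add: a_def)
  qed
  ultimately show "(\<lambda>n. (\<Sum>j<n. \<bar>(\<integral>x. indicator (arc q) ((T ^^ j) x) * indicator B x \<partial>circle_measure)
      - (\<integral>x. indicator (arc q) x \<partial>circle_measure) * measure circle_measure B\<bar>) / real n) \<longlonglongrightarrow> 0" by simp
qed

lemma cesaro_null_dominated:
  fixes a b :: "nat \<Rightarrow> real"
  assumes b: "(\<lambda>n. (\<Sum>j<n. b j) / real n) \<longlonglongrightarrow> 0"
    and ab: "\<And>j. 0 \<le> a j" "\<And>j. a j \<le> b j"
  shows "(\<lambda>n. (\<Sum>j<n. a j) / real n) \<longlonglongrightarrow> 0"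
  by (rule tendsto_sandwich[OF _ _ tendsto_const b])
    (auto intro!: always_eventually divide_right_mono divide_nonneg_nonneg sum_nonneg sum_mono ab)

text \<open>The property is linear in \<open>h\<close>, and changing \<open>h\<close> by a function of small mean norm changes every term
of the Cesaro mean by at most twice that norm.\<close>

lemma decorrelates_integrable:
  assumes T: "T \<in> C_leb" and h: "integrable circle_measure h"
    and arcs: "\<And>q. q \<in> \<rat> \<Longrightarrow> decorrelates T (indicator (arc q))"
  shows "decorrelates T h"
proof -
  let ?d = "\<lambda>h B j. (\<integral>x. h ((T ^^ j) x) * indicator B x \<partial>circle_measure) - (\<integral>x. h x \<partial>circle_measure) * measure circle_measure B"
  have iT: "integrable circle_measure (\<lambda>x. h ((T ^^ j) x))" if "integrable circle_measure h" for h :: "circle \<Rightarrow> real" and j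
    by (rule C_leb_integrable[OF C_leb_funpow[OF T] that])
  have i: "integrable circle_measure (\<lambda>x. h ((T ^^ j) x) * indicator B x)"
    if "integrable circle_measure h" "B \<in> sets borel" for h :: "circle \<Rightarrow> real" and B j
    by (rule integrable_mult_bounded(1)[OF iT[OF that(1)] bounded_borel_indicator[OF that(2)]])
  have d_add: "?d (\<lambda>x. f x + g x) B j = ?d f B j + ?d g B j"
    if "integrable circle_measure f" "integrable circle_measure g" "B \<in> sets borel" for f g B j
    using that i[of f B j] i[of g B j] by (simp add: distrib_right)
  have d_scale: "?d (\<lambda>x. c * f x) B j = c * ?d f B j" for c f B j
    by (simp add: mult.assoc right_diff_distrib)
  show ?thesis
  proof (rule integrable_circle_induct[OF h Int_stable_arcs arcs_generate])
    show "decorrelates T (indicator A)" if "A \<in> arc ` \<rat>" for A using that arcs by auto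
    show "decorrelates T (\<lambda>_. 1)" unfolding decorrelates_def using circle.prob_space by auto
  next
    fix f g assume f: "integrable circle_measure f" "decorrelates T f" and g: "integrable circle_measure g" "decorrelates T g"
    show "decorrelates T (\<lambda>x. f x + g x)" unfolding decorrelates_def
    proof
      fix B :: "circle set" assume B: "B \<in> sets borel"
      have lim: "(\<lambda>n. (\<Sum>j<n. \<bar>?d f B j\<bar>) / real n + (\<Sum>j<n. \<bar>?d g B j\<bar>) / real n) \<longlonglongrightarrow> 0 + 0"
        using f(2) g(2) B unfolding decorrelates_def by (intro tendsto_add) auto
      show "(\<lambda>n. (\<Sum>j<n. \<bar>?d (\<lambda>x. f x + g x) B j\<bar>) / real n) \<longlonglongrightarrow> 0"
      proof (rule cesaro_null_dominated)
        show "(\<lambda>n. (\<Sum>j<n. \<bar>?d f B j\<bar> + \<bar>?d g B j\<bar>) / real n) \<longlonglongrightarrow> 0"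
          using lim by (simp add: sum.distrib add_divide_distrib)
        show "\<bar>?d (\<lambda>x. f x + g x) B j\<bar> \<le> \<bar>?d f B j\<bar> + \<bar>?d g B j\<bar>" for j
          unfolding d_add[OF f(1) g(1) B] by (rule abs_triangle_ineq)
      qed simp
    qed
  next
    fix f and c :: real assume f: "decorrelates T f"
    show "decorrelates T (\<lambda>x. c * f x)" unfolding decorrelates_def d_scale
    proof
      fix B :: "circle set" assume B: "B \<in> sets borel"
      have "(\<lambda>n. \<bar>c\<bar> * ((\<Sum>j<n. \<bar>?d f B j\<bar>) / real n)) \<longlonglongrightarrow> \<bar>c\<bar> * 0"
        using f B unfolding decorrelates_def by (intro tendsto_mult_left) auto
      then show "(\<lambda>n. (\<Sum>j<n. \<bar>c * ?d f B j\<bar>) / real n) \<longlonglongrightarrow> 0"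
        by (simp add: abs_mult flip: sum_distrib_left)
    qed
  next
    fix f assume f: "integrable circle_measure f"
      and approx: "\<And>e. 0 < e \<Longrightarrow> \<exists>g. integrable circle_measure g \<and> decorrelates T g \<and> (\<integral>x. \<bar>f x - g x\<bar> \<partial>circle_measure) < e"
    show "decorrelates T f" unfolding decorrelates_def
    proof
      fix B :: "circle set" assume B: "B \<in> sets borel"
      show "(\<lambda>n. (\<Sum>j<n. \<bar>?d f B j\<bar>) / real n) \<longlonglongrightarrow> 0"
      proof (rule LIMSEQ_I)
        fix r :: real assume r: "0 < r"
        then obtain g where g: "integrable circle_measure g" "decorrelates T g" "(\<integral>x. \<bar>f x - g x\<bar> \<partial>circle_measure) < r / 4"
          using approx[of "r / 4"] by auto
        define k where "k x = f x - g x" for x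
        have k: "integrable circle_measure k" unfolding k_def using f g by simp
        have fgk: "f = (\<lambda>x. g x + k x)" by (auto simp: k_def)
        have kb: "\<bar>?d k B j\<bar> \<le> r / 2" for j
        proof -
          have [measurable]: "k \<in> borel_measurable borel" using borel_measurable_integrable[OF k] by simp
          have "\<bar>\<integral>x. k ((T ^^ j) x) * indicator B x \<partial>circle_measure\<bar> \<le> (\<integral>x. \<bar>k ((T ^^ j) x) * indicator B x\<bar> \<partial>circle_measure)"
            by (rule integral_abs_bound)
          also have "\<dots> \<le> (\<integral>x. \<bar>k ((T ^^ j) x)\<bar> \<partial>circle_measure)"
            by (rule integral_mono[OF integrable_abs[OF i[OF k B]] integrable_abs[OF iT[OF k]]]) (simp add: indicator_def)
          also have "\<dots> = (\<integral>x. \<bar>k x\<bar> \<partial>circle_measure)"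
            by (rule C_leb_integral[OF C_leb_funpow[OF T]]) measurable
          finally have 1: "\<bar>\<integral>x. k ((T ^^ j) x) * indicator B x \<partial>circle_measure\<bar> \<le> r / 4" using g(3) by (simp add: k_def)
          have "(\<integral>x. \<bar>k x\<bar> \<partial>circle_measure) < r / 4" using g(3) by (simp add: k_def)
          then have "\<bar>\<integral>x. k x \<partial>circle_measure\<bar> \<le> r / 4"
            using integral_abs_bound[of circle_measure k] by linarith
          then have "\<bar>\<integral>x. k x \<partial>circle_measure\<bar> * measure circle_measure B \<le> r / 4 * 1"
            using r by (intro mult_mono) auto
          then have "\<bar>(\<integral>x. k x \<partial>circle_measure) * measure circle_measure B\<bar> \<le> r / 4" by (simp add: abs_mult)
          with 1 show ?thesis by linarith
        qed
        from g(2) B have "(\<lambda>n. (\<Sum>j<n. \<bar>?d g B j\<bar>) / real n) \<longlonglongrightarrow> 0" unfolding decorrelates_def by blast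
        from LIMSEQ_D[OF this half_gt_zero[OF r]]
        obtain n0 where n0: "\<And>n. n \<ge> n0 \<Longrightarrow> norm ((\<Sum>j<n. \<bar>?d g B j\<bar>) / real n - 0) < r / 2"
          by blast
        show "\<exists>n0. \<forall>n\<ge>n0. norm ((\<Sum>j<n. \<bar>?d f B j\<bar>) / real n - 0) < r"
        proof (intro exI[of _ "max n0 1"] allI impI)
          fix n assume n: "max n0 1 \<le> n"
          have "(\<Sum>j<n. \<bar>?d f B j\<bar>) \<le> (\<Sum>j<n. \<bar>?d g B j\<bar> + r / 2)"
          proof (rule sum_mono)
            fix j
            show "\<bar>?d f B j\<bar> \<le> \<bar>?d g B j\<bar> + r / 2"
              using kb[of j] d_add[OF g(1) k B, of j] unfolding fgk by linarith
          qed
          then have "(\<Sum>j<n. \<bar>?d f B j\<bar>) \<le> (\<Sum>j<n. \<bar>?d g B j\<bar>) + real n * (r / 2)" by (simp add: sum.distrib)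
          then have "(\<Sum>j<n. \<bar>?d f B j\<bar>) / real n \<le> (\<Sum>j<n. \<bar>?d g B j\<bar>) / real n + r / 2"
            using n by (simp add: field_simps)
          moreover have "norm ((\<Sum>j<n. \<bar>?d g B j\<bar>) / real n - 0) < r / 2" using n by (intro n0) simp
          moreover have "0 \<le> (\<Sum>j<n. \<bar>?d f B j\<bar>) / real n" by (intro divide_nonneg_nonneg sum_nonneg) auto
          ultimately show "norm ((\<Sum>j<n. \<bar>?d f B j\<bar>) / real n - 0) < r"
            unfolding real_norm_def diff_0_right by linarith
        qed
      qed
    qed
  qed
qed

lemma weakly_mixing_if_correlations_small:
  assumes T: "T \<in> C_leb"
    and small: "\<And>q e. q \<in> \<rat> \<Longrightarrow> 0 < e \<Longrightarrow> \<exists>m>0. correlation_sum T (centred_arc q) m \<le> e * (real m)\<^sup>2"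
  shows "weakly_mixing T"
  unfolding weakly_mixing_def
proof (intro ballI)
  fix A B :: "circle set" assume A: "A \<in> sets borel" and B: "B \<in> sets borel"
  have "decorrelates T (indicator A)"
    by (rule decorrelates_integrable[OF T integrable_indicator_circle[OF A] decorrelates_arc[OF T small]])
  then have "(\<lambda>n. (\<Sum>j<n. \<bar>(\<integral>x. indicator A ((T ^^ j) x) * indicator B x \<partial>circle_measure)
      - (\<integral>x. indicator A x \<partial>circle_measure) * measure circle_measure B\<bar>) / real n) \<longlonglongrightarrow> 0"
    using B unfolding decorrelates_def by blast
  moreover have "(\<integral>x. indicator A ((T ^^ j) x) * indicator B x \<partial>circle_measure) = measure circle_measure ((T ^^ j) -` A \<inter> B)" for j
  proof -
    have "(T ^^ j) -` A \<in> sets borel" using measurable_sets[OF C_leb_measurable[OF C_leb_funpow[OF T]] A] by simp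
    moreover have "(\<lambda>x. indicator A ((T ^^ j) x) * indicator B x) = (indicator ((T ^^ j) -` A \<inter> B) :: circle \<Rightarrow> real)"
      by (auto simp: indicator_def)
    ultimately show ?thesis using B by simp
  qed
  moreover have "(\<integral>x. indicator A x \<partial>circle_measure) = measure circle_measure A" using A by simp
  ultimately show "(\<lambda>n. (\<Sum>j<n. \<bar>measure circle_measure ((T ^^ j) -` A \<inter> B)
      - measure circle_measure A * measure circle_measure B\<bar>) / real n) \<longlonglongrightarrow> 0"
    by (simp only:)
qed

section \<open>Completeness of the space of maps\<close>

interpretation C_leb: Metric_space C_leb unif_dist
  by (rule Metric_space_C_leb)

lemma dist_le_unif_dist: "dist (f x) (g x) \<le> unif_dist f g"
  unfolding unif_dist_def
  by (rule cSUP_upper) (auto intro!: bdd_aboveI2[of _ _ "1/2"] dist_circle_le_half)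

lemma unif_dist_le: "(\<And>x. dist (f x) (g x) \<le> c) \<Longrightarrow> unif_dist f g \<le> c"
  unfolding unif_dist_def by (rule cSUP_least) auto

text \<open>Invariance is tested on continuous functions because it then passes to uniform limits of maps; indicators of
closed sets are recovered as bounded limits.\<close>

lemma C_leb_of_continuous_test:
  assumes f: "continuous_on UNIV f"
    and eq: "\<And>k::circle \<Rightarrow> real. continuous_on UNIV k \<Longrightarrow>
      (\<integral>x. k (f x) \<partial>circle_measure) = (\<integral>x. k x \<partial>circle_measure)"
  shows "f \<in> C_leb"
proof -
  have m[measurable]: "f \<in> borel_measurable borel" using f by (rule borel_measurable_continuous_onI)
  have closed: "emeasure (distr circle_measure borel f) C = emeasure circle_measure C" if C: "closed C" for C
  proof -
    obtain k :: "nat \<Rightarrow> circle \<Rightarrow> real" where k: "\<And>n. continuous_on UNIV (k n)" "\<And>n x. \<bar>k n x\<bar> \<le> 1"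
      "\<And>x. (\<lambda>n. k n x) \<longlonglongrightarrow> indicator C x" using indicator_closed_limit[OF C] by blast
    have Cb[measurable]: "C \<in> sets borel" using C by (rule borel_closed)
    have [measurable]: "k n \<in> borel_measurable borel" for n using k(1) by (rule borel_measurable_continuous_onI)
    have 1: "(\<lambda>n. \<integral>x. k n x \<partial>circle_measure) \<longlonglongrightarrow> (\<integral>x. indicator C x \<partial>circle_measure)"
      by (rule integral_dominated_convergence[where w="\<lambda>_. 1"]) (use k in auto)
    have 2: "(\<lambda>n. \<integral>x. k n (f x) \<partial>circle_measure) \<longlonglongrightarrow> (\<integral>x. indicator C (f x) \<partial>circle_measure)"
      by (rule integral_dominated_convergence[where w="\<lambda>_. 1"]) (use k in auto)
    have "(\<integral>x. indicator C (f x) \<partial>circle_measure) = (\<integral>x. indicator C x \<partial>circle_measure :: real)"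
      using LIMSEQ_unique[OF 2] 1 by (simp add: eq[OF k(1)])
    moreover have "(\<lambda>x. indicator C (f x)) = (indicator (f -` C) :: circle \<Rightarrow> real)" by (auto simp: indicator_def)
    moreover have "f -` C \<in> sets borel" using measurable_sets[OF m Cb] by simp
    ultimately have "measure circle_measure (f -` C) = measure circle_measure C" using Cb by simp
    then show ?thesis by (subst emeasure_distr) (auto simp: circle.emeasure_eq_measure)
  qed
  have "distr circle_measure borel f = circle_measure"
  proof (rule measure_eqI_generator_eq[where E="Collect closed" and \<Omega>=UNIV and A="\<lambda>_. UNIV"])
    show "Int_stable (Collect (closed :: circle set \<Rightarrow> bool))" by (auto simp: Int_stable_def)
    show "sets (distr circle_measure borel f) = sigma_sets UNIV (Collect closed)" by (simp add: closed_sets_generate)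
    show "sets circle_measure = sigma_sets UNIV (Collect closed)" by (simp add: closed_sets_generate)
    show "emeasure (distr circle_measure borel f) UNIV \<noteq> \<infinity>" using closed[of UNIV] by simp
  qed (use closed in auto)
  with f show ?thesis by (simp add: C_leb_iff_distr)
qed

lemma C_leb_mcomplete: "C_leb.mcomplete"
  unfolding C_leb.mcomplete_def
proof (intro allI impI)
  fix \<sigma> assume C: "C_leb.MCauchy \<sigma>"
  then have \<sigma>: "\<sigma> n \<in> C_leb" for n by (auto simp: C_leb.MCauchy_def)
  have cau: "\<exists>n0. \<forall>n n'. n0 \<le> n \<longrightarrow> n0 \<le> n' \<longrightarrow> unif_dist (\<sigma> n) (\<sigma> n') < e" if "e > 0" for e
    using C that by (auto simp: C_leb.MCauchy_def)
  have "\<exists>l. (\<lambda>n. \<sigma> n x) \<longlonglongrightarrow> l" for x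
  proof -
    have "Cauchy (\<lambda>n. \<sigma> n x)"
    proof (rule metric_CauchyI)
      fix e :: real assume "0 < e"
      then obtain n0 where "\<And>n n'. n0 \<le> n \<Longrightarrow> n0 \<le> n' \<Longrightarrow> unif_dist (\<sigma> n) (\<sigma> n') < e" using cau by blast
      then show "\<exists>M. \<forall>m\<ge>M. \<forall>n\<ge>M. dist (\<sigma> m x) (\<sigma> n x) < e"
        by (intro exI[of _ n0] allI impI le_less_trans[OF dist_le_unif_dist])
    qed
    then show ?thesis using compact_imp_complete[OF compact_UNIV_circle] by (auto simp: complete_def)
  qed
  then obtain f where f: "\<And>x. (\<lambda>n. \<sigma> n x) \<longlonglongrightarrow> f x" by metis
  have unif: "\<exists>n0. \<forall>n\<ge>n0. unif_dist (\<sigma> n) f < e" if e: "e > 0" for e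
  proof -
    obtain n0 where n0: "\<And>n n'. n0 \<le> n \<Longrightarrow> n0 \<le> n' \<Longrightarrow> unif_dist (\<sigma> n) (\<sigma> n') < e / 2"
      using cau[of "e / 2"] e by auto
    have "unif_dist (\<sigma> n) f \<le> e / 2" if n: "n \<ge> n0" for n
    proof (rule unif_dist_le)
      fix x
      have "(\<lambda>n'. dist (\<sigma> n x) (\<sigma> n' x)) \<longlonglongrightarrow> dist (\<sigma> n x) (f x)" by (intro tendsto_intros f)
      then show "dist (\<sigma> n x) (f x) \<le> e / 2"
      proof (rule LIMSEQ_le_const2)
        have "dist (\<sigma> n x) (\<sigma> n' x) \<le> e / 2" if "n' \<ge> n0" for n'
          using dist_le_unif_dist[of "\<sigma> n" x "\<sigma> n'"] n0[OF n that] by linarith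
        then show "\<exists>N. \<forall>n'\<ge>N. dist (\<sigma> n x) (\<sigma> n' x) \<le> e / 2" by blast
      qed
    qed
    moreover have "e / 2 < e" using e by simp
    ultimately show ?thesis by (intro exI[of _ n0] allI impI) (rule le_less_trans)
  qed
  have "uniform_limit UNIV \<sigma> f sequentially"
    unfolding uniform_limit_sequentially_iff
  proof (intro allI impI)
    fix e :: real assume "0 < e"
    then obtain n0 where n0: "\<forall>n\<ge>n0. unif_dist (\<sigma> n) f < e" using unif by blast
    show "\<exists>N. \<forall>n\<ge>N. \<forall>x\<in>UNIV. dist (\<sigma> n x) (f x) < e"
      by (intro exI[of _ n0] allI impI ballI le_less_trans[OF dist_le_unif_dist] n0[rule_format])
  qed
  then have cont: "continuous_on UNIV f"
    by (rule uniform_limit_theorem[rotated]) (use \<sigma> C_leb_continuous in auto)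
  have "f \<in> C_leb"
  proof (rule C_leb_of_continuous_test[OF cont])
    fix k :: "circle \<Rightarrow> real" assume k: "continuous_on UNIV k"
    have kb: "bounded_borel k" by (rule bounded_borel_continuous[OF k])
    then obtain B where B: "\<And>x. \<bar>k x\<bar> \<le> B" using bounded_borel_bound by blast
    have [measurable]: "k \<in> borel_measurable borel" by (rule bounded_borelD[OF kb])
    have [measurable]: "\<sigma> n \<in> borel_measurable borel" for n by (rule C_leb_measurable[OF \<sigma>])
    have [measurable]: "f \<in> borel_measurable borel" by (rule borel_measurable_continuous_onI[OF cont])
    have "(\<lambda>n. \<integral>x. k (\<sigma> n x) \<partial>circle_measure) \<longlonglongrightarrow> (\<integral>x. k (f x) \<partial>circle_measure)"
    proof (rule integral_dominated_convergence[where w="\<lambda>_. B"])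
      show "AE x in circle_measure. (\<lambda>n. k (\<sigma> n x)) \<longlonglongrightarrow> k (f x)"
        by (rule AE_I2) (rule continuous_on_tendsto_compose[OF k f], auto)
    qed (use B in auto)
    moreover have "(\<integral>x. k (\<sigma> n x) \<partial>circle_measure) = (\<integral>x. k x \<partial>circle_measure)" for n
      by (rule C_leb_integral[OF \<sigma> bounded_borelD[OF kb]])
    ultimately have "(\<lambda>n. \<integral>x. k x \<partial>circle_measure) \<longlonglongrightarrow> (\<integral>x. k (f x) \<partial>circle_measure)" by simp
    from LIMSEQ_unique[OF this tendsto_const]
    show "(\<integral>x. k (f x) \<partial>circle_measure) = (\<integral>x. k x \<partial>circle_measure)" .
  qed
  then show "\<exists>x. limitin C_leb.mtopology \<sigma> x sequentially"
    unfolding C_leb.limit_metric_sequentially by (intro exI[of _ f]) (simp add: unif \<sigma>)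
qed

section \<open>Openness of the correlation conditions\<close>

lemma AE_coord_neq:
  assumes f: "f \<in> C_leb" shows "AE x in circle_measure. coord (f x) \<noteq> c"
proof -
  define Z where "Z = {x. coord x = c}"
  have Z[measurable]: "Z \<in> sets borel" unfolding Z_def by measurable
  have "measure circle_measure Z = (\<integral>x. indicator Z x \<partial>circle_measure)" by simp
  also have "\<dots> = (LINT t:{0..<1}|lborel. indicator Z (circle_of t))" by (rule integral_circle_measure) simp
  also have "\<dots> = 0" unfolding set_lebesgue_integral_def
  proof (rule integral_eq_zero_AE)
    show "AE t in lborel. indicator {0..<1} t *\<^sub>R indicator Z (circle_of t) = (0::real)"
      using AE_lborel_singleton[of c]
      by eventually_elim (auto simp: indicator_def Z_def frac_eq[THEN iffD2])
  qed
  finally have "emeasure circle_measure Z = 0" by (simp add: circle.emeasure_eq_measure)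
  then have "emeasure circle_measure (f -` Z) = 0" using f Z unfolding C_leb_def by auto
  moreover have "f -` Z \<in> sets circle_measure" using measurable_sets[OF C_leb_measurable[OF f] Z] by simp
  ultimately have "AE x in circle_measure. x \<notin> f -` Z" by (intro AE_not_in) auto
  then show ?thesis by (simp add: Z_def)
qed

text \<open>The coordinate is continuous away from the point with coordinate 0; the bound \<open>0 \<le> p\<close> excludes that point.\<close>

lemma eventually_coord_between:
  assumes lim: "(y \<longlongrightarrow> x) F" and p: "0 \<le> p" "p < coord x" and r: "coord x < r"
  shows "\<forall>\<^sub>F l in F. p < coord (y l) \<and> coord (y l) < r"
proof -
  define e where "e = min (coord x - p) (min r 1 - coord x)"
  have e: "e > 0" using assms coord_less_1[of x] by (auto simp: e_def min_def)
  have "p < coord z \<and> coord z < r" if "dist z x < e" for z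
  proof -
    have b: "0 \<le> coord z" "coord z < 1" "0 \<le> coord x" "coord x < 1" by simp_all
    have e1: "e \<le> coord x - p" "e \<le> r - coord x" "e \<le> 1 - coord x" by (auto simp: e_def min_def)
    have "\<bar>coord z - coord x\<bar> < e \<or> 1 - \<bar>coord z - coord x\<bar> < e" using that by (auto simp: dist_circle_def min_def split: if_splits)
    then show ?thesis using b e1 p by linarith
  qed
  then show ?thesis using tendstoD[OF lim e] by (auto elim: eventually_mono)
qed

text \<open>The exceptional points are the two ends of the arc; they are met with probability zero
by every iterate of an invariant map.\<close>

lemma centred_arc_tendsto:
  assumes lim: "y \<longlonglongrightarrow> x" and x: "coord x \<noteq> 0" "coord x \<noteq> q"
  shows "(\<lambda>l. centred_arc q (y l)) \<longlonglongrightarrow> centred_arc q x"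
proof -
  have x0: "0 < coord x" using x(1) coord_ge_0[of x] by linarith
  have "\<forall>\<^sub>F l in sequentially. (y l \<in> arc q \<longleftrightarrow> x \<in> arc q)"
  proof (cases "coord x < q")
    case True
    from eventually_coord_between[OF lim order_refl x0 True] show ?thesis
      by (rule eventually_mono) (use True in \<open>auto simp: arc_def\<close>)
  next
    case False
    then have "max 0 q < coord x" using x x0 by auto
    from eventually_coord_between[OF lim max.cobounded1 this coord_less_1] show ?thesis
      by (rule eventually_mono) (use False in \<open>auto simp: arc_def\<close>)
  qed
  then have "\<forall>\<^sub>F l in sequentially. centred_arc q (y l) = centred_arc q x"
    by (rule eventually_mono) (simp add: centred_arc_def indicator_def)
  then show ?thesis by (rule tendsto_eventually)
qed

lemma two_sided_rotation_apply: "two_sided_rotation a b f x = rotation a (f (rotation b x))"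
  by (simp add: two_sided_rotation_def)

lemma two_sided_rotation_Suc:
  "(two_sided_rotation a b f ^^ Suc i) x = rotation a (f (rotation b ((two_sided_rotation a b f ^^ i) x)))"
  by (simp only: funpow.simps o_apply two_sided_rotation_apply[of _ _ _ "(_ ^^ _) _"])

text \<open>Only the fractional parts of the angles matter, so the angles may be taken from a compact interval.\<close>

lemma two_sided_rotation_frac:
  "two_sided_rotation (frac a) (frac b) f = two_sided_rotation a b f"
proof -
  have "rotation (frac c) = rotation c" for c
    using rotation_add_int[of "frac c" "\<lfloor>c\<rfloor>"] by (auto simp: frac_def)
  then show ?thesis by (simp add: two_sided_rotation_def)
qed

lemma rotation_tendsto:
  assumes "b \<longlonglongrightarrow> c" "y \<longlonglongrightarrow> x"
  shows "(\<lambda>l. rotation (b l) (y l)) \<longlonglongrightarrow> rotation c x"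
proof (rule metric_tendsto_imp_tendsto[of "\<lambda>l. dist (y l) x + \<bar>b l - c\<bar>" 0])
  have "(\<lambda>l. dist (y l) x + \<bar>b l - c\<bar>) \<longlonglongrightarrow> dist x x + \<bar>c - c\<bar>" by (intro tendsto_intros assms)
  then show "(\<lambda>l. dist (y l) x + \<bar>b l - c\<bar>) \<longlonglongrightarrow> 0" by simp
  show "\<forall>\<^sub>F l in sequentially. dist (rotation (b l) (y l)) (rotation c x) \<le> dist (dist (y l) x + \<bar>b l - c\<bar>) 0"
  proof (rule always_eventually, rule allI)
    fix l
    have "dist (rotation (b l) (y l)) (rotation c x) \<le> dist (rotation (b l) (y l)) (rotation (b l) x) + dist (rotation (b l) x) (rotation c x)"
      by (rule dist_triangle)
    also have "\<dots> \<le> dist (y l) x + \<bar>b l - c\<bar>" using dist_rotation_angle[of "b l" x c] by simp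
    finally show "dist (rotation (b l) (y l)) (rotation c x) \<le> dist (dist (y l) x + \<bar>b l - c\<bar>) 0"
      by (simp add: dist_real_def)
  qed
qed

text \<open>Convergence along convergent sequences of points, not only at fixed points, is what carries over from one iterate to the next.\<close>

lemma two_sided_rotation_funpow_tendsto:
  assumes f: "f \<in> C_leb" and fl: "(\<lambda>l. unif_dist (F l) f) \<longlonglongrightarrow> 0"
    and a: "a \<longlonglongrightarrow> a'" and b: "b \<longlonglongrightarrow> b'"
  shows "(\<lambda>l. (two_sided_rotation (a l) (b l) (F l) ^^ i) x) \<longlonglongrightarrow> (two_sided_rotation a' b' f ^^ i) x"
proof (induction i)
  case 0
  show ?case by simp
next
  case (Suc i)
  define y where "y l = rotation (b l) ((two_sided_rotation (a l) (b l) (F l) ^^ i) x)" for l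
  define z where "z = rotation b' ((two_sided_rotation a' b' f ^^ i) x)"
  have yz: "y \<longlonglongrightarrow> z" unfolding y_def z_def by (rule rotation_tendsto[OF b Suc])
  have "(\<lambda>l. F l (y l)) \<longlonglongrightarrow> f z"
  proof (rule metric_tendsto_imp_tendsto[of "\<lambda>l. unif_dist (F l) f + dist (f (y l)) (f z)" 0])
    have "(\<lambda>l. f (y l)) \<longlonglongrightarrow> f z" by (rule continuous_on_tendsto_compose[OF C_leb_continuous[OF f] yz]) auto
    then have "(\<lambda>l. unif_dist (F l) f + dist (f (y l)) (f z)) \<longlonglongrightarrow> 0 + dist (f z) (f z)" by (intro tendsto_intros fl)
    then show "(\<lambda>l. unif_dist (F l) f + dist (f (y l)) (f z)) \<longlonglongrightarrow> 0" by simp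
    show "\<forall>\<^sub>F l in sequentially. dist (F l (y l)) (f z) \<le> dist (unif_dist (F l) f + dist (f (y l)) (f z)) 0"
    proof (rule always_eventually, rule allI)
      fix l
      have "dist (F l (y l)) (f z) \<le> dist (F l (y l)) (f (y l)) + dist (f (y l)) (f z)" by (rule dist_triangle)
      also have "\<dots> \<le> unif_dist (F l) f + dist (f (y l)) (f z)" using dist_le_unif_dist by (intro add_right_mono)
      finally show "dist (F l (y l)) (f z) \<le> dist (unif_dist (F l) f + dist (f (y l)) (f z)) 0"
        by (simp add: dist_real_def)
    qed
  qed
  from rotation_tendsto[OF a this] show ?case
    unfolding two_sided_rotation_Suc y_def z_def .
qed

lemma correlation_sum_tendsto:
  assumes f: "f \<in> C_leb" and F: "\<And>l. F l \<in> C_leb" and fl: "(\<lambda>l. unif_dist (F l) f) \<longlonglongrightarrow> 0"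
    and a: "a \<longlonglongrightarrow> a'" and b: "b \<longlonglongrightarrow> b'"
  shows "(\<lambda>l. correlation_sum (two_sided_rotation (a l) (b l) (F l)) (centred_arc q) m)
    \<longlonglongrightarrow> correlation_sum (two_sided_rotation a' b' f) (centred_arc q) m"
proof -
  define T where "T l = two_sided_rotation (a l) (b l) (F l)" for l
  define T' where "T' = two_sided_rotation a' b' f"
  have T: "T l \<in> C_leb" for l unfolding T_def by (rule two_sided_rotation_in_C_leb[OF F])
  have T': "T' \<in> C_leb" unfolding T'_def by (rule two_sided_rotation_in_C_leb[OF f])
  have lim: "(\<lambda>l. (T l ^^ i) x) \<longlonglongrightarrow> (T' ^^ i) x" for i x
    unfolding T_def T'_def by (rule two_sided_rotation_funpow_tendsto[OF f fl a b])
  have [measurable]: "centred_arc q \<in> borel_measurable borel"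
    using centred_arc_test_function by (simp add: test_function_def)
  have c1: "\<bar>centred_arc q x\<bar> \<le> 1" for x using centred_arc_test_function by (simp add: test_function_def)
  have [measurable]: "T l ^^ i \<in> borel_measurable borel" for l i by (rule C_leb_measurable[OF C_leb_funpow[OF T]])
  have [measurable]: "T' ^^ i \<in> borel_measurable borel" for i by (rule C_leb_measurable[OF C_leb_funpow[OF T']])
  have "(\<lambda>l. correlation (T l) (centred_arc q) i j) \<longlonglongrightarrow> correlation T' (centred_arc q) i j" for i j
    unfolding correlation_def
  proof (rule integral_dominated_convergence[where w="\<lambda>_. 1"])
    note AE_coord_neq[OF C_leb_funpow[OF T', of i], of 0] AE_coord_neq[OF C_leb_funpow[OF T', of i], of q]
      AE_coord_neq[OF C_leb_funpow[OF T', of j], of 0] AE_coord_neq[OF C_leb_funpow[OF T', of j], of q]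
    then show "AE x in circle_measure. (\<lambda>l. centred_arc q ((T l ^^ i) x) * centred_arc q ((T l ^^ j) x))
        \<longlonglongrightarrow> centred_arc q ((T' ^^ i) x) * centred_arc q ((T' ^^ j) x)"
      by eventually_elim (intro tendsto_mult centred_arc_tendsto lim)
    show "AE x in circle_measure. norm (centred_arc q ((T l ^^ i) x) * centred_arc q ((T l ^^ j) x)) \<le> 1" for l
    proof (rule AE_I2)
      fix x
      have "\<bar>centred_arc q ((T l ^^ i) x)\<bar> * \<bar>centred_arc q ((T l ^^ j) x)\<bar> \<le> 1 * 1"
        using c1 by (intro mult_mono) auto
      then show "norm (centred_arc q ((T l ^^ i) x) * centred_arc q ((T l ^^ j) x)) \<le> 1" by (simp add: abs_mult)
    qed
  qed auto
  then show ?thesis unfolding correlation_sum_def T_def[symmetric] T'_def[symmetric]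
    by (intro tendsto_sum tendsto_rabs)
qed

text \<open>The angles range over all reals, which makes the set invariant under two-sided rotations. The length
\<open>m\<close> may depend on the angles.\<close>

definition nearly_mixing :: "real \<Rightarrow> real \<Rightarrow> (circle \<Rightarrow> circle) set" where
  "nearly_mixing q e = {f \<in> C_leb. \<forall>a b. \<exists>m>0.
     correlation_sum (two_sided_rotation a b f) (centred_arc q) m < e * (real m)\<^sup>2}"

text \<open>If the complement contained maps arbitrarily close to \<open>f\<close>, the angles that witness this would accumulate at some
pair, and by continuity of the correlation sums that pair would witness that \<open>f\<close> is in the complement as well.\<close>

lemma openin_nearly_mixing: "openin C_leb.mtopology (nearly_mixing q e)"
  unfolding C_leb.openin_mtopology
proof (intro conjI allI impI)
  show "nearly_mixing q e \<subseteq> C_leb" by (auto simp: nearly_mixing_def)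
  fix f assume f: "f \<in> nearly_mixing q e"
  then have fC: "f \<in> C_leb" by (auto simp: nearly_mixing_def)
  show "\<exists>r>0. C_leb.mball f r \<subseteq> nearly_mixing q e"
  proof (rule ccontr)
    assume neg: "\<not> ?thesis"
    have "\<exists>g. g \<in> C_leb \<and> unif_dist f g < 1 / real (Suc l) \<and> g \<notin> nearly_mixing q e" for l
    proof -
      have "0 < 1 / real (Suc l)" by simp
      with neg have "\<not> C_leb.mball f (1 / real (Suc l)) \<subseteq> nearly_mixing q e" by blast
      then show ?thesis by (auto simp: C_leb.in_mball)
    qed
    then obtain F where F: "\<And>l. F l \<in> C_leb" "\<And>l. unif_dist f (F l) < 1 / real (Suc l)" "\<And>l. F l \<notin> nearly_mixing q e"
      by metis
    have "\<exists>a b. a \<in> {0..1} \<and> b \<in> {0..1} \<and> (\<forall>m>0. e * (real m)\<^sup>2 \<le> correlation_sum (two_sided_rotation a b (F l)) (centred_arc q) m)" for l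
    proof -
      have "\<exists>a b. \<forall>m>0. \<not> correlation_sum (two_sided_rotation a b (F l)) (centred_arc q) m < e * (real m)\<^sup>2"
        using F(1,3)[of l] unfolding nearly_mixing_def by blast
      then obtain a b where ab: "\<forall>m>0. e * (real m)\<^sup>2 \<le> correlation_sum (two_sided_rotation a b (F l)) (centred_arc q) m"
        unfolding not_less by blast
      have "frac a \<in> {0..1}" "frac b \<in> {0..1}" using frac_lt_1 by (auto intro: less_imp_le)
      with ab show ?thesis
        by - (rule exI[of _ "frac a"], rule exI[of _ "frac b"], simp add: two_sided_rotation_frac)
    qed
    then obtain a b where ab: "\<And>l. a l \<in> {0..1}" "\<And>l. b l \<in> {0..1::real}"
      "\<And>l m. m > 0 \<Longrightarrow> e * (real m)\<^sup>2 \<le> correlation_sum (two_sided_rotation (a l) (b l) (F l)) (centred_arc q) m"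
      by metis
    have "compact ({0..1::real} \<times> {0..1::real})" by (intro compact_Times) auto
    then have "seq_compact ({0..1::real} \<times> {0..1::real})" by (rule compact_imp_seq_compact)
    then obtain ab' and s :: "nat \<Rightarrow> nat" where s: "strict_mono s" "((\<lambda>l. (a l, b l)) \<circ> s) \<longlonglongrightarrow> ab'"
      unfolding seq_compact_def using ab(1,2) by (metis (no_types, lifting) SigmaI)
    have lim: "(\<lambda>l. a (s l)) \<longlonglongrightarrow> fst ab'" "(\<lambda>l. b (s l)) \<longlonglongrightarrow> snd ab'"
      using tendsto_fst[OF s(2)] tendsto_snd[OF s(2)] by (simp_all add: o_def)
    have "(\<lambda>l. unif_dist (F (s l)) f) \<longlonglongrightarrow> 0"
    proof (rule tendsto_sandwich[OF _ _ tendsto_const])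
      show "(\<lambda>l. 1 / real (Suc (s l))) \<longlonglongrightarrow> 0"
        using LIMSEQ_subseq_LIMSEQ[OF LIMSEQ_Suc[OF lim_1_over_n] s(1)] by (simp add: o_def)
      show "\<forall>\<^sub>F l in sequentially. unif_dist (F (s l)) f \<le> 1 / real (Suc (s l))"
        using F(2) by (intro always_eventually allI) (metis C_leb.commute less_imp_le)
    qed (simp add: C_leb.nonneg)
    note tend = correlation_sum_tendsto[OF fC F(1) this lim]
    have "e * (real m)\<^sup>2 \<le> correlation_sum (two_sided_rotation (fst ab') (snd ab') f) (centred_arc q) m" if "m > 0" for m
      by (rule LIMSEQ_le_const[OF tend]) (use ab(3)[OF that] in blast)
    then show False using f unfolding nearly_mixing_def by (auto simp: not_less[symmetric])
  qed
qed

section \<open>Density of the correlation conditions and the main result\<close>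

text \<open>A two-sided rotation is conjugate, by a rotation, to a rotation applied on one side only.\<close>

lemma two_sided_rotation_funpow:
  "(two_sided_rotation a b f ^^ n) x = rotation (- b) (((\<lambda>x. rotation (a + b) (f x)) ^^ n) (rotation b x))"
proof (induction n)
  case 0
  show ?case by simp
next
  case (Suc n)
  then show ?case by (simp add: two_sided_rotation_apply)
qed

lemma correlation_sym: "correlation T \<phi> i j = correlation T \<phi> j i"
  by (simp add: correlation_def mult.commute)

text \<open>All correlations of distant times are at most \<open>e / 2\<close>; the pairs of times at distance less than \<open>n0\<close> number at
most \<open>2 * n0 * k\<close>, which is negligible against the square of \<open>k\<close>.\<close>

lemma folded_nearly_mixing:
  assumes g: "g \<in> C_leb" and N: "N > 0" and e: "e > 0"
  shows "\<exists>m. odd m \<and> folded g N m \<in> nearly_mixing q e"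
proof -
  define \<phi> where "\<phi> = centred_arc q"
  have \<phi>: "test_function \<phi>" unfolding \<phi>_def by (rule centred_arc_test_function)
  then have \<phi>b: "bounded_borel \<phi>" and \<phi>1: "\<And>x. \<bar>\<phi> x\<bar> \<le> 1"
    by (simp_all add: test_function_bounded_borel test_function_def)
  have "e / 2 > 0" using e by simp
  from folded_decorrelates[OF g N \<phi> this] obtain M n0 where
    D: "\<And>m c b \<psi> n. m \<ge> M \<Longrightarrow> odd m \<Longrightarrow> test_function \<psi> \<Longrightarrow> (\<integral>x. \<psi> x \<partial>circle_measure) = 0 \<Longrightarrow> n \<ge> n0 \<Longrightarrow>
      \<bar>\<integral>x. \<phi> (rotation b x) * \<psi> (((\<lambda>x. rotation c (folded g N m x)) ^^ n) x) \<partial>circle_measure\<bar> \<le> e / 2" by blast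
  define m where "m = 2 * M + 1"
  have m: "odd m" "M \<le> m" by (auto simp: m_def)
  define f where "f = folded g N m"
  have f: "f \<in> C_leb" unfolding f_def by (rule folded_in_C_leb[OF g N m(1)])
  have "\<exists>k>0. correlation_sum (two_sided_rotation a b f) \<phi> k < e * (real k)\<^sup>2" for a b
  proof -
    define T where "T = two_sided_rotation a b f"
    have T: "T \<in> C_leb" unfolding T_def by (rule two_sided_rotation_in_C_leb[OF f])
    define S where "S x = rotation (a + b) (f x)" for x
    define \<psi> where "\<psi> x = \<phi> (rotation (- b) x)" for x
    have \<psi>: "test_function \<psi>" unfolding \<psi>_def[abs_def]
      by (rule test_function_comp[OF \<phi> C_leb_measurable[OF rotation_in_C_leb]])
    have \<psi>0: "(\<integral>x. \<psi> x \<partial>circle_measure) = 0"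
      using C_leb_integral[OF rotation_in_C_leb bounded_borelD[OF \<phi>b]] integral_centred_arc
      by (simp add: \<psi>_def \<phi>_def)
    have S: "S \<in> C_leb" unfolding S_def[abs_def] by (rule C_leb_comp[OF rotation_in_C_leb f])
    have far0: "\<bar>correlation T \<phi> 0 n\<bar> \<le> e / 2" if n: "n \<ge> n0" for n
    proof -
      have "correlation T \<phi> 0 n = (\<integral>x. \<psi> (rotation b x) * \<psi> ((S ^^ n) (rotation b x)) \<partial>circle_measure)"
        unfolding correlation_def T_def two_sided_rotation_funpow S_def \<psi>_def by simp
      also have "\<dots> = (\<integral>x. \<psi> x * \<psi> ((S ^^ n) x) \<partial>circle_measure)"
        by (rule C_leb_integral[OF rotation_in_C_leb bounded_borelD[OF bounded_borel_mult[OF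
          test_function_bounded_borel[OF \<psi>] bounded_borel_comp[OF test_function_bounded_borel[OF \<psi>]
            C_leb_measurable[OF C_leb_funpow[OF S]]]]]])
      finally show ?thesis
        using D[OF m(2,1) \<psi> \<psi>0 n, of "- b" "a + b"] by (simp add: S_def[abs_def] \<psi>_def f_def)
    qed
    have far: "\<bar>correlation T \<phi> i j\<bar> \<le> e / 2" if "i + n0 \<le> j \<or> j + n0 \<le> i" for i j
      using that
    proof
      assume "i + n0 \<le> j"
      then show ?thesis using correlation_shift[OF T \<phi>b, of 0 i "j - i"] far0[of "j - i"] by simp
    next
      assume "j + n0 \<le> i"
      then show ?thesis using correlation_shift[OF T \<phi>b, of 0 j "i - j"] far0[of "i - j"] correlation_sym[of T \<phi> i j] by simp
    qed
    have le1: "\<bar>correlation T \<phi> i j\<bar> \<le> 1" for i j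
    proof -
      have "\<bar>correlation T \<phi> i j\<bar> \<le> (\<integral>x. \<bar>\<phi> ((T ^^ i) x) * \<phi> ((T ^^ j) x)\<bar> \<partial>circle_measure)"
        unfolding correlation_def by (rule integral_abs_bound)
      also have "\<dots> \<le> (\<integral>x. 1 \<partial>circle_measure)"
      proof (rule integral_mono)
        show "integrable circle_measure (\<lambda>x. \<bar>\<phi> ((T ^^ i) x) * \<phi> ((T ^^ j) x)\<bar>)"
          by (rule integrable_abs[OF integrable_bounded_borel[OF bounded_borel_mult[OF 
            bounded_borel_comp[OF \<phi>b C_leb_measurable[OF C_leb_funpow[OF T]]]
            bounded_borel_comp[OF \<phi>b C_leb_measurable[OF C_leb_funpow[OF T]]]]]])
        show "\<bar>\<phi> ((T ^^ i) x) * \<phi> ((T ^^ j) x)\<bar> \<le> 1" for x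
          using mult_mono[OF \<phi>1 \<phi>1, of "(T ^^ j) x" "(T ^^ i) x"] by (simp add: abs_mult)
      qed simp
      also have "\<dots> = 1" using circle.prob_space by simp
      finally show ?thesis .
    qed
    obtain k :: nat where k: "4 * real n0 / e < real k" using reals_Archimedean2 by blast
    have "0 \<le> 4 * real n0 / e" using e by simp
    then have k0: "k > 0" using k by (cases k) auto
    have row: "(\<Sum>j<k. \<bar>correlation T \<phi> i j\<bar>) \<le> real k * (e / 2) + 2 * real n0" for i
    proof -
      define near where "near = {j. j < k \<and> j < i + n0 \<and> i < j + n0}"
      have "near \<subseteq> {i - n0..<i + n0}" unfolding near_def by auto
      then have "card near \<le> card {i - n0..<i + n0}" by (intro card_mono) auto
      also have "\<dots> \<le> 2 * n0" by simp
      finally have card: "card near \<le> 2 * n0" .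
      have "(\<Sum>j<k. \<bar>correlation T \<phi> i j\<bar>) \<le> (\<Sum>j<k. e / 2 + (if j \<in> near then 1 else 0))"
      proof (rule sum_mono)
        fix j assume "j \<in> {..<k}"
        then show "\<bar>correlation T \<phi> i j\<bar> \<le> e / 2 + (if j \<in> near then 1 else 0)"
          using far[of i j] le1[of i j] e by (auto simp: near_def not_less)
      qed
      also have "\<dots> = real k * (e / 2) + real (card near)"
      proof -
        have "{..<k} \<inter> near = near" by (auto simp: near_def)
        then have "(\<Sum>j<k. if j \<in> near then 1 else 0) = real (card near)"
          by (simp add: sum.If_cases)
        then show ?thesis by (simp add: sum.distrib)
      qed
      also have "\<dots> \<le> real k * (e / 2) + 2 * real n0" using card by simp
      finally show ?thesis .
    qed
    have "correlation_sum T \<phi> k \<le> (\<Sum>i<k. real k * (e / 2) + 2 * real n0)"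
      unfolding correlation_sum_def by (rule sum_mono) (rule row)
    also have "\<dots> = real k * (real k * (e / 2) + 2 * real n0)" by simp
    also have "\<dots> < real k * (real k * e)"
      using k k0 e by (intro mult_strict_left_mono) (auto simp: field_simps)
    also have "\<dots> = e * (real k)\<^sup>2" by (simp add: power2_eq_square)
    finally show ?thesis using k0 unfolding T_def by blast
  qed
  then have "f \<in> nearly_mixing q e" using f by (simp add: nearly_mixing_def \<phi>_def)
  then show ?thesis using m(1) unfolding f_def by blast
qed

text \<open>The folds move points by at most \<open>2 / N\<close>, and \<open>g\<close> is uniformly continuous. The bound does not depend
on \<open>m\<close>, which therefore remains free to make the correlations small.\<close>

lemma folded_close:
  assumes g: "g \<in> C_leb" and r: "r > 0"
  shows "\<exists>N>0. \<forall>m. unif_dist g (folded g N m) < r"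
proof -
  have "uniformly_continuous_on UNIV g"
    by (rule compact_uniformly_continuous[OF C_leb_continuous[OF g] compact_UNIV_circle])
  then obtain d where d: "d > 0" "\<And>x y. dist x y < d \<Longrightarrow> dist (g x) (g y) < r / 2"
    unfolding uniformly_continuous_on_def using r by (metis UNIV_I half_gt_zero)
  obtain N :: nat where N: "2 / d < real N" using reals_Archimedean2 by blast
  have "0 < 2 / d" using d by simp
  then have N0: "N > 0" using N by (cases N) auto
  have Nd: "2 / real N < d" using N d(1) N0 by (simp add: field_simps)
  have "unif_dist g (folded g N m) \<le> r / 2" for m
  proof (rule unif_dist_le)
    fix x
    have "dist x (shifted_fold_map N (fold_map N m x)) \<le> 
        dist (fold_map N m x) x + dist (shifted_fold_map N (fold_map N m x)) (fold_map N m x)"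
      by (metis dist_commute dist_triangle)
    also have "\<dots> \<le> 1 / real N + 1 / real N" by (intro add_mono dist_fold_map[OF N0] dist_shifted_fold_map[OF N0])
    also have "\<dots> < d" using Nd by simp
    finally show "dist (g x) (folded g N m x) \<le> r / 2"
      unfolding folded_def by (intro less_imp_le d(2))
  qed
  moreover have "r / 2 < r" using r by simp
  ultimately have "unif_dist g (folded g N m) < r" for m by (rule le_less_trans)
  then show ?thesis using N0 by (intro exI[of _ N]) simp
qed

lemma dense_nearly_mixing:
  assumes e: "e > 0" shows "C_leb.mtopology closure_of (nearly_mixing q e) = C_leb"
  unfolding C_leb.metric_closure_of
proof (intro equalityI subsetI CollectI conjI allI impI)
  fix g and r :: real assume g: "g \<in> C_leb" and r: "0 < r"
  obtain N where N: "N > 0" "\<And>m. unif_dist g (folded g N m) < r" using folded_close[OF g r] by blast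
  obtain m where m: "odd m" "folded g N m \<in> nearly_mixing q e" using folded_nearly_mixing[OF g N(1) e] by blast
  then show "\<exists>y\<in>nearly_mixing q e. y \<in> C_leb.mball g r"
    using g N(2)[of m] folded_in_C_leb[OF g N(1) m(1)] by (intro bexI[of _ "folded g N m"]) (auto simp: C_leb.in_mball)
qed auto

lemma two_sided_rotation_twice:
  "two_sided_rotation a b (two_sided_rotation c d f) = two_sided_rotation (c + a) (b + d) f"
  by (auto simp: two_sided_rotation_def fun_eq_iff)

theorem theorem2:
  shows "\<exists>\<G>. \<G> \<subseteq> C_leb
           \<and> gdelta_in C_leb_topology \<G>
           \<and> C_leb_topology closure_of \<G> = C_leb
           \<and> (\<forall>g\<in>\<G>. weakly_mixing g)
           \<and> (\<forall>\<alpha>\<in>{0..<1}. \<forall>\<beta>\<in>{0..<1}. \<forall>f\<in>\<G>. two_sided_rotation \<alpha> \<beta> f \<in> \<G>)"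
proof -
  define \<F> where "\<F> = (\<lambda>(q, n). nearly_mixing q (1 / real (Suc n))) ` (\<rat> \<times> UNIV)"
  have count: "countable \<F>" unfolding \<F>_def by (intro countable_image countable_SIGMA countable_rat) auto
  have nonempty: "\<F> \<noteq> {}" unfolding \<F>_def using Rats_0 by blast
  have mem: "f \<in> \<Inter>\<F> \<longleftrightarrow> (\<forall>q\<in>\<rat>. \<forall>n. f \<in> nearly_mixing q (1 / real (Suc n)))" for f
    unfolding \<F>_def by auto
  have op: "openin C_leb.mtopology U" and dense: "C_leb.mtopology closure_of U = C_leb" if "U \<in> \<F>" for U
    using that openin_nearly_mixing dense_nearly_mixing unfolding \<F>_def by auto
  have sub: "\<Inter>\<F> \<subseteq> C_leb" using nonempty openin_subset[OF op] by fastforce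
  have gdelta: "gdelta_in C_leb.mtopology (\<Inter>\<F>)"
    using count nonempty op by (intro gdelta_in_Inter open_imp_gdelta_in)
  have closure: "C_leb.mtopology closure_of \<Inter>\<F> = C_leb"
    using op dense by (intro C_leb.metric_Baire_category[OF C_leb_mcomplete count]) blast
  have wm: "weakly_mixing f" if f: "f \<in> \<Inter>\<F>" for f
  proof (rule weakly_mixing_if_correlations_small)
    show "f \<in> C_leb" using f sub by blast
    fix q e :: real assume q: "q \<in> \<rat>" and e: "0 < e"
    obtain n where n: "1 / real (Suc n) < e" using e nat_approx_posE by blast
    have "f \<in> nearly_mixing q (1 / real (Suc n))" using f q mem by blast
    then obtain m where m: "m > 0" "correlation_sum (two_sided_rotation 0 0 f) (centred_arc q) m < 1 / real (Suc n) * (real m)\<^sup>2"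
      unfolding nearly_mixing_def by blast
    have "two_sided_rotation 0 0 f = f" by (auto simp: two_sided_rotation_def)
    moreover have "1 / real (Suc n) * (real m)\<^sup>2 \<le> e * (real m)\<^sup>2" using n by (intro mult_right_mono) auto
    ultimately show "\<exists>m>0. correlation_sum f (centred_arc q) m \<le> e * (real m)\<^sup>2" using m by (intro exI[of _ m]) auto
  qed
  have inv: "two_sided_rotation a b f \<in> \<Inter>\<F>" if f: "f \<in> \<Inter>\<F>" for f a b
    using f unfolding mem nearly_mixing_def by (auto simp: two_sided_rotation_twice two_sided_rotation_in_C_leb)
  show ?thesis unfolding C_leb_topology_def
    by (intro exI[of _ "\<Inter>\<F>"] conjI ballI sub gdelta closure wm inv)
qed

end
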